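(* Let $I\subset S_L=L[x_1,\ldots,x_n]$ be a graded ideal and let $V\subset \mathrm{GL}_n(K)$ be a subvariety. Then there exists a Zariski-open set $\emptyset\neq U\subset V$ such that the Gröbner complex $\mathrm{GC}(g(I))$ is the same polyhedral complex for all $g\in U$.
   Context: $K$ is an algebraically closed field. $L=K\{\!\{t\}\!\}$ is the field of generalized power series over $K$: formal sums $f=\sum_{\nu\in\mathbb{R}}c_\nu t^\nu$ with $c_\nu\in K$ and $\{\nu: c_\nu\neq 0\}$ well-ordered, with addition and multiplication as for polynomials. It is algebraically closed and has the valuation $v(f)=\min\{\nu: c_\nu\ne 0\}$ for $f\neq 0$, $v(0)=\infty$. Let $R_L=\{a\in L: v(a)\ge 0\}$; for $a\in R_L$ let $\overline a$ be its image in the residue field of $R_L$, which is identified with $K$ (so $\overline a$ is the coefficient of $t^0$). $S_L=L[x_1,\ldots,x_n]$ and $S_K=K[x_1,\ldots,x_n]$ carry the standard $\mathbb{Z}$-grading; "graded ideal" refers to this grading. For $0\neq f=\sum_\nu a_\nu x^\nu\in S_L$ and $\omega\in\mathbb{R}^n$ put $W=\min_\nu\{v(a_\nu)+\omega\cdot\nu\}$ and $\mathrm{in}_\omega(f)=\overline{t^{-W}f(x_1t^{\omega_1},\ldots,x_nt^{\omega_n})}\in S_K$ (residue taken coefficientwise); $\mathrm{in}_\omega(0)=0$. For a graded ideal $I\subset S_L$, $\mathrm{in}_\omega(I)\subset S_K$ is the ideal generated by all $\mathrm{in}_\omega(f)$, $f\in I$. For a graded ideal $I\subset S_L$ each set $\{\omega'\in\mathbb{R}^n: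 \mathrm{in}_{\omega'}(I)=\mathrm{in}_\omega(I)\}$ is the relative interior of a polyhedron, and the closures of these sets form a polyhedral complex in $\mathbb{R}^n$, the Gröbner complex $\mathrm{GC}(I)$. $\mathrm{GL}_n(K)$ is equipped with the Zariski topology (as a subset of $K^{n\times n}$). A subvariety of $\mathrm{GL}_n(K)$ is a non-empty irreducible closed subset, with the induced topology. An element $g=(g_{ij})\in \mathrm{GL}_n(K)$ is identified with the $L$-algebra automorphism of $S_L$ given by $x_i\mapsto\sum_{j=1}^n g_{ji}x_j$, and $g(I)$ is the image of $I$. *)

theory Defs
  imports
    "HOL-Analysis.Analysis"
    "HOL-Computational_Algebra.Polynomial"
    "HOL-Library.Poly_Mapping"
begin

section \<open>Well-ordered sets of real numbers\<close>

abbreviation well_ordered :: "real set \<Rightarrow> bool" where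
  "well_ordered A \<equiv> wfp_on A (<)"

lemma well_ordered_iff:
  "well_ordered A \<longleftrightarrow> (\<forall>B\<subseteq>A. B \<noteq> {} \<longrightarrow> (\<exists>m\<in>B. \<forall>x\<in>B. m \<le> x))"
  unfolding wfp_on_iff_ex_minimal by (meson not_less)

lemma well_ordered_min:
  assumes "well_ordered A" "B \<subseteq> A" "x \<in> B"
  obtains m where "m \<in> B" "\<And>y. y \<in> B \<Longrightarrow> m \<le> y"
  using assms unfolding well_ordered_iff by (metis empty_iff)

lemma well_ordered_Un:
  assumes A: "well_ordered A" and B: "well_ordered B"
  shows "well_ordered (A \<union> B)"
  unfolding well_ordered_iff
proof (intro allI impI)
  fix C assume C: "C \<subseteq> A \<union> B" "C \<noteq> {}"
  show "\<exists>m\<in>C. \<forall>x\<in>C. m \<le> x"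
  proof (cases "C \<inter> A = {} \<or> C \<inter> B = {}")
    case True
    then have "C \<subseteq> B \<or> C \<subseteq> A" using C by blast
    then show ?thesis using A B C(2) unfolding well_ordered_iff by blast
  next
    case False
    obtain m where m: "m \<in> C \<inter> A" "\<And>y. y \<in> C \<inter> A \<Longrightarrow> m \<le> y"
      using False well_ordered_min[OF A, of "C \<inter> A"] by blast
    obtain k where k: "k \<in> C \<inter> B" "\<And>y. y \<in> C \<inter> B \<Longrightarrow> k \<le> y"
      using False well_ordered_min[OF B, of "C \<inter> B"] by blast
    have "min m k \<in> C" using m(1) k(1) by (simp add: min_def)
    moreover have "min m k \<le> x" if "x \<in> C" for x
      using that C(1) m(2)[of x] k(2)[of x] by (auto simp: min_le_iff_disj)
    ultimately show ?thesis by blast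
  qed
qed

lemma well_ordered_no_descent:
  fixes s :: "nat \<Rightarrow> real"
  assumes "well_ordered A" "\<And>n. s n \<in> A" "\<And>n. s (Suc n) < s n"
  shows False
proof -
  obtain m where "m \<in> range s" "\<And>y. y \<in> range s \<Longrightarrow> m \<le> y"
    using well_ordered_min[OF assms(1), of "range s" "s 0"] assms(2) by blast
  then show False using assms(3) by (metis imageE not_less rangeI)
qed

lemma well_ordered_plus:
  assumes A: "well_ordered A" and B: "well_ordered B"
  shows "well_ordered {a + b | a b. a \<in> A \<and> b \<in> B}"
  unfolding well_ordered_iff
proof (intro allI impI, rule ccontr)
  fix C assume C: "C \<subseteq> {a + b | a b. a \<in> A \<and> b \<in> B}" "C \<noteq> {}"
    and "\<not> (\<exists>m\<in>C. \<forall>x\<in>C. m \<le> x)"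
  then have desc: "\<forall>m\<in>C. \<exists>x\<in>C. x < m" by (meson not_less)
  obtain x0 where x0: "x0 \<in> C" using C(2) by blast
  obtain c where c: "\<And>n. c n \<in> C" "\<And>n. c (Suc n) < c n"
    using dependent_nat_choice[of "\<lambda>n x. x \<in> C" "\<lambda>n x y. y < x"] desc x0 by metis
  have "\<forall>n. \<exists>a b. a \<in> A \<and> b \<in> B \<and> c n = a + b" using c(1) C(1) by blast
  then obtain a b where ab: "\<And>n. a n \<in> A" "\<And>n. b n \<in> B" "\<And>n. c n = a n + b n" by metis
  obtain f where f: "strict_mono f" "monoseq (\<lambda>n. a (f n))" using seq_monosub by blast
  have cdec: "c (f (Suc n)) < c (f n)" for n
  proof -
    have "f n < f (Suc n)" using f(1) by (simp add: strict_mono_def)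
    then show ?thesis using c(2) by (rule lift_Suc_mono_less[of "\<lambda>n. - c n", simplified, rotated])
  qed
  have "\<exists>N. \<forall>n\<ge>N. a (f n) \<le> a (f (Suc n))"
  proof -
    consider "\<forall>m n. m \<le> n \<longrightarrow> a (f m) \<le> a (f n)" | "\<forall>m n. m \<le> n \<longrightarrow> a (f n) \<le> a (f m)"
      using f(2) unfolding monoseq_def by blast
    then show ?thesis
    proof cases
      case 1 then show ?thesis by simp
    next
      case 2
      obtain m where m: "m \<in> range (\<lambda>n. a (f n))" "\<And>y. y \<in> range (\<lambda>n. a (f n)) \<Longrightarrow> m \<le> y"
        using well_ordered_min[OF A, of "range (\<lambda>n. a (f n))" "a (f 0)"] ab(1) by blast
      then obtain N where N: "m = a (f N)" by blast
      have "a (f n) \<le> a (f (Suc n))" if "n \<ge> N" for n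
      proof -
        have "a (f n) \<le> a (f N)" using 2 that by blast
        also have "\<dots> \<le> a (f (Suc n))" using m(2) N by blast
        finally show ?thesis .
      qed
      then show ?thesis by blast
    qed
  qed
  then obtain N where N: "\<And>n. n \<ge> N \<Longrightarrow> a (f n) \<le> a (f (Suc n))" by blast
  have "b (f (Suc (N + n))) < b (f (N + n))" for n
    using cdec[of "N + n"] N[of "N + n"] unfolding ab(3) by simp
  then show False
    using well_ordered_no_descent[OF B, of "\<lambda>n. b (f (N + n))"] ab(2) by simp
qed

lemma finite_two_sided_well_ordered:
  assumes S: "well_ordered S" "well_ordered (uminus ` S)"
  shows "finite S"
proof (rule ccontr)
  assume inf: "infinite S"
  define U where "U x = {y \<in> S. x \<le> y}" for x
  define T where "T = {x \<in> S. infinite (U x)}"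
  have "S \<noteq> {}" using inf by auto
  then obtain m where m: "m \<in> S" "\<And>y. y \<in> S \<Longrightarrow> m \<le> y"
    using well_ordered_min[OF S(1), of S] by blast
  then have "U m = S" by (auto simp: U_def)
  then have "m \<in> T" using inf m(1) by (simp add: T_def)
  moreover have "T \<subseteq> S" by (auto simp: T_def)
  ultimately obtain z where z: "z \<in> uminus ` T" "\<And>y. y \<in> uminus ` T \<Longrightarrow> z \<le> y"
    using well_ordered_min[OF S(2) image_mono imageI] by metis
  then obtain x where x: "x \<in> T" "z = - x" by blast
  have x_max: "y \<le> x" if "y \<in> T" for y
    using z(2)[of "- y"] that x(2) by simp
  define W where "W = {y \<in> S. x < y}"
  have "U x \<subseteq> insert x W" by (auto simp: U_def W_def)
  moreover have "infinite (U x)" using x(1) by (simp add: T_def)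
  ultimately have inf': "infinite W" by (meson finite_insert finite_subset)
  then have "W \<noteq> {}" by auto
  moreover have "W \<subseteq> S" by (auto simp: W_def)
  ultimately obtain w where w: "w \<in> W" "\<And>y. y \<in> W \<Longrightarrow> w \<le> y"
    using well_ordered_min[OF S(1), of W] by blast
  then have "W \<subseteq> U w" by (auto simp: U_def W_def)
  then have "infinite (U w)" using inf' finite_subset by blast
  then have "w \<in> T" using w(1) by (simp add: T_def W_def)
  then show False using x_max[of w] w(1) by (simp add: W_def)
qed

lemma finite_well_ordered_decompositions:
  assumes A: "well_ordered A" and B: "well_ordered B"
  shows "finite {(a, b). a \<in> A \<and> b \<in> B \<and> a + b = (c::real)}"
proof -
  define S where "S = {a \<in> A. c - a \<in> B}"
  have "well_ordered S" using A by (rule wfp_on_subset) (auto simp: S_def)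
  moreover have "well_ordered (uminus ` S)"
    unfolding well_ordered_iff
  proof (intro allI impI)
    fix D assume D: "D \<subseteq> uminus ` S" "D \<noteq> {}"
    then obtain d where d: "d \<in> D" by blast
    have "(+) c ` D \<subseteq> B" using D(1) by (auto simp: S_def)
    then obtain m where m: "m \<in> (+) c ` D" "\<And>y. y \<in> (+) c ` D \<Longrightarrow> m \<le> y"
      using well_ordered_min[OF B _ imageI[OF d]] by metis
    then obtain e where e: "e \<in> D" "m = c + e" by blast
    have "e \<le> x" if "x \<in> D" for x using m(2)[of "c + x"] that e(2) by simp
    then show "\<exists>m\<in>D. \<forall>x\<in>D. m \<le> x" using e(1) by blast
  qed
  ultimately have "finite S" by (rule finite_two_sided_well_ordered)
  then have "finite ((\<lambda>a. (a, c - a)) ` S)" by (rule finite_imageI)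
  moreover have "{(a, b). a \<in> A \<and> b \<in> B \<and> a + b = c} \<subseteq> (\<lambda>a. (a, c - a)) ` S"
    by (auto simp: S_def image_iff)
  ultimately show ?thesis by (rule finite_subset[rotated])
qed


section \<open>The field of generalized power series\<close>

typedef (overloaded) 'a hahn = "{f :: real \<Rightarrow> 'a::zero. well_ordered {\<nu>. f \<nu> \<noteq> 0}}"
  morphisms hcoeff Abs_hahn
  by (rule exI[of _ "\<lambda>_. 0"]) (simp add: wfp_on_def)

setup_lifting type_definition_hahn

abbreviation hsupp :: "'a::zero hahn \<Rightarrow> real set" where
  "hsupp f \<equiv> {\<nu>. hcoeff f \<nu> \<noteq> 0}"

lemma well_ordered_hsupp: "well_ordered (hsupp f)"
  using hcoeff[of f] by simp

lemma hahn_eqI: "(\<And>\<nu>. hcoeff f \<nu> = hcoeff g \<nu>) \<Longrightarrow> f = g"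
  by (simp add: hcoeff_inject[symmetric] fun_eq_iff)

lemma well_ordered_singleton: "well_ordered {x}"
  unfolding well_ordered_iff by (auto simp: subset_singleton_iff)

instantiation hahn :: (ab_group_add) ab_group_add
begin

lift_definition zero_hahn :: "'a hahn" is "\<lambda>_. 0"
  by (simp add: wfp_on_def)

lift_definition plus_hahn :: "'a hahn \<Rightarrow> 'a hahn \<Rightarrow> 'a hahn" is "\<lambda>f g \<nu>. f \<nu> + g \<nu>"
  by (rule wfp_on_subset, erule (1) well_ordered_Un) auto

lift_definition uminus_hahn :: "'a hahn \<Rightarrow> 'a hahn" is "\<lambda>f \<nu>. - f \<nu>"
  by simp

lift_definition minus_hahn :: "'a hahn \<Rightarrow> 'a hahn \<Rightarrow> 'a hahn" is "\<lambda>f g \<nu>. f \<nu> - g \<nu>"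
  by (rule wfp_on_subset, erule (1) well_ordered_Un) auto

instance
  by standard (transfer, simp add: fun_eq_iff algebra_simps)+

end

lemmas hcoeff_arith [simp] =
  zero_hahn.rep_eq plus_hahn.rep_eq uminus_hahn.rep_eq minus_hahn.rep_eq

text \<open>The monomial \<open>c t\<^sup>\<alpha>\<close>.\<close>

lift_definition hmonom :: "'a::zero \<Rightarrow> real \<Rightarrow> 'a hahn" is
  "\<lambda>c \<alpha> \<nu>. if \<nu> = \<alpha> then c else 0"
  by (rule wfp_on_subset[OF well_ordered_singleton]) auto

lemma hcoeff_hmonom: "hcoeff (hmonom c \<alpha>) \<nu> = (if \<nu> = \<alpha> then c else 0)"
  by transfer simp

instantiation hahn :: (comm_ring_1) comm_ring_1
begin

definition one_hahn :: "'a hahn" where "1 = hmonom 1 0"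

lift_definition times_hahn :: "'a hahn \<Rightarrow> 'a hahn \<Rightarrow> 'a hahn" is
  "\<lambda>f g \<nu>. \<Sum>(\<alpha>, \<beta>)\<in>{(\<alpha>, \<beta>). f \<alpha> \<noteq> 0 \<and> g \<beta> \<noteq> 0 \<and> \<alpha> + \<beta> = \<nu>}. f \<alpha> * g \<beta>"
proof -
  fix f g :: "real \<Rightarrow> 'a"
  assume "well_ordered {\<nu>. f \<nu> \<noteq> 0}" "well_ordered {\<nu>. g \<nu> \<noteq> 0}"
  then have "well_ordered {a + b | a b. a \<in> {\<nu>. f \<nu> \<noteq> 0} \<and> b \<in> {\<nu>. g \<nu> \<noteq> 0}}"
    by (rule well_ordered_plus)
  moreover have "{\<nu>. (\<Sum>(\<alpha>, \<beta>)\<in>{(\<alpha>, \<beta>). f \<alpha> \<noteq> 0 \<and> g \<beta> \<noteq> 0 \<and> \<alpha> + \<beta> = \<nu>}. f \<alpha> * g \<beta>) \<noteq> 0}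
      \<subseteq> {a + b | a b. a \<in> {\<nu>. f \<nu> \<noteq> 0} \<and> b \<in> {\<nu>. g \<nu> \<noteq> 0}}"
  proof
    fix \<nu> assume "\<nu> \<in> {\<nu>. (\<Sum>(\<alpha>, \<beta>)\<in>{(\<alpha>, \<beta>). f \<alpha> \<noteq> 0 \<and> g \<beta> \<noteq> 0 \<and> \<alpha> + \<beta> = \<nu>}. f \<alpha> * g \<beta>) \<noteq> 0}"
    then obtain p where "p \<in> {(\<alpha>, \<beta>). f \<alpha> \<noteq> 0 \<and> g \<beta> \<noteq> 0 \<and> \<alpha> + \<beta> = \<nu>}"
      by (elim CollectE) (rule sum.not_neutral_contains_not_neutral)
    then show "\<nu> \<in> {a + b | a b. a \<in> {\<nu>. f \<nu> \<noteq> 0} \<and> b \<in> {\<nu>. g \<nu> \<noteq> 0}}" by blast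
  qed
  ultimately show "well_ordered {\<nu>. (\<Sum>(\<alpha>, \<beta>)\<in>{(\<alpha>, \<beta>). f \<alpha> \<noteq> 0 \<and> g \<beta> \<noteq> 0 \<and> \<alpha> + \<beta> = \<nu>}.
      f \<alpha> * g \<beta>) \<noteq> 0}"
    by (rule wfp_on_subset)
qed

lemma hcoeff_times_superset:
  fixes f g :: "'a hahn"
  assumes "well_ordered A" "well_ordered B" "hsupp f \<subseteq> A" "hsupp g \<subseteq> B"
  shows "hcoeff (f * g) \<nu> =
    (\<Sum>(\<alpha>, \<beta>)\<in>{(\<alpha>, \<beta>). \<alpha> \<in> A \<and> \<beta> \<in> B \<and> \<alpha> + \<beta> = \<nu>}. hcoeff f \<alpha> * hcoeff g \<beta>)"
  unfolding times_hahn.rep_eq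
  by (rule sum.mono_neutral_left) (use assms finite_well_ordered_decompositions[of A B \<nu>] in auto)

lemma hsupp_times:
  fixes f g :: "'a hahn"
  shows "hsupp (f * g) \<subseteq> {a + b | a b. a \<in> hsupp f \<and> b \<in> hsupp g}"
proof
  fix \<nu> assume "\<nu> \<in> hsupp (f * g)"
  then have "(\<Sum>(\<alpha>, \<beta>)\<in>{(\<alpha>, \<beta>). hcoeff f \<alpha> \<noteq> 0 \<and> hcoeff g \<beta> \<noteq> 0 \<and> \<alpha> + \<beta> = \<nu>}.
      hcoeff f \<alpha> * hcoeff g \<beta>) \<noteq> 0"
    by (simp add: times_hahn.rep_eq)
  then obtain p where "p \<in> {(\<alpha>, \<beta>). hcoeff f \<alpha> \<noteq> 0 \<and> hcoeff g \<beta> \<noteq> 0 \<and> \<alpha> + \<beta> = \<nu>}"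
    by (rule sum.not_neutral_contains_not_neutral)
  then show "\<nu> \<in> {a + b | a b. a \<in> hsupp f \<and> b \<in> hsupp g}" by blast
qed

lemma hahn_mult_commute: "(f::'a hahn) * g = g * f"
proof (rule hahn_eqI)
  fix \<nu>
  show "hcoeff (f * g) \<nu> = hcoeff (g * f) \<nu>"
    unfolding times_hahn.rep_eq
    by (rule sum.reindex_bij_witness[of _ prod.swap prod.swap]) (auto simp: mult.commute add.commute)
qed

lemma hahn_distrib: "((f::'a hahn) + g) * h = f * h + g * h"
proof (rule hahn_eqI)
  fix \<nu>
  let ?A = "hsupp f \<union> hsupp g"
  have A: "well_ordered ?A" by (intro well_ordered_Un well_ordered_hsupp)
  have "hcoeff (u * h) \<nu> =
    (\<Sum>(\<alpha>, \<beta>)\<in>{(\<alpha>, \<beta>). \<alpha> \<in> ?A \<and> \<beta> \<in> hsupp h \<and> \<alpha> + \<beta> = \<nu>}. hcoeff u \<alpha> * hcoeff h \<beta>)"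
    if "hsupp u \<subseteq> ?A" for u
    by (rule hcoeff_times_superset) (use that A well_ordered_hsupp in auto)
  moreover have "hsupp (f + g) \<subseteq> ?A" by auto
  ultimately show "hcoeff ((f + g) * h) \<nu> = hcoeff (f * h + g * h) \<nu>"
    by (simp only: plus_hahn.rep_eq Un_upper1 Un_upper2)
      (simp add: sum.distrib[symmetric] distrib_right split_def)
qed

lemma hahn_mult_assoc: "(f * g) * h = (f::'a hahn) * (g * h)"
proof (rule hahn_eqI)
  fix \<nu>
  let ?F = "hsupp f" and ?G = "hsupp g" and ?H = "hsupp h"
  define FG where "FG = {a + b | a b. a \<in> ?F \<and> b \<in> ?G}"
  define GH where "GH = {a + b | a b. a \<in> ?G \<and> b \<in> ?H}"
  have wo: "well_ordered ?F" "well_ordered ?G" "well_ordered ?H"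
    by (rule well_ordered_hsupp)+
  have woFG: "well_ordered FG" "well_ordered GH"
    unfolding FG_def GH_def by (intro well_ordered_plus wo)+
  let ?P = "\<lambda>A B c. {(\<alpha>, \<beta>). \<alpha> \<in> A \<and> \<beta> \<in> B \<and> \<alpha> + \<beta> = (c::real)}"
  have fin: "finite (?P FG ?H c)" "finite (?P ?F ?G c)" "finite (?P ?F GH c)" "finite (?P ?G ?H c)" for c
    by (intro finite_well_ordered_decompositions wo woFG)+
  have "hcoeff ((f * g) * h) \<nu> = (\<Sum>(d, c)\<in>?P FG ?H \<nu>. hcoeff (f * g) d * hcoeff h c)"
    by (rule hcoeff_times_superset) (use woFG wo hsupp_times[of f g] FG_def in auto)
  also have "\<dots> = (\<Sum>p\<in>?P FG ?H \<nu>. \<Sum>q\<in>?P ?F ?G (fst p).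
      hcoeff f (fst q) * hcoeff g (snd q) * hcoeff h (snd p))"
    by (intro sum.cong refl) (simp add: times_hahn.rep_eq sum_distrib_right split_def)
  also have "\<dots> = (\<Sum>(p, q)\<in>(SIGMA p:?P FG ?H \<nu>. ?P ?F ?G (fst p)).
      hcoeff f (fst q) * hcoeff g (snd q) * hcoeff h (snd p))"
    by (rule sum.Sigma) (intro fin ballI)+
  also have "\<dots> = (\<Sum>(p, q)\<in>(SIGMA p:?P ?F GH \<nu>. ?P ?G ?H (snd p)).
      hcoeff f (fst p) * (hcoeff g (fst q) * hcoeff h (snd q)))"
    by (rule sum.reindex_bij_witness
        [of _ "\<lambda>((a, e), (b, c)). ((a + b, c), (a, b))" "\<lambda>((d, c), (a, b)). ((a, b + c), (b, c))"])
      (auto simp: FG_def GH_def mult.assoc)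
  also have "\<dots> = (\<Sum>p\<in>?P ?F GH \<nu>. \<Sum>q\<in>?P ?G ?H (snd p).
      hcoeff f (fst p) * (hcoeff g (fst q) * hcoeff h (snd q)))"
    by (rule sum.Sigma[symmetric]) (intro fin ballI)+
  also have "\<dots> = (\<Sum>(a, e)\<in>?P ?F GH \<nu>. hcoeff f a * hcoeff (g * h) e)"
    by (intro sum.cong refl) (simp add: times_hahn.rep_eq sum_distrib_left split_def)
  also have "\<dots> = hcoeff (f * (g * h)) \<nu>"
    by (rule hcoeff_times_superset[symmetric]) (use woFG wo hsupp_times[of g h] GH_def in auto)
  finally show "hcoeff ((f * g) * h) \<nu> = hcoeff (f * (g * h)) \<nu>" .
qed

lemma hcoeff_hmonom_times: "hcoeff (hmonom c \<alpha> * (f::'a hahn)) \<nu> = c * hcoeff f (\<nu> - \<alpha>)"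
proof -
  let ?P = "{(a, b). a \<in> {\<alpha>} \<and> b \<in> insert (\<nu> - \<alpha>) (hsupp f) \<and> a + b = \<nu>}"
  have "well_ordered ({\<nu> - \<alpha>} \<union> hsupp f)"
    by (intro well_ordered_Un well_ordered_singleton well_ordered_hsupp)
  then have "hcoeff (hmonom c \<alpha> * f) \<nu> = (\<Sum>(a, b)\<in>?P. hcoeff (hmonom c \<alpha>) a * hcoeff f b)"
    by (intro hcoeff_times_superset well_ordered_singleton)
      (auto simp: hcoeff_hmonom split: if_splits)
  also have "?P = {(\<alpha>, \<nu> - \<alpha>)}" by auto
  finally show ?thesis by (simp add: hcoeff_hmonom)
qed

instance
proof
  fix f g h :: "'a hahn"
  show "f * g * h = f * (g * h)" by (rule hahn_mult_assoc)
  show "f * g = g * f" by (rule hahn_mult_commute)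
  show "1 * f = f" by (rule hahn_eqI) (simp add: one_hahn_def hcoeff_hmonom_times)
  show "(f + g) * h = f * h + g * h" by (rule hahn_distrib)
  show "(0::'a hahn) \<noteq> 1"
  proof
    assume "(0::'a hahn) = 1"
    then have "hcoeff (0::'a hahn) 0 = hcoeff 1 0" by simp
    then show False by (simp add: one_hahn_def hcoeff_hmonom)
  qed
qed

end

lemma hmonom_mult_hmonom:
  "hmonom c \<alpha> * hmonom d \<beta> = hmonom (c * d) (\<alpha> + \<beta>)" for c d :: "'a::comm_ring_1"
  by (rule hahn_eqI) (auto simp: hcoeff_hmonom_times hcoeff_hmonom)

lemma hahn_geometric_inverse:
  fixes h :: "'a::comm_ring_1 hahn"
  assumes pos: "\<And>\<nu>. hcoeff h \<nu> \<noteq> 0 \<Longrightarrow> 0 < \<nu>"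
  obtains g where "(1 - h) * g = 1"
proof -
  obtain \<delta> where \<delta>: "0 < \<delta>" "\<And>\<nu>. hcoeff h \<nu> \<noteq> 0 \<Longrightarrow> \<delta> \<le> \<nu>"
  proof (cases "hsupp h = {}")
    case True then show ?thesis by (intro that[of 1]) auto
  next
    case False
    then obtain m where "m \<in> hsupp h" "\<And>\<nu>. \<nu> \<in> hsupp h \<Longrightarrow> m \<le> \<nu>"
      using well_ordered_min[OF well_ordered_hsupp[of h], of "hsupp h"] by blast
    then show ?thesis using pos by (intro that[of m]) auto
  qed
  have pow: "real k * \<delta> \<le> \<nu>" if "hcoeff (h ^ k) \<nu> \<noteq> 0" for k \<nu>
    using that
  proof (induction k arbitrary: \<nu>)
    case 0 then show ?case by (auto simp: one_hahn_def hcoeff_hmonom split: if_splits)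
  next
    case (Suc k)
    then obtain a b where "\<nu> = a + b" "hcoeff h a \<noteq> 0" "hcoeff (h ^ k) b \<noteq> 0"
      using hsupp_times[of h "h ^ k"] by auto
    then show ?case using Suc.IH[of b] \<delta>(2)[of a] by (simp add: algebra_simps)
  qed
  define G where "G N = (\<Sum>k\<le>N. h ^ k)" for N
  have hcoeff_sum: "hcoeff (sum F S) \<nu> = (\<Sum>k\<in>S. hcoeff (F k) \<nu>)"
    for F :: "nat \<Rightarrow> 'a hahn" and S \<nu>
    by (induction S rule: infinite_finite_induct) auto
  have stable: "hcoeff (G M) \<nu> = hcoeff (G N) \<nu>" if "N \<le> M" "\<nu> < real (Suc N) * \<delta>" for M N \<nu>
    unfolding G_def hcoeff_sum
  proof (rule sum.mono_neutral_right)
    show "\<forall>i\<in>{..M} - {..N}. hcoeff (h ^ i) \<nu> = 0"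
    proof
      fix i assume "i \<in> {..M} - {..N}"
      then have "real (Suc N) * \<delta> \<le> real i * \<delta>" using \<delta>(1) by simp
      then show "hcoeff (h ^ i) \<nu> = 0" using pow[of i \<nu>] that(2) by force
    qed
  qed (use that in auto)
  define N where "N \<nu> = nat \<lceil>\<nu> / \<delta>\<rceil>" for \<nu>
  have N: "\<nu> < real (Suc (N \<nu>)) * \<delta>" for \<nu>
  proof -
    have "\<nu> / \<delta> < real (Suc (N \<nu>))" unfolding N_def by linarith
    then show ?thesis using \<delta>(1) by (simp add: divide_less_eq)
  qed
  define g0 where "g0 \<nu> = hcoeff (G (N \<nu>)) \<nu>" for \<nu>
  have g0: "g0 \<nu> = hcoeff (G M) \<nu>" if "\<nu> \<le> c" "N c \<le> M" for \<nu> c M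
  proof -
    have "N \<nu> \<le> N c"
      unfolding N_def using that(1) \<delta>(1) by (intro nat_mono ceiling_mono divide_right_mono) auto
    then show ?thesis unfolding g0_def using stable[OF _ N[of \<nu>], of M] that(2) by simp
  qed
  have "well_ordered {\<nu>. g0 \<nu> \<noteq> 0}"
    unfolding well_ordered_iff
  proof (intro allI impI)
    fix B assume B: "B \<subseteq> {\<nu>. g0 \<nu> \<noteq> 0}" "B \<noteq> {}"
    then obtain c where c: "c \<in> B" by blast
    have "B \<inter> {..c} \<subseteq> hsupp (G (N c))" using B(1) g0[of _ c "N c"] by auto
    then obtain m where "m \<in> B \<inter> {..c}" "\<And>y. y \<in> B \<inter> {..c} \<Longrightarrow> m \<le> y"
      using well_ordered_min[OF well_ordered_hsupp[of "G (N c)"], of "B \<inter> {..c}" c] c by blast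
    then show "\<exists>m\<in>B. \<forall>x\<in>B. m \<le> x" by (intro bexI[of _ m]) force+
  qed
  then have g: "hcoeff (Abs_hahn g0) = g0" by (simp add: Abs_hahn_inverse)
  have "(1 - h) * Abs_hahn g0 = 1"
  proof (rule hahn_eqI)
    fix \<nu>
    define M where "M = N \<nu>"
    let ?A = "hsupp (1 - h)"
    let ?B = "hsupp (Abs_hahn g0) \<union> hsupp (G M)"
    let ?P = "{(\<alpha>, \<beta>). \<alpha> \<in> ?A \<and> \<beta> \<in> ?B \<and> \<alpha> + \<beta> = \<nu>}"
    have wo: "well_ordered ?A" "well_ordered ?B"
      by (intro well_ordered_Un well_ordered_hsupp)+
    have nonneg: "0 \<le> \<alpha>" if "\<alpha> \<in> ?A" for \<alpha>
      using that pos[of \<alpha>] by (force simp: one_hahn_def hcoeff_hmonom split: if_splits)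
    have "hcoeff ((1 - h) * Abs_hahn g0) \<nu> =
        (\<Sum>(\<alpha>, \<beta>)\<in>?P. hcoeff (1 - h) \<alpha> * hcoeff (Abs_hahn g0) \<beta>)"
      by (rule hcoeff_times_superset) (use wo in auto)
    also have "\<dots> = (\<Sum>(\<alpha>, \<beta>)\<in>?P. hcoeff (1 - h) \<alpha> * hcoeff (G M) \<beta>)"
    proof (rule sum.cong[OF refl], clarify)
      fix \<alpha> \<beta> assume "hcoeff (1 - h) \<alpha> \<noteq> 0" "\<nu> = \<alpha> + \<beta>"
      then have "\<beta> \<le> \<nu>" using nonneg[of \<alpha>] by simp
      then have "g0 \<beta> = hcoeff (G M) \<beta>" by (rule g0) (simp add: M_def)
      then show "hcoeff (1 - h) \<alpha> * hcoeff (Abs_hahn g0) \<beta> = hcoeff (1 - h) \<alpha> * hcoeff (G M) \<beta>"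
        by (simp add: g)
    qed
    also have "\<dots> = hcoeff ((1 - h) * G M) \<nu>"
      by (rule hcoeff_times_superset[symmetric]) (use wo in auto)
    also have "(1 - h) * G M = 1 - h ^ Suc M"
      unfolding G_def by (rule sum_gp_basic)
    also have "hcoeff (1 - h ^ Suc M) \<nu> = hcoeff 1 \<nu>"
      using pow[of "Suc M" \<nu>] N[of \<nu>] unfolding M_def by force
    finally show "hcoeff ((1 - h) * Abs_hahn g0) \<nu> = hcoeff 1 \<nu>" .
  qed
  then show ?thesis by (rule that)
qed

lemma hahn_inverse_exists:
  fixes f :: "'a::field hahn"
  assumes "f \<noteq> 0"
  shows "\<exists>g. f * g = 1"
proof -
  have "hsupp f \<noteq> {}" using assms by (metis (mono_tags) empty_Collect_eq hahn_eqI zero_hahn.rep_eq)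
  then obtain m where m: "m \<in> hsupp f" "\<And>\<nu>. \<nu> \<in> hsupp f \<Longrightarrow> m \<le> \<nu>"
    using well_ordered_min[OF well_ordered_hsupp[of f], of "hsupp f"] by blast
  define u where "u = hmonom (inverse (hcoeff f m)) (- m)"
  have "hcoeff (1 - u * f) \<nu> \<noteq> 0 \<Longrightarrow> 0 < \<nu>" for \<nu>
    using m(1) m(2)[of "\<nu> + m"]
    by (cases "\<nu> = 0") (auto simp: u_def hcoeff_hmonom_times one_hahn_def hcoeff_hmonom)
  then obtain g where "(1 - (1 - u * f)) * g = 1" using hahn_geometric_inverse by blast
  then have "f * (u * g) = 1" by (simp add: algebra_simps)
  then show ?thesis by blast
qed

instantiation hahn :: (field) inverse
begin

definition inverse_hahn :: "'a hahn \<Rightarrow> 'a hahn" where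
  "inverse_hahn f = (if f = 0 then 0 else (SOME g. f * g = 1))"

definition divide_hahn :: "'a hahn \<Rightarrow> 'a hahn \<Rightarrow> 'a hahn" where
  "divide_hahn f g = f * inverse g"

instance ..

end

instance hahn :: (field) field
proof
  fix f g :: "'a hahn"
  show "inverse f * f = 1" if "f \<noteq> 0"
    using someI_ex[OF hahn_inverse_exists[OF that]] that
    by (simp add: inverse_hahn_def mult.commute)
  show "f div g = f * inverse g" by (rule divide_hahn_def)
  show "inverse (0::'a hahn) = 0" by (simp add: inverse_hahn_def)
qed

definition hval :: "'a::ab_group_add hahn \<Rightarrow> ereal" where
  "hval f = (if f = 0 then \<infinity> else ereal (LEAST \<nu>. hcoeff f \<nu> \<noteq> 0))"

text \<open>The residue map \<open>R\<^sub>L \<rightarrow> K\<close>; it is only meaningful on elements of non-negative valuation.\<close>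

definition hresidue :: "'a::zero hahn \<Rightarrow> 'a" where
  "hresidue a = hcoeff a 0"


section \<open>Polynomials in the variables indexed by a finite type\<close>

type_synonym ('n, 'a) mpoly = "('n \<Rightarrow>\<^sub>0 nat) \<Rightarrow>\<^sub>0 'a"

definition mconst :: "'a::zero \<Rightarrow> ('n, 'a) mpoly" where
  "mconst c = Poly_Mapping.single 0 c"

definition mvar :: "'n \<Rightarrow> ('n, 'a::zero_neq_one) mpoly" where
  "mvar i = Poly_Mapping.single (Poly_Mapping.single i 1) 1"

text \<open>For a ring homomorphism \<open>\<phi>\<close>, the homomorphism given by \<open>\<phi>\<close> on the coefficients and by \<open>x\<^sub>i \<mapsto> h i\<close> on the variables.\<close>

definition meval :: "('a::zero \<Rightarrow> 'b::comm_ring_1) \<Rightarrow> ('n::finite \<Rightarrow> 'b) \<Rightarrow> ('n, 'a) mpoly \<Rightarrow> 'b" where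
  "meval \<phi> h f = (\<Sum>m\<in>Poly_Mapping.keys f.
     \<phi> (Poly_Mapping.lookup f m) * (\<Prod>i\<in>UNIV. h i ^ Poly_Mapping.lookup m i))"

definition msubst :: "('n::finite \<Rightarrow> ('m, 'a) mpoly) \<Rightarrow> ('n, 'a::comm_ring_1) mpoly \<Rightarrow> ('m, 'a) mpoly" where
  "msubst = meval mconst"

lemma meval_superset:
  assumes "\<phi> 0 = 0" "finite S" "Poly_Mapping.keys f \<subseteq> S"
  shows "meval \<phi> h f = (\<Sum>m\<in>S.
     \<phi> (Poly_Mapping.lookup f m) * (\<Prod>i\<in>UNIV. h i ^ Poly_Mapping.lookup m i))"
  unfolding meval_def
  by (rule sum.mono_neutral_left) (use assms in \<open>auto simp: in_keys_iff\<close>)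

lemma meval_zero: "meval \<phi> h 0 = 0"
  by (simp add: meval_def)

lemma meval_one: "meval (\<lambda>c. c) h 1 = 1"
  by (simp add: meval_def lookup_one)

lemma meval_add: "meval (\<lambda>c. c) h (f + g) = meval (\<lambda>c. c) h f + meval (\<lambda>c. c) h g"
proof -
  let ?S = "Poly_Mapping.keys f \<union> Poly_Mapping.keys g"
  have "meval (\<lambda>c. c) h u = (\<Sum>m\<in>?S. Poly_Mapping.lookup u m *
      (\<Prod>i\<in>UNIV. h i ^ Poly_Mapping.lookup m i))" if "Poly_Mapping.keys u \<subseteq> ?S" for u
    by (rule meval_superset) (use that in auto)
  from this[of f] this[of g] this[of "f + g"] show ?thesis
    using keys_add[of f g] by (simp add: lookup_add algebra_simps sum.distrib)
qed

lemma mpoly_induct [case_names zero add_single]: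
  assumes "P 0" "\<And>f m c. P f \<Longrightarrow> P (Poly_Mapping.single m c + f)"
  shows "P (f :: ('n, 'a::comm_monoid_add) mpoly)"
proof (induction f rule: update_induct)
  case (update f a b)
  have "Poly_Mapping.update a b f = Poly_Mapping.single a b + f"
    using update.hyps(1)
    by (intro poly_mapping_eqI) (auto simp: lookup_update lookup_add lookup_single in_keys_iff when_def)
  then show ?case using assms(2) update by simp
qed (rule assms(1))

lemma meval_single: "meval (\<lambda>c. c) h (Poly_Mapping.single m d) = d * (\<Prod>i\<in>UNIV. h i ^ Poly_Mapping.lookup m i)"
  by (simp add: meval_def)

lemma meval_single_times:
  "meval (\<lambda>c. c) h (Poly_Mapping.single k c * f) = c * (\<Prod>i\<in>UNIV. h i ^ Poly_Mapping.lookup k i) * meval (\<lambda>c. c) h f"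
proof (induction f rule: mpoly_induct)
  case (add_single f m d)
  then show ?case
    by (simp add: distrib_left meval_add mult_single meval_single lookup_add power_add prod.distrib
        algebra_simps)
qed (simp add: meval_zero)

lemma meval_mult: "meval (\<lambda>c. c) h (f * g) = meval (\<lambda>c. c) h f * meval (\<lambda>c. c) h g"
proof (induction f rule: mpoly_induct)
  case (add_single f m d)
  then show ?case by (simp add: distrib_right meval_add meval_single_times meval_single)
qed (simp add: meval_zero)

definition monom_degree :: "('n::finite \<Rightarrow>\<^sub>0 nat) \<Rightarrow> nat" where
  "monom_degree m = (\<Sum>i\<in>UNIV. Poly_Mapping.lookup m i)"

definition homogeneous_component :: "nat \<Rightarrow> ('n::finite, 'a::comm_monoid_add) mpoly \<Rightarrow> ('n, 'a) mpoly" where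
  "homogeneous_component d f =
     (\<Sum>m\<in>{m \<in> Poly_Mapping.keys f. monom_degree m = d}. Poly_Mapping.single m (Poly_Mapping.lookup f m))"

text \<open>Ideals of a commutative ring are its submodules; \<open>ideal.span\<close> is the generated ideal.\<close>

interpretation ideal: module "(*) :: 'a::comm_ring_1 \<Rightarrow> 'a \<Rightarrow> 'a"
  by standard (simp_all add: algebra_simps)

abbreviation is_ideal :: "'a::comm_ring_1 set \<Rightarrow> bool" where
  "is_ideal \<equiv> ideal.subspace"

definition graded_ideal :: "('n::finite, 'a::comm_ring_1) mpoly set \<Rightarrow> bool" where
  "graded_ideal I \<longleftrightarrow> is_ideal I \<and> (\<forall>f\<in>I. \<forall>d. homogeneous_component d f \<in> I)"


section \<open>Initial ideals and the Groebner complex\<close>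

definition exponent_vector :: "('n::finite \<Rightarrow>\<^sub>0 nat) \<Rightarrow> real ^ 'n" where
  "exponent_vector m = (\<chi> i. real (Poly_Mapping.lookup m i))"

text \<open>
  Zero coefficients have valuation \<open>\<infinity>\<close>, so for \<^prop>\<open>f \<noteq> 0\<close> the minimum over all exponents
  is the minimum over the finitely many exponents occurring in \<open>f\<close>, and it is finite.
\<close>

definition tropical_weight :: "real ^ 'n \<Rightarrow> ('n::finite, 'k::field hahn) mpoly \<Rightarrow> real" where
  "tropical_weight \<omega> f = real_of_ereal
     (MIN m\<in>Poly_Mapping.keys f. hval (Poly_Mapping.lookup f m) + ereal (\<omega> \<bullet> exponent_vector m))"

text \<open>
  After the scaling by \<open>t\<^sup>-\<^sup>W\<close> all coefficients lie in \<open>R\<^sub>L\<close>, so taking residues coefficientwise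
  makes sense.
\<close>

definition initial_form :: "real ^ 'n \<Rightarrow> ('n::finite, 'k::field hahn) mpoly \<Rightarrow> ('n, 'k) mpoly" where
  "initial_form \<omega> f =
     (if f = 0 then 0
      else Poly_Mapping.map hresidue
        (mconst (hmonom 1 (- tropical_weight \<omega> f)) *
         msubst (\<lambda>i. mconst (hmonom 1 (\<omega> $ i)) * mvar i) f))"

definition initial_ideal :: "real ^ 'n \<Rightarrow> ('n::finite, 'k::field hahn) mpoly set \<Rightarrow> ('n, 'k) mpoly set" where
  "initial_ideal \<omega> I = ideal.span (initial_form \<omega> ` I)"

text \<open>A polyhedral complex is represented by the set of its cells.\<close>

definition groebner_complex :: "('n::finite, 'k::field hahn) mpoly set \<Rightarrow> (real ^ 'n) set set" where
  "groebner_complex I =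
     range (\<lambda>\<omega>. closure {\<omega>'. initial_ideal \<omega>' I = initial_ideal \<omega> I})"


section \<open>The Zariski topology on the general linear group\<close>

definition matrix_zero_set :: "('n::finite \<times> 'n, 'k::field) mpoly set \<Rightarrow> ('k ^ 'n ^ 'n) set" where
  "matrix_zero_set P = {A. \<forall>p\<in>P. meval (\<lambda>c. c) (\<lambda>(i, j). A $ i $ j) p = 0}"

definition zariski_matrix :: "('k::field ^ 'n::finite ^ 'n) topology" where
  "zariski_matrix = topology (\<lambda>U. \<exists>P. U = - matrix_zero_set P)"

lemma openin_zariski_matrix:
  fixes U :: "('k::field ^ 'n::finite ^ 'n) set"
  shows "openin zariski_matrix U \<longleftrightarrow> (\<exists>P. U = - matrix_zero_set P)"
proof -
  have "istopology (\<lambda>U :: ('k ^ 'n ^ 'n) set. \<exists>P. U = - matrix_zero_set P)"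
    unfolding istopology_def
  proof (intro conjI allI impI)
    fix S T :: "('k ^ 'n ^ 'n) set"
    assume "\<exists>P. S = - matrix_zero_set P" "\<exists>P. T = - matrix_zero_set P"
    then obtain P Q where "S = - matrix_zero_set P" "T = - matrix_zero_set Q" by blast
    moreover have "matrix_zero_set {p * q | p q. p \<in> P \<and> q \<in> Q} = matrix_zero_set P \<union> matrix_zero_set Q"
    proof
      show "matrix_zero_set {p * q | p q. p \<in> P \<and> q \<in> Q} \<subseteq> matrix_zero_set P \<union> matrix_zero_set Q"
      proof (rule subsetI, rule ccontr)
        fix A assume A: "A \<in> matrix_zero_set {p * q | p q. p \<in> P \<and> q \<in> Q}"
          and "A \<notin> matrix_zero_set P \<union> matrix_zero_set Q"
        then obtain p q where "p \<in> P" "q \<in> Q" and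
          nz: "meval (\<lambda>c. c) (\<lambda>(i, j). A $ i $ j) p \<noteq> 0" "meval (\<lambda>c. c) (\<lambda>(i, j). A $ i $ j) q \<noteq> 0"
          unfolding matrix_zero_set_def by blast
        then have "meval (\<lambda>c. c) (\<lambda>(i, j). A $ i $ j) (p * q) = 0"
          using A unfolding matrix_zero_set_def by blast
        then show False using nz by (simp add: meval_mult)
      qed
    qed (auto simp: matrix_zero_set_def meval_mult)
    ultimately have "S \<inter> T = - matrix_zero_set {p * q | p q. p \<in> P \<and> q \<in> Q}"
      by simp
    then show "\<exists>P. S \<inter> T = - matrix_zero_set P" by blast
  next
    fix \<K> :: "('k ^ 'n ^ 'n) set set"
    assume "\<forall>K\<in>\<K>. \<exists>P. K = - matrix_zero_set P"
    then obtain P where "\<And>K. K \<in> \<K> \<Longrightarrow> K = - matrix_zero_set (P K)" by metis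
    then have "\<Union>\<K> = - matrix_zero_set (\<Union>K\<in>\<K>. P K)"
      by (fastforce simp: matrix_zero_set_def)
    then show "\<exists>P. \<Union>\<K> = - matrix_zero_set P" by blast
  qed
  then show ?thesis by (simp add: zariski_matrix_def)
qed

lemma topspace_zariski_matrix [simp]: "topspace zariski_matrix = UNIV"
proof -
  have "(UNIV :: ('a ^ 'b ^ 'b) set) = - matrix_zero_set {1}"
    by (simp add: matrix_zero_set_def meval_one)
  then have "openin zariski_matrix (UNIV :: ('a ^ 'b ^ 'b) set)"
    unfolding openin_zariski_matrix by blast
  then show ?thesis using openin_subset by fastforce
qed

lemma closedin_zariski_matrix: "closedin zariski_matrix C \<longleftrightarrow> (\<exists>P. C = matrix_zero_set P)"
  unfolding closedin_def openin_zariski_matrix by (auto simp: Compl_eq_Diff_UNIV[symmetric])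

definition zariski_GL :: "('k::field ^ 'n::finite ^ 'n) topology" where
  "zariski_GL = subtopology zariski_matrix {g. invertible g}"

definition irreducible_space :: "'a topology \<Rightarrow> bool" where
  "irreducible_space X \<longleftrightarrow> topspace X \<noteq> {} \<and>
     (\<forall>A B. closedin X A \<and> closedin X B \<and> A \<union> B = topspace X \<longrightarrow> A = topspace X \<or> B = topspace X)"

definition GL_subvariety :: "('k::field ^ 'n::finite ^ 'n) set \<Rightarrow> bool" where
  "GL_subvariety V \<longleftrightarrow> closedin zariski_GL V \<and> irreducible_space (subtopology zariski_GL V)"

text \<open>
  \<^term>\<open>A $ i $ j\<close> is the entry in row \<open>i\<close> and column \<open>j\<close>, so \<open>g\<close> acts by the transposed
  indices \<open>x\<^sub>i \<mapsto> \<Sum>\<^sub>j g\<^sub>j\<^sub>i x\<^sub>j\<close>.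
\<close>

definition GL_act :: "'k::field ^ 'n::finite ^ 'n \<Rightarrow> ('n, 'k hahn) mpoly \<Rightarrow> ('n, 'k hahn) mpoly" where
  "GL_act g = msubst (\<lambda>i. \<Sum>j\<in>UNIV. mconst (hmonom (g $ j $ i) 0) * mvar j)"

end

theory Submission
  imports Defs "HOL-Computational_Algebra.Primes"
begin

text \<open>
  For an ideal \<open>J\<close> of \<open>S\<^sub>L\<close> the ideal \<open>in\<^sub>\<omega>(J)\<close> is simply the set of all residues of those
  \<open>f(x\<^sub>1 t\<^bsup>\<omega>\<^sub>1\<^esup>, \<dots>, x\<^sub>n t\<^bsup>\<omega>\<^sub>n\<^esup>)\<close>, \<open>f \<in> J\<close>, that have coefficients in the valuation ring
  (\<open>initial_ideal_residues\<close>). If \<open>J\<close> is graded, this can be read off degree by degree, so the question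
  becomes one about the degenerations of the finite-dimensional spaces \<open>J\<^sub>d\<close>.

  Consider a single degree first. Let \<open>T\<close> be a set of monomials such that \<open>J\<^sub>d\<close> is the graph of a linear map from the
  coordinates in \<open>T\<close> to the other ones, and let \<open>b\<close> be the corresponding reduced basis. If its entries
  have large enough valuations with respect to \<open>\<omega>\<close>, then the residues of the rescaled basis vectors
  form the reduced basis of the degeneration, and some \<open>T\<close> with this property exists for each
  \<open>\<omega>\<close>: the set of leading monomials of the degeneration. An entry survives in the residue exactly if its
  valuation equals a number that depends only on \<open>\<omega>\<close> and the position of the
  entry, and then its leading coefficient survives, which does not depend on \<open>\<omega>\<close>. Consequently the
  valuations of the entries of all reduced bases decide for which
  \<open>\<omega>, \<omega>'\<close> the two degenerations agree (\<open>residues_eq_transfer\<close>).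

  Now let \<open>g\<close> vary. The reduced bases of \<open>g(I)\<^sub>d\<close> are obtained by Gaussian elimination from vectors whose entries are
  polynomials in the entries of \<open>g\<close> with coefficients in \<open>L\<close>. Such a polynomial is a power series in \<open>t\<close>
  whose coefficients are polynomial functions of \<open>g\<close>; its valuation is attained at the first coefficient that does
  not vanish identically on \<open>V\<close>, hence it is constant on a non-empty open set; the
  same follows for the entries of the reduced bases, which are quotients of such polynomials. As \<open>V\<close> is irreducible,
  finitely many such conditions can be imposed simultaneously, and the elimination takes the same course
  on a non-empty open set. So for each single \<open>d\<close> the equivalence relation
  \<open>in\<^sub>\<omega>(g(I))\<^sub>d = in\<^sub>\<omega>\<^sub>'(g(I))\<^sub>d\<close> on the weights is generically independent of \<open>g\<close>
  (\<open>generic_basis_orders\<close>).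

  It remains to bound the degrees. All ideals \<open>in\<^sub>\<omega>(g(I))\<close> have the Hilbert function of \<open>I\<close>. A compactness argument on
  top of Dickson's lemma shows that the monomial ideals with a given Hilbert function are generated in bounded
  degree (\<open>bounded_generation\<close>); passing to leading monomials, the ideals \<open>in\<^sub>\<omega>(g(I))\<close> are determined by
  their parts of degree at most some \<open>D\<close> (\<open>reduce_to_low_degrees\<close>). Hence the degrees up to \<open>D\<close> suffice,
  and on one non-empty open set the relation \<open>in\<^sub>\<omega>(g(I)) = in\<^sub>\<omega>\<^sub>'(g(I))\<close>, whose classes have the cells of
  the Groebner complex as closures, does not depend on \<open>g\<close>.
\<close>

section \<open>Linear algebra of polynomials\<close>

abbreviation mcoeff :: "('n, 'a::zero) mpoly \<Rightarrow> ('n \<Rightarrow>\<^sub>0 nat) \<Rightarrow> 'a" where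
  "mcoeff \<equiv> Poly_Mapping.lookup"

lemma mcoeff_scale [simp]: "mcoeff (mconst c * f) m = c * mcoeff f m"
  by (simp add: mconst_def mult_map_scale_conv_mult[symmetric] Poly_Mapping.map.rep_eq when_def)

lemma mconst_arith:
  "mconst 0 = 0" "mconst 1 = 1" "mconst (a + b) = mconst a + mconst b"
  "mconst (a * b) = mconst a * mconst (b::'a::comm_ring_1)"
  by (simp_all add: mconst_def single_add mult_single)

interpretation mp: vector_space "\<lambda>(c::'a::field) (f::('n, 'a) mpoly). mconst c * f"
proof
  fix a b :: 'a and f g :: "('n, 'a) mpoly"
  show "mconst a * (f + g) = mconst a * f + mconst a * g" by (rule distrib_left)
  show "mconst (a + b) * f = mconst a * f + mconst b * f"
    unfolding mconst_arith by (rule distrib_right)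
  show "mconst a * (mconst b * f) = mconst (a * b) * f"
    unfolding mconst_arith by (rule mult.assoc[symmetric])
  show "mconst 1 * f = f" unfolding mconst_arith by (rule mult_1_left)
qed

text \<open>
  \<open>W\<close> is the graph of a linear map from the coordinates in \<open>T\<close> to the remaining coordinates, and \<open>b\<close> is its
  reduced basis, as in a reduced row echelon form with pivots \<open>T\<close>.
\<close>

definition graph_basis ::
  "('n, 'a::field) mpoly set \<Rightarrow> ('n \<Rightarrow>\<^sub>0 nat) set \<Rightarrow> (('n \<Rightarrow>\<^sub>0 nat) \<Rightarrow> ('n, 'a) mpoly) \<Rightarrow> bool" where
  "graph_basis W T b \<longleftrightarrow>
     (\<forall>e\<in>T. b e \<in> W \<and> (\<forall>e'\<in>T. mcoeff (b e) e' = (if e' = e then 1 else 0))) \<and>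
     (\<forall>f\<in>W. (\<forall>e\<in>T. mcoeff f e = 0) \<longrightarrow> f = 0)"

lemma graph_basisD:
  assumes "graph_basis W T b"
  shows "e \<in> T \<Longrightarrow> b e \<in> W" "e \<in> T \<Longrightarrow> mcoeff (b e) e = 1"
    "e \<in> T \<Longrightarrow> e' \<in> T \<Longrightarrow> e' \<noteq> e \<Longrightarrow> mcoeff (b e) e' = 0"
    "f \<in> W \<Longrightarrow> (\<And>e. e \<in> T \<Longrightarrow> mcoeff f e = 0) \<Longrightarrow> f = 0"
  using assms unfolding graph_basis_def by auto

lemma graph_basis_eqI:
  assumes "mp.subspace W" "graph_basis W T b" "f \<in> W" "g \<in> W" "\<And>e. e \<in> T \<Longrightarrow> mcoeff f e = mcoeff g e"
  shows "f = g"
  using graph_basisD(4)[OF assms(2), of "f - g"] mp.subspace_diff[OF assms(1,3,4)] assms(5)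
  by (simp add: lookup_minus)

lemma graph_basis_unique:
  assumes "mp.subspace W" "graph_basis W T b" "graph_basis W T b'" "e \<in> T"
  shows "b e = b' e"
  using assms by (intro graph_basis_eqI[OF assms(1,2)]) (auto simp: graph_basis_def)

lemma graph_basis_expand:
  assumes "mp.subspace W" "graph_basis W T b" "finite T" "f \<in> W"
  shows "f = (\<Sum>e\<in>T. mconst (mcoeff f e) * b e)"
proof (rule graph_basis_eqI[OF assms(1,2,4)])
  show "(\<Sum>e\<in>T. mconst (mcoeff f e) * b e) \<in> W"
    using assms graph_basisD(1)[OF assms(2)] by (intro mp.subspace_sum mp.subspace_scale) auto
  fix e assume e: "e \<in> T"
  have "(\<Sum>x\<in>T. mcoeff f x * mcoeff (b x) e) = (\<Sum>x\<in>T. if x = e then mcoeff f x else 0)"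
    using e graph_basisD(2,3)[OF assms(2)] by (intro sum.cong) auto
  then show "mcoeff f e = mcoeff (\<Sum>e\<in>T. mconst (mcoeff f e) * b e) e"
    using e assms(3) by (simp add: lookup_sum)
qed

lemma graph_basis_span:
  assumes "mp.subspace W" "graph_basis W T b" "finite T"
  shows "W = mp.span (b ` T)"
proof
  show "W \<subseteq> mp.span (b ` T)"
  proof
    fix f assume "f \<in> W"
    then have "f = (\<Sum>e\<in>T. mconst (mcoeff f e) * b e)" by (rule graph_basis_expand[OF assms])
    also have "\<dots> \<in> mp.span (b ` T)"
      by (intro mp.span_sum mp.span_scale mp.span_base) auto
    finally show "f \<in> mp.span (b ` T)" .
  qed
  show "mp.span (b ` T) \<subseteq> W"
    using graph_basisD(1)[OF assms(2)] by (intro mp.span_minimal assms(1)) auto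
qed

lemma graph_basis_inj: "graph_basis W T b \<Longrightarrow> inj_on b T"
  by (rule inj_onI) (metis graph_basisD(2,3) zero_neq_one)

lemma graph_basis_independent:
  assumes "graph_basis W T b" "finite T"
  shows "mp.independent (b ` T)"
proof -
  have "u v = 0" if eq: "(\<Sum>v\<in>b ` T. mconst (u v) * v) = 0" and v: "v \<in> b ` T" for u v
  proof -
    obtain e where e: "e \<in> T" "v = b e" using v by blast
    have "0 = mcoeff (\<Sum>v\<in>b ` T. mconst (u v) * v) e" using eq by simp
    also have "\<dots> = (\<Sum>x\<in>T. u (b x) * mcoeff (b x) e)"
      using graph_basis_inj[OF assms(1)] by (simp add: lookup_sum sum.reindex)
    also have "\<dots> = (\<Sum>x\<in>T. if x = e then u (b x) else 0)"
      using e graph_basisD(2,3)[OF assms(1)] by (intro sum.cong) auto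
    also have "\<dots> = u v" using e assms(2) by simp
    finally show ?thesis by simp
  qed
  then show ?thesis using assms(2) by (auto simp: mp.dependent_finite)
qed

text \<open>
  Dimension is monotone along injective linear maps. For a coordinate change and its inverse this shows
  that the number of pivots does not change.
\<close>

lemma graph_basis_card_le:
  assumes \<phi>: "\<And>f g. \<phi> (f + g) = \<phi> f + \<phi> g" "\<And>c f. \<phi> (mconst c * f) = mconst c * \<phi> f"
    and inj: "\<And>f. f \<in> W \<Longrightarrow> \<phi> f = 0 \<Longrightarrow> f = 0"
    and W: "mp.subspace W" "graph_basis W T b" "finite T"
    and W': "mp.subspace W'" "graph_basis W' T' b'" "finite T'"
    and img: "\<phi> ` W \<subseteq> W'"
  shows "card T \<le> card T'"
proof -
  have \<phi>0: "\<phi> 0 = 0" using \<phi>(2)[of 0 0] by (simp add: mconst_arith)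
  have \<phi>_sum: "\<phi> (\<Sum>x\<in>A. F x) = (\<Sum>x\<in>A. \<phi> (F x))" for A F
    by (induction A rule: infinite_finite_induct) (simp_all add: \<phi>0 \<phi>(1))
  have diff: "\<phi> f = \<phi> g \<Longrightarrow> f = g" if "f \<in> W" "g \<in> W" for f g
    using inj[OF mp.subspace_diff[OF W(1) that]] \<phi>(1)[of "f - g" g] by simp
  have bW: "b ` T \<subseteq> W" using graph_basisD(1)[OF W(2)] by blast
  have inj\<phi>: "inj_on \<phi> (b ` T)" using diff bW by (auto intro!: inj_onI)
  have "mp.independent (\<phi> ` b ` T)"
  proof -
    have "u v = 0" if eq: "(\<Sum>v\<in>\<phi> ` b ` T. mconst (u v) * v) = 0" and v: "v \<in> \<phi> ` b ` T" for u v
    proof -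
      have "\<phi> (\<Sum>x\<in>b ` T. mconst (u (\<phi> x)) * x) = 0"
        using eq by (simp add: sum.reindex[OF inj\<phi>] \<phi>_sum \<phi>(2))
      moreover have "(\<Sum>x\<in>b ` T. mconst (u (\<phi> x)) * x) \<in> W"
        using bW by (intro mp.subspace_sum mp.subspace_scale W(1)) auto
      ultimately have "(\<Sum>x\<in>b ` T. mconst (u (\<phi> x)) * x) = 0" using inj by blast
      then have "\<forall>x\<in>b ` T. u (\<phi> x) = 0"
        using graph_basis_independent[OF W(2,3)] W(3) by (auto simp: mp.dependent_finite)
      then show ?thesis using v by blast
    qed
    then show ?thesis using W(3) by (auto simp: mp.dependent_finite)
  qed
  moreover have "\<phi> ` b ` T \<subseteq> mp.span (b' ` T')"
    using img bW graph_basis_span[OF W'] by blast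
  ultimately have "card (\<phi> ` b ` T) \<le> card (b' ` T')"
    using mp.independent_span_bound[of "b' ` T'" "\<phi> ` b ` T"] W'(3) by blast
  then show ?thesis
    by (simp add: card_image inj\<phi> graph_basis_inj[OF W(2)] graph_basis_inj[OF W'(2)])
qed

lemma subspace_zero_coeff: "mp.subspace W \<Longrightarrow> mp.subspace {f \<in> W. mcoeff f x = 0}"
  unfolding mp.subspace_def by (auto simp: lookup_add)

text \<open>
  One step of Gaussian elimination: \<open>v\<close> provides the pivot at \<open>x\<close>, and the subspace on which the
  \<open>x\<close>-coordinate vanishes provides the other pivots.
\<close>

lemma graph_basis_insert:
  assumes W: "mp.subspace W" and v: "v \<in> W" "mcoeff v x = 1" and x: "x \<notin> T" "finite T"
    and b: "graph_basis {f \<in> W. mcoeff f x = 0} T b"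
  shows "graph_basis W (insert x T) (b(x := v - (\<Sum>e\<in>T. mconst (mcoeff v e) * b e)))"
proof -
  let ?v = "v - (\<Sum>e\<in>T. mconst (mcoeff v e) * b e)"
  note bD = graph_basisD[OF b]
  have bW: "b e \<in> W" "mcoeff (b e) x = 0" if "e \<in> T" for e using bD(1)[OF that] by auto
  have vW: "?v \<in> W"
    by (intro mp.subspace_diff mp.subspace_sum mp.subspace_scale W v bW)
  have vx: "mcoeff ?v x = 1" using bW by (simp add: lookup_minus lookup_sum v)
  have vT: "mcoeff ?v e = 0" if "e \<in> T" for e
  proof -
    have "(\<Sum>y\<in>T. mcoeff v y * mcoeff (b y) e) = (\<Sum>y\<in>T. if y = e then mcoeff v y else 0)"
      using that bD(2,3) by (intro sum.cong) auto
    then show ?thesis using that x by (simp add: lookup_minus lookup_sum)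
  qed
  have "b e = (b(x := ?v)) e" if "e \<in> T" for e using that x by auto
  then show ?thesis
    unfolding graph_basis_def using bW vW vx vT bD x by (auto simp: fun_upd_def)
qed

lemma graph_basis_remove:
  assumes b: "graph_basis W (insert x T) b" and x: "x \<notin> T"
  shows "graph_basis {f \<in> W. mcoeff f x = 0} T b"
  using b x unfolding graph_basis_def by auto

definition leading_monomials :: "(('n \<Rightarrow>\<^sub>0 nat) \<Rightarrow> nat) \<Rightarrow> ('n, 'a::zero) mpoly set \<Rightarrow> ('n \<Rightarrow>\<^sub>0 nat) set" where
  "leading_monomials \<kappa> W = {e. \<exists>f\<in>W. mcoeff f e \<noteq> 0 \<and> (\<forall>e'. \<kappa> e < \<kappa> e' \<longrightarrow> mcoeff f e' = 0)}"

text \<open>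
  Row reduction that always takes the largest remaining monomial as the next candidate for a pivot ends with
  the leading monomials as pivots.
\<close>

lemma echelon_graph_basis:
  fixes \<kappa> :: "('n \<Rightarrow>\<^sub>0 nat) \<Rightarrow> nat"
  assumes "finite E" "inj_on \<kappa> E" "mp.subspace W" "\<And>f. f \<in> W \<Longrightarrow> Poly_Mapping.keys f \<subseteq> E"
  shows "\<exists>b. graph_basis W (leading_monomials \<kappa> W) b"
  using assms unfolding leading_monomials_def
proof (induction "card E" arbitrary: E W)
  case 0
  then have "W \<subseteq> {0}" by auto
  then have "graph_basis W {} (\<lambda>_. 0)" by (auto simp: graph_basis_def)
  moreover from \<open>W \<subseteq> {0}\<close> have "{e. \<exists>f\<in>W. mcoeff f e \<noteq> 0 \<and> (\<forall>e'. \<kappa> e < \<kappa> e' \<longrightarrow> mcoeff f e' = 0)} = {}" by force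
  ultimately show ?case by metis
next
  case (Suc N)
  let ?L = "\<lambda>W. {e. \<exists>f\<in>W. mcoeff f e \<noteq> 0 \<and> (\<forall>e'. \<kappa> e < \<kappa> e' \<longrightarrow> mcoeff f e' = 0)}"
  have "E \<noteq> {}" using Suc.hyps(2) by auto
  then have "Max (\<kappa> ` E) \<in> \<kappa> ` E" using Suc.prems(1) by (intro Max_in) auto
  then obtain x where x: "x \<in> E" "\<kappa> x = Max (\<kappa> ` E)" by force
  have xmax: "\<kappa> y \<le> \<kappa> x" if "y \<in> E" for y
    unfolding x(2) using Suc.prems(1) that by (intro Max_ge) auto
  define W0 where "W0 = {f \<in> W. mcoeff f x = 0}"
  have W0: "mp.subspace W0" unfolding W0_def by (rule subspace_zero_coeff[OF Suc.prems(3)])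
  have keysW0: "Poly_Mapping.keys f \<subseteq> E - {x}" if "f \<in> W0" for f
    using Suc.prems(4)[of f] that by (auto simp: W0_def in_keys_iff)
  have "\<exists>b. graph_basis W0 (?L W0) b"
    by (rule Suc.hyps(1)[of "E - {x}"])
      (use Suc.hyps(2) Suc.prems x W0 keysW0 in \<open>auto intro: inj_on_subset\<close>)
  then obtain b where b: "graph_basis W0 (?L W0) b" ..
  have LW0: "?L W0 \<subseteq> E - {x}" using keysW0 by (force simp: in_keys_iff)
  show ?case
  proof (cases "W0 = W")
    case True then show ?thesis using b by auto
  next
    case False
    then obtain f where f: "f \<in> W" "mcoeff f x \<noteq> 0" by (auto simp: W0_def)
    define v where "v = mconst (inverse (mcoeff f x)) * f"
    have v: "v \<in> W" "mcoeff v x = 1"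
      using f Suc.prems(3) by (auto simp: v_def mp.subspace_scale)
    have top: "mcoeff g e' = 0" if "g \<in> W" "\<kappa> x < \<kappa> e'" for g e'
      using that xmax[of e'] Suc.prems(4)[of g] by (force simp: in_keys_iff)
    have "?L W = insert x (?L W0)"
    proof (intro set_eqI iffI)
      fix e assume "e \<in> ?L W"
      then obtain g where g: "g \<in> W" "mcoeff g e \<noteq> 0" "\<forall>e'. \<kappa> e < \<kappa> e' \<longrightarrow> mcoeff g e' = 0" by blast
      have eE: "e \<in> E" using Suc.prems(4)[OF g(1)] g(2) by (auto simp: in_keys_iff)
      show "e \<in> insert x (?L W0)"
      proof (cases "e = x")
        case False
        then have "\<kappa> e \<noteq> \<kappa> x" using Suc.prems(2) eE x(1) by (auto dest: inj_onD)
        then have "\<kappa> e < \<kappa> x" using xmax[OF eE] by simp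
        then have "g \<in> W0" using g by (simp add: W0_def)
        then show ?thesis using g by blast
      qed simp
    next
      fix e assume "e \<in> insert x (?L W0)"
      then show "e \<in> ?L W"
      proof (cases "e = x")
        case True
        then have "v \<in> W" "mcoeff v e \<noteq> 0 \<and> (\<forall>e'. \<kappa> e < \<kappa> e' \<longrightarrow> mcoeff v e' = 0)"
          using v top[OF v(1)] by auto
        then show ?thesis by blast
      next
        case False
        then have "e \<in> ?L W0" using \<open>e \<in> insert x (?L W0)\<close> by blast
        then show ?thesis unfolding W0_def by blast
      qed
    qed
    moreover have x': "x \<notin> ?L W0" using LW0 by blast
    moreover have fin: "finite (?L W0)"
      using LW0 Suc.prems(1) by (meson finite_Diff finite_subset)
    ultimately show ?thesis
      using graph_basis_insert[OF Suc.prems(3) v x' fin, folded W0_def, OF b] by auto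
  qed
qed

section \<open>Orders of power series and residues of polynomials\<close>

text \<open>
  The relations \<open>v(x) \<ge> a\<close> and \<open>v(x) = a\<close> for finite \<open>a\<close>, in terms of coefficients. The series \<open>0\<close> satisfies
  all of the former and none of the latter.
\<close>

definition order_ge :: "'a::zero hahn \<Rightarrow> real \<Rightarrow> bool" where
  "order_ge x a \<longleftrightarrow> (\<forall>\<nu><a. hcoeff x \<nu> = 0)"

definition has_order :: "'a::zero hahn \<Rightarrow> real \<Rightarrow> bool" where
  "has_order x a \<longleftrightarrow> hcoeff x a \<noteq> 0 \<and> order_ge x a"

lemma has_order_unique: "has_order x a \<Longrightarrow> has_order x b \<Longrightarrow> a = b"
  unfolding has_order_def order_ge_def by (meson linorder_neqE)

lemma has_order_exists:
  fixes x :: "'a::ab_group_add hahn"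
  assumes "x \<noteq> 0"
  obtains a where "has_order x a"
proof -
  have "hsupp x \<noteq> {}"
  proof
    assume "hsupp x = {}"
    then have "x = 0" by (intro hahn_eqI) auto
    then show False using assms by blast
  qed
  then obtain \<nu> where "\<nu> \<in> hsupp x" by blast
  then obtain m where m: "m \<in> hsupp x" "\<And>y. y \<in> hsupp x \<Longrightarrow> m \<le> y"
    using well_ordered_min[OF well_ordered_hsupp[of x] order_refl] by metis
  have "hcoeff x \<nu> = 0" if "\<nu> < m" for \<nu> using m(2)[of \<nu>] that by auto
  then have "has_order x m" using m(1) by (simp add: has_order_def order_ge_def)
  then show ?thesis by (rule that)
qed

lemma has_order_hval:
  fixes x :: "'a::ab_group_add hahn"
  assumes "has_order x a" shows "hval x = ereal a"
proof -
  have "x \<noteq> 0" using assms by (auto simp: has_order_def)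
  moreover have "(LEAST \<nu>. hcoeff x \<nu> \<noteq> 0) = a"
    using assms unfolding has_order_def order_ge_def by (metis (mono_tags, lifting) Least_equality not_less)
  ultimately show ?thesis by (simp add: hval_def)
qed

lemma order_ge_mono: "order_ge x a \<Longrightarrow> b \<le> a \<Longrightarrow> order_ge x b"
  by (simp add: order_ge_def)

lemma order_ge_zero [simp]: "order_ge (0::'a::ab_group_add hahn) a"
  by (simp add: order_ge_def)

lemma order_ge_add: "order_ge x a \<Longrightarrow> order_ge y a \<Longrightarrow> order_ge (x + y :: 'a::ab_group_add hahn) a"
  by (simp add: order_ge_def)

lemma order_ge_diff: "order_ge x a \<Longrightarrow> order_ge y a \<Longrightarrow> order_ge (x - y :: 'a::ab_group_add hahn) a"
  by (simp add: order_ge_def)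

lemma order_ge_iff:
  fixes x :: "'a::ab_group_add hahn"
  shows "order_ge x a \<longleftrightarrow> (\<forall>\<nu>. has_order x \<nu> \<longrightarrow> a \<le> \<nu>)"
proof
  show "order_ge x a \<Longrightarrow> \<forall>\<nu>. has_order x \<nu> \<longrightarrow> a \<le> \<nu>"
    unfolding order_ge_def has_order_def by (meson not_less)
  assume *: "\<forall>\<nu>. has_order x \<nu> \<longrightarrow> a \<le> \<nu>"
  show "order_ge x a"
  proof (cases "x = 0")
    case False
    then obtain b where "has_order x b" by (rule has_order_exists)
    then show ?thesis using * by (meson has_order_def order_ge_mono)
  qed simp
qed

lemma hcoeff_sum: "hcoeff (sum F S) \<nu> = (\<Sum>k\<in>S. hcoeff (F k) \<nu>)"
  for F :: "'i \<Rightarrow> 'a::ab_group_add hahn"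
  by (induction S rule: infinite_finite_induct) auto

lemma order_ge_mult:
  fixes x y :: "'a::comm_ring_1 hahn"
  assumes x: "order_ge x a" and y: "order_ge y b"
  shows "order_ge (x * y) (a + b)" "hcoeff (x * y) (a + b) = hcoeff x a * hcoeff y b"
proof -
  have ge: "a \<le> \<alpha>" "b \<le> \<beta>" if "hcoeff x \<alpha> \<noteq> 0" "hcoeff y \<beta> \<noteq> 0" for \<alpha> \<beta>
    using that x y unfolding order_ge_def by (meson not_less)+
  show "order_ge (x * y) (a + b)"
    unfolding order_ge_def
  proof (intro allI impI, rule ccontr)
    fix \<nu> assume "\<nu> < a + b" "hcoeff (x * y) \<nu> \<noteq> 0"
    then obtain \<alpha> \<beta> where "\<nu> = \<alpha> + \<beta>" "hcoeff x \<alpha> \<noteq> 0" "hcoeff y \<beta> \<noteq> 0"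
      using hsupp_times[of x y] by auto
    then show False using ge[of \<alpha> \<beta>] \<open>\<nu> < a + b\<close> by simp
  qed
  have "{(\<alpha>, \<beta>). hcoeff x \<alpha> \<noteq> 0 \<and> hcoeff y \<beta> \<noteq> 0 \<and> \<alpha> + \<beta> = a + b} \<subseteq> {(a, b)}"
    using ge by force
  then have "hcoeff (x * y) (a + b) = (\<Sum>(\<alpha>, \<beta>)\<in>{(a, b)}. hcoeff x \<alpha> * hcoeff y \<beta>)"
    unfolding times_hahn.rep_eq by (intro sum.mono_neutral_left) auto
  then show "hcoeff (x * y) (a + b) = hcoeff x a * hcoeff y b" by simp
qed

lemma order_ge_mult': 
  fixes x y :: "'a::comm_ring_1 hahn"
  assumes "order_ge x a" "order_ge y b" "c = a + b"
  shows "order_ge (x * y) c" "hcoeff (x * y) c = hcoeff x a * hcoeff y b"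
  using order_ge_mult[OF assms(1,2)] assms(3) by auto

lemma has_order_mult:
  fixes x y :: "'a::field hahn"
  assumes "has_order x a" "has_order y b"
  shows "has_order (x * y) (a + b)"
  using assms order_ge_mult[of x a y b] by (auto simp: has_order_def)

definition wt :: "real ^ 'n \<Rightarrow> ('n::finite \<Rightarrow>\<^sub>0 nat) \<Rightarrow> real" where
  "wt \<omega> m = \<omega> \<bullet> exponent_vector m"

lemma wt_add: "wt \<omega> (m + k) = wt \<omega> m + wt \<omega> k"
  by (simp add: wt_def exponent_vector_def inner_vec_def lookup_add algebra_simps sum.distrib)

text \<open>
  The coefficient of \<open>x\<^sup>m\<close> in \<open>f(x\<^sub>1 t\<^bsup>\<omega>\<^sub>1\<^esup>, \<dots>, x\<^sub>n t\<^bsup>\<omega>\<^sub>n\<^esup>)\<close> is \<open>t\<^bsup>wt \<omega> m\<^esup>\<close> times that in \<open>f\<close>.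
  So \<open>integral_at\<close> says that the rescaled polynomial has its coefficients in the valuation ring, and
  \<open>residue_at\<close> is its coefficientwise residue.
\<close>

definition integral_at :: "real ^ 'n \<Rightarrow> ('n::finite, 'k::field hahn) mpoly \<Rightarrow> bool" where
  "integral_at \<omega> f \<longleftrightarrow> (\<forall>m. order_ge (mcoeff f m) (- wt \<omega> m))"

definition residue_at :: "real ^ 'n \<Rightarrow> ('n::finite, 'k::field hahn) mpoly \<Rightarrow> ('n, 'k) mpoly" where
  "residue_at \<omega> = Poly_Mapping.mapp (\<lambda>m c. hcoeff c (- wt \<omega> m))"

lemma mcoeff_residue_at [simp]: "mcoeff (residue_at \<omega> f) m = hcoeff (mcoeff f m) (- wt \<omega> m)"
  by (simp add: residue_at_def lookup_mapp when_def in_keys_iff)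

text \<open>
  For an ideal this is the initial ideal; for a finite-dimensional subspace over \<open>L\<close> it is a degeneration over \<open>K\<close>.
\<close>

definition residues :: "real ^ 'n \<Rightarrow> ('n::finite, 'k::field hahn) mpoly set \<Rightarrow> ('n, 'k) mpoly set" where
  "residues \<omega> W = residue_at \<omega> ` {f \<in> W. integral_at \<omega> f}"

lemma integral_at_add: "integral_at \<omega> f \<Longrightarrow> integral_at \<omega> g \<Longrightarrow> integral_at \<omega> (f + g)"
  by (simp add: integral_at_def lookup_add order_ge_add)

lemma residue_at_add: "residue_at \<omega> (f + g) = residue_at \<omega> f + residue_at \<omega> g"
  by (rule poly_mapping_eqI) (simp add: lookup_add)

lemma integral_at_scale: "integral_at \<omega> f \<Longrightarrow> integral_at \<omega> (mconst (hmonom c 0) * f)"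
  by (simp add: integral_at_def order_ge_def hcoeff_hmonom_times)

lemma residue_at_scale: "residue_at \<omega> (mconst (hmonom c 0) * f) = mconst c * residue_at \<omega> f"
  by (rule poly_mapping_eqI) (simp add: hcoeff_hmonom_times)

lemma subspace_residues:
  assumes "mp.subspace W" shows "mp.subspace (residues \<omega> W)"
  unfolding mp.subspace_def residues_def
proof (intro conjI ballI allI)
  show "0 \<in> residue_at \<omega> ` {f \<in> W. integral_at \<omega> f}"
    by (rule image_eqI[of _ _ 0])
      (simp_all add: poly_mapping_eq_iff fun_eq_iff mp.subspace_0[OF assms] integral_at_def)
next
  fix p q assume "p \<in> residue_at \<omega> ` {f \<in> W. integral_at \<omega> f}" "q \<in> residue_at \<omega> ` {f \<in> W. integral_at \<omega> f}"
  then obtain f g where "p = residue_at \<omega> f" "q = residue_at \<omega> g" "f \<in> W" "g \<in> W"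
    "integral_at \<omega> f" "integral_at \<omega> g" by blast
  then show "p + q \<in> residue_at \<omega> ` {f \<in> W. integral_at \<omega> f}"
    by (intro image_eqI[of _ _ "f + g"]) (simp_all add: residue_at_add integral_at_add mp.subspace_add[OF assms])
next
  fix c p assume "p \<in> residue_at \<omega> ` {f \<in> W. integral_at \<omega> f}"
  then obtain f where "p = residue_at \<omega> f" "f \<in> W" "integral_at \<omega> f" by blast
  then show "mconst c * p \<in> residue_at \<omega> ` {f \<in> W. integral_at \<omega> f}"
    by (intro image_eqI[of _ _ "mconst (hmonom c 0) * f"])
      (simp_all add: residue_at_scale integral_at_scale mp.subspace_scale[OF assms])
qed

lemma tropical_weight_order:
  assumes "f \<noteq> 0"
  shows "order_ge (mcoeff f m) (tropical_weight \<omega> f - wt \<omega> m)"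
    and "\<exists>m. hcoeff (mcoeff f m) (tropical_weight \<omega> f - wt \<omega> m) \<noteq> 0"
proof -
  let ?K = "Poly_Mapping.keys f"
  have "\<exists>a. has_order (mcoeff f m) a" if "m \<in> ?K" for m
    using that by (meson has_order_exists in_keys_iff)
  then obtain a where a: "\<And>m. m \<in> ?K \<Longrightarrow> has_order (mcoeff f m) (a m)" by metis
  let ?F = "\<lambda>m. hval (mcoeff f m) + ereal (\<omega> \<bullet> exponent_vector m)"
  have F: "?F m = ereal (a m + wt \<omega> m)" if "m \<in> ?K" for m
    using has_order_hval[OF a[OF that]] by (simp add: wt_def)
  have K: "finite ?K" "?K \<noteq> {}" using assms by simp_all
  then have "Min (?F ` ?K) \<in> ?F ` ?K" by (intro Min_in) auto
  then obtain m0 where m0: "m0 \<in> ?K" "Min (?F ` ?K) = ?F m0" by blast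
  have W: "tropical_weight \<omega> f = a m0 + wt \<omega> m0"
    unfolding tropical_weight_def m0(2) F[OF m0(1)] by simp
  have le: "a m0 + wt \<omega> m0 \<le> a m + wt \<omega> m" if "m \<in> ?K" for m
  proof -
    have "?F m0 \<le> ?F m" using Min_le[of "?F ` ?K" "?F m"] K that m0(2) by simp
    then show ?thesis by (simp add: F that m0(1))
  qed
  show "order_ge (mcoeff f m) (tropical_weight \<omega> f - wt \<omega> m)"
  proof (cases "m \<in> ?K")
    case True
    then show ?thesis using a[OF True] le[OF True] by (auto simp: has_order_def W elim: order_ge_mono)
  qed (simp add: in_keys_iff)
  show "\<exists>m. hcoeff (mcoeff f m) (tropical_weight \<omega> f - wt \<omega> m) \<noteq> 0"
    using a[OF m0(1)] by (intro exI[of _ m0]) (simp add: W has_order_def)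
qed

text \<open>
  Dividing by the power of \<open>t\<close> of exponent the minimal weight makes \<open>f\<close> integral without killing its residue.
\<close>

lemma normalise_integral:
  fixes \<omega> :: "real ^ 'n::finite" and f :: "('n, 'k::field hahn) mpoly"
  assumes "f \<noteq> 0"
  defines "h \<equiv> mconst (hmonom 1 (- tropical_weight \<omega> f)) * f"
  shows "integral_at \<omega> h" "residue_at \<omega> h \<noteq> 0"
proof -
  have c: "hcoeff (mcoeff h m) \<nu> = hcoeff (mcoeff f m) (\<nu> + tropical_weight \<omega> f)" for m \<nu>
    by (simp add: h_def hcoeff_hmonom_times)
  show "integral_at \<omega> h"
    using tropical_weight_order(1)[OF assms(1), of _ \<omega>]
    by (simp add: integral_at_def order_ge_def c)
  obtain m where "hcoeff (mcoeff f m) (tropical_weight \<omega> f - wt \<omega> m) \<noteq> 0"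
    using tropical_weight_order(2)[OF assms(1)] by blast
  then have "mcoeff (residue_at \<omega> h) m \<noteq> 0" by (simp add: c algebra_simps)
  then show "residue_at \<omega> h \<noteq> 0" by (metis lookup_zero)
qed

section \<open>Rescaling the variables by powers of \<open>t\<close>\<close>

lemma mvar_power: "mvar i ^ n = Poly_Mapping.single (Poly_Mapping.single i n) (1::'a::comm_ring_1)"
  by (induction n) (simp_all add: mvar_def mult_single single_add[symmetric])

lemma prod_single:
  "finite S \<Longrightarrow> (\<Prod>i\<in>S. Poly_Mapping.single (F i) (1::'a::comm_ring_1)) = Poly_Mapping.single (\<Sum>i\<in>S. F i) 1"
  for F :: "'i \<Rightarrow> 'n \<Rightarrow>\<^sub>0 nat"
  by (induction S rule: finite_induct) (simp_all add: mult_single)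

lemma prod_mvar_power:
  "(\<Prod>i\<in>UNIV. mvar i ^ Poly_Mapping.lookup m i) = Poly_Mapping.single (m :: 'n::finite \<Rightarrow>\<^sub>0 nat) (1::'a::comm_ring_1)"
proof -
  have "(\<Sum>i\<in>UNIV. Poly_Mapping.single i (Poly_Mapping.lookup m i)) = m"
    by (rule poly_mapping_eqI) (simp add: lookup_sum lookup_single when_def)
  then show ?thesis by (simp add: mvar_power prod_single)
qed

lemma mconst_power: "mconst c ^ n = mconst (c ^ n :: 'a::comm_ring_1)"
  by (induction n) (simp_all add: mconst_arith)

lemma mconst_prod: "(\<Prod>i\<in>S. mconst (F i)) = mconst (\<Prod>i\<in>S. F i :: 'a::comm_ring_1)"
  by (induction S rule: infinite_finite_induct) (simp_all add: mconst_arith)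

lemma hmonom_power: "hmonom 1 \<alpha> ^ n = hmonom (1::'a::comm_ring_1) (real n * \<alpha>)"
  by (induction n) (simp_all add: one_hahn_def hmonom_mult_hmonom algebra_simps)

lemma hmonom_prod: "(\<Prod>i\<in>S. hmonom 1 (F i)) = hmonom (1::'a::comm_ring_1) (\<Sum>i\<in>S. F i)"
  by (induction S rule: infinite_finite_induct) (simp_all add: one_hahn_def hmonom_mult_hmonom)

lemma mcoeff_weight_subst:
  "mcoeff (msubst (\<lambda>i. mconst (hmonom 1 (\<omega> $ i)) * mvar i) f) m = hmonom 1 (wt \<omega> m) * mcoeff f m"
  for f :: "('n::finite, 'k::field hahn) mpoly"
proof -
  have "(\<Prod>i\<in>UNIV. (mconst (hmonom 1 (\<omega> $ i)) * mvar i) ^ Poly_Mapping.lookup k i) =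
      mconst (hmonom 1 (wt \<omega> k)) * Poly_Mapping.single k (1 :: 'k hahn)" for k
    by (simp add: power_mult_distrib prod.distrib prod_mvar_power mconst_power mconst_prod
        hmonom_power hmonom_prod wt_def inner_vec_def exponent_vector_def mult.commute)
  then have "mcoeff (msubst (\<lambda>i. mconst (hmonom 1 (\<omega> $ i)) * mvar i) f) m =
      (\<Sum>k\<in>Poly_Mapping.keys f. if m = k then mcoeff f k * hmonom 1 (wt \<omega> k) else 0)"
    by (simp add: msubst_def meval_def lookup_sum lookup_single when_def if_distrib
        mconst_arith(4)[symmetric] cong: if_cong)
  also have "\<dots> = hmonom 1 (wt \<omega> m) * mcoeff f m"
    by (simp add: in_keys_iff mult.commute)
  finally show ?thesis .
qed

lemma initial_form_residue:
  "initial_form \<omega> f = residue_at \<omega> (mconst (hmonom 1 (- tropical_weight \<omega> f)) * f)"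
proof (cases "f = 0")
  case False
  have map: "mcoeff (Poly_Mapping.map hresidue p) m = hcoeff (mcoeff p m) 0"
    for p :: "('a, 'b::field hahn) mpoly" and m
    by (simp add: Poly_Mapping.map.rep_eq when_def hresidue_def)
  show ?thesis
    using False by (intro poly_mapping_eqI)
      (simp add: initial_form_def map mcoeff_weight_subst hmonom_mult_hmonom hcoeff_hmonom_times)
qed (simp add: initial_form_def poly_mapping_eq_iff fun_eq_iff)

section \<open>Initial degenerations of a finite-dimensional space\<close>

text \<open>
  If \<open>f\<close> had negative weight, dividing by the corresponding power of \<open>t\<close> would push its coordinates in \<open>T\<close> into
  the maximal ideal, so its non-zero residue would vanish on \<open>T\<close>.
\<close>

lemma integral_from_coordinates:
  assumes W: "mp.subspace W"
    and inj: "\<And>p. p \<in> residues \<omega> W \<Longrightarrow> (\<And>e. e \<in> T \<Longrightarrow> mcoeff p e = 0) \<Longrightarrow> p = 0"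
    and f: "f \<in> W" "\<And>e. e \<in> T \<Longrightarrow> order_ge (mcoeff f e) (- wt \<omega> e)"
  shows "integral_at \<omega> f"
proof (cases "f = 0 \<or> 0 \<le> tropical_weight \<omega> f")
  case True
  then show ?thesis
    using tropical_weight_order(1)[of f _ \<omega>] by (force simp: integral_at_def elim: order_ge_mono)
next
  case False
  define h where "h = mconst (hmonom 1 (- tropical_weight \<omega> f)) * f"
  have h: "integral_at \<omega> h" "residue_at \<omega> h \<noteq> 0" "h \<in> W"
    using False normalise_integral[of f \<omega>] f(1) W by (auto simp: h_def mp.subspace_scale)
  have "mcoeff (residue_at \<omega> h) e = 0" if "e \<in> T" for e
    using f(2)[OF that] False by (simp add: h_def hcoeff_hmonom_times order_ge_def)
  moreover have "residue_at \<omega> h \<in> residues \<omega> W" using h by (auto simp: residues_def)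
  ultimately show ?thesis using inj h(2) by blast
qed

lemma injective_from_coordinates:
  assumes W: "mp.subspace W"
    and inj: "\<And>p. p \<in> residues \<omega> W \<Longrightarrow> (\<And>e. e \<in> T \<Longrightarrow> mcoeff p e = 0) \<Longrightarrow> p = 0"
    and f: "f \<in> W" "\<And>e. e \<in> T \<Longrightarrow> mcoeff f e = 0"
  shows "f = 0"
proof (rule ccontr)
  assume nz: "f \<noteq> 0"
  define h where "h = mconst (hmonom 1 (- tropical_weight \<omega> f)) * f"
  have h: "integral_at \<omega> h" "residue_at \<omega> h \<noteq> 0" "h \<in> W"
    using nz normalise_integral[of f \<omega>] f(1) W by (auto simp: h_def mp.subspace_scale)
  have "mcoeff (residue_at \<omega> h) e = 0" if "e \<in> T" for e
    using f(2)[OF that] by (simp add: h_def)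
  moreover have "residue_at \<omega> h \<in> residues \<omega> W" using h by (auto simp: residues_def)
  ultimately show False using inj h(2) by blast
qed

lemma order_inverse_unit:
  fixes a :: "'k::field hahn"
  assumes "order_ge a 0" "hcoeff a 0 = 1"
  shows "a \<noteq> 0" "order_ge (inverse a) 0" "hcoeff (inverse a) 0 = 1"
proof -
  show nz: "a \<noteq> 0" using assms(2) by auto
  have a: "has_order a 0" using assms by (simp add: has_order_def)
  obtain c where c: "has_order (inverse a) c" using has_order_exists[of "inverse a"] nz by auto
  have "has_order (1 :: 'k hahn) 0"
    by (simp add: has_order_def order_ge_def one_hahn_def hcoeff_hmonom)
  moreover have "has_order (1 :: 'k hahn) c" using has_order_mult[OF a c] nz by simp
  ultimately have "c = 0" using has_order_unique by blast
  then show ge: "order_ge (inverse a) 0" using c by (simp add: has_order_def)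
  have "hcoeff (a * inverse a) 0 = 1" using nz by (simp add: one_hahn_def hcoeff_hmonom)
  then show "hcoeff (inverse a) 0 = 1"
    using order_ge_mult(2)[OF assms(1) ge] assms(2) by simp
qed

text \<open>
  The hypotheses say that, after rescaling, the coordinates of the \<open>u e\<close> in \<open>T\<close> form a matrix that is congruent
  to the identity modulo the maximal ideal of the valuation ring. It is therefore invertible; here this is
  seen by elimination, in which every pivot is a unit with residue \<open>1\<close> and the congruence is preserved.
\<close>

lemma lift_graph_basis:
  assumes "finite T" "mp.subspace W" "\<And>f. f \<in> W \<Longrightarrow> (\<And>e. e \<in> T \<Longrightarrow> mcoeff f e = 0) \<Longrightarrow> f = 0"
    and "\<And>e. e \<in> T \<Longrightarrow> u e \<in> W"
    and "\<And>e e'. e \<in> T \<Longrightarrow> e' \<in> T \<Longrightarrow> order_ge (mcoeff (u e) e') (wt \<omega> e - wt \<omega> e')"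
    and "\<And>e e'. e \<in> T \<Longrightarrow> e' \<in> T \<Longrightarrow>
           hcoeff (mcoeff (u e) e') (wt \<omega> e - wt \<omega> e') = (if e' = e then 1 else 0)"
  shows "\<exists>b. graph_basis W T b"
  using assms
proof (induction T arbitrary: W u rule: finite_induct)
  case empty
  then show ?case by (auto simp: graph_basis_def)
next
  case (insert x T)
  note W = insert.prems(1) and inj = insert.prems(2) and uW = insert.prems(3)
    and u_ge = insert.prems(4) and u_coeff = insert.prems(5)
  define a where "a = mcoeff (u x) x"
  have a: "a \<noteq> 0" "order_ge (inverse a) 0" "hcoeff (inverse a) 0 = 1"
    using order_inverse_unit[of a] u_ge[of x x] u_coeff[of x x] by (simp_all add: a_def)
  define v where "v = mconst (inverse a) * u x"
  have v: "v \<in> W" "mcoeff v x = 1" using uW W a(1) by (simp_all add: v_def mp.subspace_scale a_def)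
  have v_ge: "order_ge (mcoeff v e) (wt \<omega> x - wt \<omega> e)" if "e \<in> T" for e
    using order_ge_mult'(1)[OF a(2) u_ge[of x e], of "wt \<omega> x - wt \<omega> e"] that by (simp add: v_def)
  define u' where "u' e = u e - mconst (mcoeff (u e) x) * v" for e
  let ?W0 = "{f \<in> W. mcoeff f x = 0}"
  have "\<exists>b. graph_basis ?W0 T b"
  proof (rule insert.IH[of _ u'])
    show "mp.subspace ?W0" by (rule subspace_zero_coeff[OF W])
    show "f = 0" if "f \<in> ?W0" "\<And>e. e \<in> T \<Longrightarrow> mcoeff f e = 0" for f using that inj by auto
    show "u' e \<in> ?W0" if "e \<in> T" for e
      using uW that W v by (auto simp: u'_def lookup_minus intro!: mp.subspace_diff mp.subspace_scale)
    fix e e' assume e: "e \<in> T" "e' \<in> T"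
    have xe: "x \<noteq> e" using e insert.hyps by blast
    have ux: "order_ge (mcoeff (u e) x) (wt \<omega> e - wt \<omega> x)" "hcoeff (mcoeff (u e) x) (wt \<omega> e - wt \<omega> x) = 0"
      using u_ge[of e x] u_coeff[of e x] e xe by auto
    have p: "order_ge (mcoeff (u e) x * mcoeff v e') (wt \<omega> e - wt \<omega> e')"
      "hcoeff (mcoeff (u e) x * mcoeff v e') (wt \<omega> e - wt \<omega> e') = 0"
      using order_ge_mult'[OF ux(1) v_ge[OF e(2)], of "wt \<omega> e - wt \<omega> e'"] ux(2) by simp_all
    show "order_ge (mcoeff (u' e) e') (wt \<omega> e - wt \<omega> e')"
      using order_ge_diff[OF u_ge[of e e'] p(1)] e by (simp add: u'_def lookup_minus)
    show "hcoeff (mcoeff (u' e) e') (wt \<omega> e - wt \<omega> e') = (if e' = e then 1 else 0)"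
      using u_coeff[of e e'] p(2) e by (simp add: u'_def lookup_minus)
  qed
  then obtain b where "graph_basis ?W0 T b" ..
  then show ?case using graph_basis_insert[OF W v insert.hyps(2,1)] by blast
qed

text \<open>
  Lifts of a reduced basis of the residues satisfy the hypotheses of \<open>lift_graph_basis\<close>.
\<close>

lemma graph_basis_from_residues:
  assumes W: "mp.subspace W" and T: "finite T" and r: "graph_basis (residues \<omega> W) T r"
  shows "\<exists>b. graph_basis W T b"
proof -
  have "\<exists>f. f \<in> W \<and> integral_at \<omega> f \<and> residue_at \<omega> f = r e" if "e \<in> T" for e
    using graph_basisD(1)[OF r that] by (auto simp: residues_def)
  then obtain f where f: "\<And>e. e \<in> T \<Longrightarrow> f e \<in> W \<and> integral_at \<omega> (f e) \<and> residue_at \<omega> (f e) = r e"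
    by metis
  have co: "hcoeff (mcoeff (mconst (hmonom 1 (wt \<omega> e)) * f e) e') \<nu> = hcoeff (mcoeff (f e) e') (\<nu> - wt \<omega> e)"
    for e e' \<nu> by (simp add: hcoeff_hmonom_times)
  show ?thesis
  proof (rule lift_graph_basis[OF T W, of "\<lambda>e. mconst (hmonom 1 (wt \<omega> e)) * f e" \<omega>])
    show "g = 0" if "g \<in> W" "\<And>e. e \<in> T \<Longrightarrow> mcoeff g e = 0" for g
      using injective_from_coordinates[OF W graph_basisD(4)[OF r]] that by blast
    show "mconst (hmonom 1 (wt \<omega> e)) * f e \<in> W" if "e \<in> T" for e
      using f[OF that] W by (simp add: mp.subspace_scale)
    fix e e' assume e: "e \<in> T" "e' \<in> T"
    have "order_ge (mcoeff (f e) e') (- wt \<omega> e')" using f[OF e(1)] by (simp add: integral_at_def)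
    then show "order_ge (mcoeff (mconst (hmonom 1 (wt \<omega> e)) * f e) e') (wt \<omega> e - wt \<omega> e')"
      unfolding order_ge_def co by simp
    have "hcoeff (mcoeff (f e) e') (- wt \<omega> e') = mcoeff (residue_at \<omega> (f e)) e'" by simp
    also have "\<dots> = mcoeff (r e) e'" using f[OF e(1)] by simp
    also have "\<dots> = (if e' = e then 1 else 0)" using graph_basisD(2,3)[OF r] e by auto
    finally show "hcoeff (mcoeff (mconst (hmonom 1 (wt \<omega> e)) * f e) e') (wt \<omega> e - wt \<omega> e')
        = (if e' = e then 1 else 0)"
      unfolding co by simp
  qed
qed

text \<open>
  The basis vectors, divided by \<open>t\<^bsup>wt \<omega> e\<^esup>\<close> so that the pivot entry becomes \<open>1\<close> after rescaling the variables,
  are integral.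
\<close>

definition adapted :: "real ^ 'n \<Rightarrow> ('n::finite \<Rightarrow>\<^sub>0 nat) set \<Rightarrow> (('n \<Rightarrow>\<^sub>0 nat) \<Rightarrow> ('n, 'k::field hahn) mpoly) \<Rightarrow> bool" where
  "adapted \<omega> T b \<longleftrightarrow> (\<forall>e\<in>T. \<forall>m. order_ge (mcoeff (b e) m) (wt \<omega> e - wt \<omega> m))"

definition degenerate_basis ::
  "real ^ 'n \<Rightarrow> (('n::finite \<Rightarrow>\<^sub>0 nat) \<Rightarrow> ('n, 'k::field hahn) mpoly) \<Rightarrow> ('n \<Rightarrow>\<^sub>0 nat) \<Rightarrow> ('n, 'k) mpoly" where
  "degenerate_basis \<omega> b e = residue_at \<omega> (mconst (hmonom 1 (- wt \<omega> e)) * b e)"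

lemma mcoeff_degenerate_basis: "mcoeff (degenerate_basis \<omega> b e) m = hcoeff (mcoeff (b e) m) (wt \<omega> e - wt \<omega> m)"
  by (simp add: degenerate_basis_def hcoeff_hmonom_times)

text \<open>
  The coordinates of a rescaled basis vector in \<open>T\<close> are \<open>0\<close> and \<open>1\<close>, so \<open>integral_from_coordinates\<close> applies.
\<close>

lemma graph_basis_adapted:
  assumes W: "mp.subspace W" and b: "graph_basis W T b"
    and inj: "\<And>p. p \<in> residues \<omega> W \<Longrightarrow> (\<And>e. e \<in> T \<Longrightarrow> mcoeff p e = 0) \<Longrightarrow> p = 0"
  shows "adapted \<omega> T b"
  unfolding adapted_def
proof (intro ballI allI)
  fix e m assume e: "e \<in> T"
  let ?h = "mconst (hmonom 1 (- wt \<omega> e)) * b e"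
  have co: "hcoeff (mcoeff ?h m) \<nu> = hcoeff (mcoeff (b e) m) (\<nu> + wt \<omega> e)" for m \<nu>
    by (simp add: hcoeff_hmonom_times)
  have "integral_at \<omega> ?h"
  proof (rule integral_from_coordinates[OF W inj])
    show "?h \<in> W" using graph_basisD(1)[OF b e] W by (simp add: mp.subspace_scale)
    fix e' assume "e' \<in> T"
    then have "mcoeff (b e) e' = (if e' = e then 1 else 0)" using graph_basisD(2,3)[OF b] e by auto
    then show "order_ge (mcoeff ?h e') (- wt \<omega> e')"
      unfolding order_ge_def co by (simp add: one_hahn_def hcoeff_hmonom)
  qed
  then have "order_ge (mcoeff ?h m) (- wt \<omega> m)" by (simp add: integral_at_def)
  then have "\<forall>\<nu>. \<nu> < - wt \<omega> m \<longrightarrow> hcoeff (mcoeff (b e) m) (\<nu> + wt \<omega> e) = 0"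
    unfolding order_ge_def co by blast
  then show "order_ge (mcoeff (b e) m) (wt \<omega> e - wt \<omega> m)"
    unfolding order_ge_def by (metis add.commute diff_add_cancel diff_less_eq minus_add_cancel uminus_add_conv_diff)
qed

text \<open>
  An element whose residue vanishes on \<open>T\<close> is a combination of the integral basis vectors with coefficients in the
  maximal ideal, hence its whole residue vanishes.
\<close>

lemma degenerate_graph_basis:
  assumes W: "mp.subspace W" and T: "finite T" and b: "graph_basis W T b" and ad: "adapted \<omega> T b"
  shows "graph_basis (residues \<omega> W) T (degenerate_basis \<omega> b)"
  unfolding graph_basis_def
proof (intro conjI ballI impI)
  fix e assume e: "e \<in> T"
  let ?h = "mconst (hmonom 1 (- wt \<omega> e)) * b e"
  have "integral_at \<omega> ?h"
    using ad e by (simp add: adapted_def integral_at_def order_ge_def hcoeff_hmonom_times)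
  moreover have "?h \<in> W" using graph_basisD(1)[OF b e] W by (simp add: mp.subspace_scale)
  ultimately show "degenerate_basis \<omega> b e \<in> residues \<omega> W"
    by (auto simp: degenerate_basis_def residues_def)
  fix e' assume "e' \<in> T"
  then have "mcoeff (b e) e' = (if e' = e then 1 else 0)" using graph_basisD(2,3)[OF b] e by auto
  then show "mcoeff (degenerate_basis \<omega> b e) e' = (if e' = e then 1 else 0)"
    by (simp add: mcoeff_degenerate_basis one_hahn_def hcoeff_hmonom)
next
  fix p assume "p \<in> residues \<omega> W" and p0: "\<forall>e\<in>T. mcoeff p e = 0"
  then obtain f where f: "f \<in> W" "integral_at \<omega> f" "p = residue_at \<omega> f" by (auto simp: residues_def)
  show "p = 0"
  proof (rule poly_mapping_eqI)
    fix m
    have "hcoeff (mcoeff f e * mcoeff (b e) m) (- wt \<omega> m) = 0" if e: "e \<in> T" for e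
    proof -
      have fe: "order_ge (mcoeff f e) (- wt \<omega> e)" using f(2) by (simp add: integral_at_def)
      have be: "order_ge (mcoeff (b e) m) (wt \<omega> e - wt \<omega> m)" using ad e by (simp add: adapted_def)
      have "hcoeff (mcoeff f e) (- wt \<omega> e) = 0" using p0 e f(3) by auto
      then show ?thesis using order_ge_mult'(2)[OF fe be, of "- wt \<omega> m"] by simp
    qed
    moreover have "mcoeff f m = (\<Sum>e\<in>T. mcoeff f e * mcoeff (b e) m)"
      using arg_cong[OF graph_basis_expand[OF W b T f(1)], of "\<lambda>f. mcoeff f m"] by (simp add: lookup_sum)
    ultimately show "mcoeff p m = mcoeff 0 m" by (simp add: f(3) hcoeff_sum)
  qed
qed

text \<open>
  The valuations of all entries of the reduced basis with pivots \<open>T\<close>. The result is a set with one element, or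
  empty if \<open>W\<close> has no such basis, so that an equation between two such sets also compares the existence of bases.
\<close>

definition basis_orders :: "('n, 'k::field hahn) mpoly set \<Rightarrow> ('n \<Rightarrow>\<^sub>0 nat) set \<Rightarrow>
    (('n \<Rightarrow>\<^sub>0 nat) \<times> ('n \<Rightarrow>\<^sub>0 nat) \<times> real) set set" where
  "basis_orders W T = {Q. \<exists>b. graph_basis W T b \<and> Q = {(e, m, \<nu>). e \<in> T \<and> has_order (mcoeff (b e) m) \<nu>}}"

lemma keys_residues:
  assumes "\<And>f. f \<in> W \<Longrightarrow> Poly_Mapping.keys f \<subseteq> E" "p \<in> residues \<omega> W"
  shows "Poly_Mapping.keys p \<subseteq> E"
  using assms by (force simp: residues_def in_keys_iff)

lemma residues_graph_basis_exists:
  fixes \<kappa> :: "('n::finite \<Rightarrow>\<^sub>0 nat) \<Rightarrow> nat"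
  assumes E: "finite E" "inj_on \<kappa> E" and W: "mp.subspace W" "\<And>f. f \<in> W \<Longrightarrow> Poly_Mapping.keys f \<subseteq> E"
    and T_def: "T = leading_monomials \<kappa> (residues \<omega> W)"
  obtains b where "T \<subseteq> E" "graph_basis W T b" "adapted \<omega> T b"
    "graph_basis (residues \<omega> W) T (degenerate_basis \<omega> b)"
proof -
  obtain r where r: "graph_basis (residues \<omega> W) T r"
    unfolding T_def
    using echelon_graph_basis[OF E subspace_residues[OF W(1)]] keys_residues[OF W(2)] by metis
  have TE: "T \<subseteq> E"
  proof
    fix e assume "e \<in> T"
    then obtain p where "p \<in> residues \<omega> W" "e \<in> Poly_Mapping.keys p"
      unfolding T_def leading_monomials_def in_keys_iff by blast
    then show "e \<in> E" using keys_residues[OF W(2)] by blast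
  qed
  then have T: "finite T" using E(1) finite_subset by blast
  obtain b where b: "graph_basis W T b" using graph_basis_from_residues[OF W(1) T r] ..
  have "adapted \<omega> T b" by (rule graph_basis_adapted[OF W(1) b graph_basisD(4)[OF r]])
  then show ?thesis using that[OF TE b] degenerate_graph_basis[OF W(1) T b] by blast
qed

text \<open>
  Let \<open>T\<close> be the pivots of the common degeneration of \<open>W\<close>. Integrality of the reduced basis of \<open>W\<close> with
  respect to \<open>\<omega>\<close> and \<open>\<omega>'\<close> is a matter of valuations, so the reduced basis of \<open>W'\<close> is integral too. Whether an entry
  has a non-zero residue is again decided by its valuation, hence happens for the same entries of both
  spaces; and for an entry that survives for both weights the residue is its leading coefficient in either case.
\<close>

lemma residues_eq_transfer:
  fixes W W' :: "('n::finite, 'k::field hahn) mpoly set"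
  assumes E: "finite E" and W: "mp.subspace W" "\<And>f. f \<in> W \<Longrightarrow> Poly_Mapping.keys f \<subseteq> E"
    and W': "mp.subspace W'" and orders: "\<And>T. T \<subseteq> E \<Longrightarrow> basis_orders W T = basis_orders W' T"
    and eq: "residues \<omega> W = residues \<omega>' W"
  shows "residues \<omega> W' = residues \<omega>' W'"
proof -
  obtain \<kappa> :: "('n \<Rightarrow>\<^sub>0 nat) \<Rightarrow> nat" where \<kappa>: "inj_on \<kappa> E"
    using finite_imp_inj_to_nat_seg[OF E] by blast
  obtain T b where T: "T \<subseteq> E" and b: "graph_basis W T b" and ad: "adapted \<omega> T b"
    and r: "graph_basis (residues \<omega> W) T (degenerate_basis \<omega> b)"
    using residues_graph_basis_exists[OF E \<kappa> W refl] by metis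
  have finT: "finite T" using T E finite_subset by blast
  have ad2: "adapted \<omega>' T b"
    by (rule graph_basis_adapted[OF W(1) b]) (use graph_basisD(4)[OF r] eq in auto)
  have r2: "graph_basis (residues \<omega> W) T (degenerate_basis \<omega>' b)"
    using degenerate_graph_basis[OF W(1) finT b ad2] eq by simp
  have same: "hcoeff (mcoeff (b e) m) (wt \<omega> e - wt \<omega> m) = hcoeff (mcoeff (b e) m) (wt \<omega>' e - wt \<omega>' m)"
    if "e \<in> T" for e m
    using graph_basis_unique[OF subspace_residues[OF W(1)] r r2 that]
    by (metis mcoeff_degenerate_basis)
  have "{(e, m, \<nu>). e \<in> T \<and> has_order (mcoeff (b e) m) \<nu>} \<in> basis_orders W T"
    using b by (auto simp: basis_orders_def)
  then obtain b' where b': "graph_basis W' T b'"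
    and "{(e, m, \<nu>). e \<in> T \<and> has_order (mcoeff (b e) m) \<nu>} = {(e, m, \<nu>). e \<in> T \<and> has_order (mcoeff (b' e) m) \<nu>}"
    unfolding orders[OF T] by (auto simp: basis_orders_def)
  then have ho: "has_order (mcoeff (b e) m) \<nu> \<longleftrightarrow> has_order (mcoeff (b' e) m) \<nu>" if "e \<in> T" for e m \<nu>
    using that by (auto simp: set_eq_iff)
  have ad': "adapted \<omega> T b'" "adapted \<omega>' T b'"
    using ad ad2 ho by (simp_all add: adapted_def order_ge_iff)
  have r': "graph_basis (residues \<omega> W') T (degenerate_basis \<omega> b')"
    "graph_basis (residues \<omega>' W') T (degenerate_basis \<omega>' b')"
    using degenerate_graph_basis[OF W' finT b'] ad' by auto
  have ho1: "has_order (mcoeff (b e) m) (wt \<omega> e - wt \<omega> m) \<longleftrightarrow> hcoeff (mcoeff (b e) m) (wt \<omega> e - wt \<omega> m) \<noteq> 0"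
    if "adapted \<omega> T b" "e \<in> T" for \<omega> and b :: "('n \<Rightarrow>\<^sub>0 nat) \<Rightarrow> ('n, 'k hahn) mpoly" and e m
    using that by (auto simp: adapted_def has_order_def)
  have "degenerate_basis \<omega> b' e = degenerate_basis \<omega>' b' e" if e: "e \<in> T" for e
  proof (rule poly_mapping_eqI)
    fix m
    let ?\<nu> = "wt \<omega> e - wt \<omega> m" and ?\<nu>' = "wt \<omega>' e - wt \<omega>' m"
    have "has_order (mcoeff (b' e) m) ?\<nu> \<longleftrightarrow> has_order (mcoeff (b' e) m) ?\<nu>'"
      using ho[OF e] ho1[OF ad e] ho1[OF ad2 e] same[OF e] by simp
    then have "hcoeff (mcoeff (b' e) m) ?\<nu> = hcoeff (mcoeff (b' e) m) ?\<nu>'"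
      using ho1[OF ad'(1) e, of m] ho1[OF ad'(2) e, of m] has_order_unique[of "mcoeff (b' e) m" ?\<nu> ?\<nu>']
      by metis
    then show "mcoeff (degenerate_basis \<omega> b' e) m = mcoeff (degenerate_basis \<omega>' b' e) m"
      by (simp add: mcoeff_degenerate_basis)
  qed
  then have "degenerate_basis \<omega> b' ` T = degenerate_basis \<omega>' b' ` T" by (intro image_cong) auto
  then show ?thesis
    using graph_basis_span[OF subspace_residues[OF W'] r'(1) finT]
      graph_basis_span[OF subspace_residues[OF W'] r'(2) finT] by simp
qed

section \<open>Monomial ideals with a given Hilbert function\<close>

lemma monom_degree_add: "monom_degree (m + k) = monom_degree m + monom_degree k"
  by (simp add: monom_degree_def lookup_add sum.distrib)

lemma finite_monomials: "finite {m :: 'n::finite \<Rightarrow>\<^sub>0 nat. monom_degree m \<le> d}"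
proof (rule finite_imageD)
  have "Poly_Mapping.lookup m i \<le> monom_degree m" for m :: "'n \<Rightarrow>\<^sub>0 nat" and i
    unfolding monom_degree_def by (rule member_le_sum) auto
  then have "Poly_Mapping.lookup ` {m :: 'n \<Rightarrow>\<^sub>0 nat. monom_degree m \<le> d} \<subseteq> (UNIV \<rightarrow>\<^sub>E {..d})"
    by (auto simp: PiE_def) (meson order_trans)
  then show "finite (Poly_Mapping.lookup ` {m :: 'n \<Rightarrow>\<^sub>0 nat. monom_degree m \<le> d})"
    by (rule finite_subset) (intro finite_PiE, auto)
  show "inj_on Poly_Mapping.lookup {m :: 'n \<Rightarrow>\<^sub>0 nat. monom_degree m \<le> d}"
    by (simp add: inj_on_def lookup_inject)
qed

text \<open>
  A decreasing sequence of natural numbers becomes constant, so it also has non-decreasing subsequences.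
\<close>

lemma nat_monotone_subsequence:
  fixes s :: "nat \<Rightarrow> nat"
  shows "\<exists>q :: nat \<Rightarrow> nat. strict_mono q \<and> (\<forall>j k. j \<le> k \<longrightarrow> s (q j) \<le> s (q k))"
proof -
  obtain q where q: "strict_mono q" "monoseq (\<lambda>k. s (q k))" using seq_monosub by blast
  show ?thesis
  proof (cases "\<forall>j k. j \<le> k \<longrightarrow> s (q j) \<le> s (q k)")
    case True then show ?thesis using q(1) by blast
  next
    case False
    then have dec: "\<And>j k. j \<le> k \<Longrightarrow> s (q k) \<le> s (q j)" using q(2) by (auto simp: monoseq_def)
    define v where "v = (LEAST v. v \<in> range (\<lambda>k. s (q k)))"
    have "v \<in> range (\<lambda>k. s (q k))" unfolding v_def by (rule LeastI) blast
    then obtain N where N: "v = s (q N)" by blast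
    have "s (q k) = v" if "N \<le> k" for k
      using dec[OF that] Least_le[of "\<lambda>v. v \<in> range (\<lambda>k. s (q k))" "s (q k)"] N by (auto simp: v_def)
    then have "s (q (N + j)) \<le> s (q (N + k))" for j k by simp
    moreover have "strict_mono (\<lambda>k. q (N + k))" using q(1) by (simp add: strict_mono_def)
    ultimately show ?thesis by blast
  qed
qed

lemma monotone_subsequence_coordinates:
  fixes f :: "nat \<Rightarrow> 'i \<Rightarrow> nat"
  assumes "finite A"
  shows "\<exists>q :: nat \<Rightarrow> nat. strict_mono q \<and> (\<forall>i\<in>A. \<forall>j k. j \<le> k \<longrightarrow> f (q j) i \<le> f (q k) i)"
  using assms
proof (induction A rule: finite_induct)
  case empty
  then show ?case by (auto intro: exI[of _ id] simp: strict_mono_def)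
next
  case (insert x A)
  then obtain q :: "nat \<Rightarrow> nat" where q: "strict_mono q" "\<And>i j k. i \<in> A \<Longrightarrow> j \<le> k \<Longrightarrow> f (q j) i \<le> f (q k) i"
    by blast
  obtain r :: "nat \<Rightarrow> nat" where r: "strict_mono r" "\<forall>j k. j \<le> k \<longrightarrow> f (q (r j)) x \<le> f (q (r k)) x"
    using nat_monotone_subsequence[of "\<lambda>k. f (q k) x"] by blast
  have mono: "r j \<le> r k" if "j \<le> k" for j k
    using r(1) that by (simp add: strict_mono_less_eq)
  have "strict_mono (\<lambda>k. q (r k))" using q(1) r(1) by (simp add: strict_mono_def)
  moreover have "f (q (r j)) i \<le> f (q (r k)) i" if "i \<in> insert x A" "j \<le> k" for i j k
    using that q(2)[of i "r j" "r k"] r(2) mono[of j k] by blast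
  ultimately show ?case by (intro exI[of _ "\<lambda>k. q (r k)"]) blast
qed

definition upward_closed :: "('n \<Rightarrow>\<^sub>0 nat) set \<Rightarrow> bool" where
  "upward_closed M \<longleftrightarrow> (\<forall>m\<in>M. \<forall>k. m + k \<in> M)"

definition generated_upto :: "nat \<Rightarrow> ('n::finite \<Rightarrow>\<^sub>0 nat) set \<Rightarrow> bool" where
  "generated_upto d M \<longleftrightarrow> (\<forall>m\<in>M. \<exists>m'\<in>M. monom_degree m' \<le> d \<and> (\<exists>k. m = m' + k))"

text \<open>
  If no degree bound worked, there would be elements \<open>s d\<close> that are not divisible by any element of degree at
  most \<open>d\<close>; a subsequence that is monotone in every coordinate contradicts this.
\<close>

lemma dickson: "\<exists>d. generated_upto d (M :: ('n::finite \<Rightarrow>\<^sub>0 nat) set)"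
proof (rule ccontr)
  assume "\<not> ?thesis"
  then have "\<forall>d. \<exists>m\<in>M. \<forall>m'\<in>M. monom_degree m' \<le> d \<longrightarrow> (\<forall>k. m \<noteq> m' + k)"
    unfolding generated_upto_def by blast
  then obtain s where s: "\<And>d. s d \<in> M" "\<And>d m' k. m' \<in> M \<Longrightarrow> monom_degree m' \<le> d \<Longrightarrow> s d \<noteq> m' + k"
    by metis
  obtain q :: "nat \<Rightarrow> nat" where q: "strict_mono q"
    "\<And>i j k. j \<le> k \<Longrightarrow> Poly_Mapping.lookup (s (q j)) i \<le> Poly_Mapping.lookup (s (q k)) i"
    using monotone_subsequence_coordinates[of "UNIV :: 'n set" "\<lambda>k. Poly_Mapping.lookup (s k)"] by auto
  \<comment> \<open>The index \<open>q k \<ge> k\<close> is so large that \<open>s (q k)\<close> must not be divisible by \<open>s (q 0)\<close>.\<close>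
  define k where "k = monom_degree (s (q 0))"
  have "monom_degree (s (q 0)) \<le> q k" using seq_suble[OF q(1), of k] by (simp add: k_def)
  moreover have "s (q k) = s (q 0) + (s (q k) - s (q 0))"
    by (rule poly_mapping_eqI) (simp add: lookup_add lookup_minus q(2))
  ultimately show False using s(1)[of "q 0"] s(2)[of "s (q 0)" "q k"] by blast
qed

text \<open>
  Koenig's lemma for the tree of truncations: there are only finitely many sets of monomials of bounded degree,
  so some truncation in degree \<open>d + 1\<close> of infinitely many members extends the one chosen in degree \<open>d\<close>.
\<close>

lemma infinite_branch:
  fixes M :: "nat \<Rightarrow> ('n::finite \<Rightarrow>\<^sub>0 nat) set"
  shows "\<exists>N. \<forall>d. infinite {D. {m \<in> M D. monom_degree m \<le> d} = {m \<in> N. monom_degree m \<le> d}}"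
proof -
  define tr where "tr d X = {m \<in> X. monom_degree m \<le> d}" for d and X :: "('n \<Rightarrow>\<^sub>0 nat) set"
  have fin: "finite (tr d ` Z)" for d Z
    by (rule finite_subset[of _ "Pow {m. monom_degree m \<le> d}"]) (auto simp: tr_def finite_monomials)
  have tr_tr: "tr d (tr e X) = tr d X" if "d \<le> e" for d e X using that by (auto simp: tr_def)
  have "\<exists>T. \<forall>d. infinite {D. tr d (M D) = T d} \<and> tr d (T (Suc d)) = T d"
  proof (rule dependent_nat_choice)
    have "\<exists>a\<in>UNIV. infinite {D \<in> UNIV. tr 0 (M D) = tr 0 (M a)}"
      by (rule pigeonhole_infinite) (use fin[of 0 "range M"] in \<open>auto simp: image_image\<close>)
    then show "\<exists>x. infinite {D. tr 0 (M D) = x}" by auto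
  next
    fix x d assume inf: "infinite {D. tr d (M D) = x}"
    have "\<exists>a\<in>{D. tr d (M D) = x}. infinite {D \<in> {D. tr d (M D) = x}. tr (Suc d) (M D) = tr (Suc d) (M a)}"
      by (rule pigeonhole_infinite[OF inf]) (use fin[of "Suc d" "M ` {D. tr d (M D) = x}"] in \<open>auto simp: image_image\<close>)
    then obtain a where a: "tr d (M a) = x"
      "infinite {D \<in> {D. tr d (M D) = x}. tr (Suc d) (M D) = tr (Suc d) (M a)}" by blast
    have "infinite {D. tr (Suc d) (M D) = tr (Suc d) (M a)}"
      by (rule infinite_super[OF _ a(2)]) auto
    moreover have "tr d (tr (Suc d) (M a)) = x" using a(1) tr_tr[of d "Suc d"] by simp
    ultimately show "\<exists>y. infinite {D. tr (Suc d) (M D) = y} \<and> tr d y = x" by blast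
  qed
  then obtain T where T: "\<And>d. infinite {D. tr d (M D) = T d}" "\<And>d. tr d (T (Suc d)) = T d" by blast
  have T': "tr d (T (d + k)) = T d" for d k
  proof (induction k)
    case 0
    show ?case using T(2)[of d] tr_tr[of d d "T (Suc d)"] by simp
  next
    case (Suc k)
    then show ?case using T(2)[of "d + k"] tr_tr[of d "d + k" "T (Suc (d + k))"] by simp
  qed
  have "tr d (\<Union>e. T e) = T d" for d
  proof
    show "tr d (\<Union>e. T e) \<subseteq> T d"
    proof
      fix m assume "m \<in> tr d (\<Union>e. T e)"
      then obtain e where e: "m \<in> T e" "monom_degree m \<le> d" by (auto simp: tr_def)
      show "m \<in> T d"
      proof (cases "d \<le> e")
        case True
        then show ?thesis using T'[of d "e - d"] e by (auto simp: tr_def)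
      next
        case False
        then show ?thesis using T'[of e "d - e"] e by (auto simp: tr_def)
      qed
    qed
    show "T d \<subseteq> tr d (\<Union>e. T e)" using T'[of d 0] by (auto simp: tr_def)
  qed
  then show ?thesis using T(1) unfolding tr_def by (intro exI[of _ "\<Union>e. T e"]) simp
qed

text \<open>
  If ideals \<open>M D\<close> with the given Hilbert function needed generators of degree greater than \<open>D\<close> for each \<open>D\<close>, a limit \<open>N\<close>
  of them in the sense of \<open>infinite_branch\<close> would also be an ideal with this Hilbert function. It is generated in some
  degree \<open>d0\<close> by Dickson's lemma. A member \<open>M D\<close> that agrees with \<open>N\<close> up to degree \<open>d0 \<le> D\<close> contains \<open>N\<close>, and
  equals \<open>N\<close> because the Hilbert functions agree, a contradiction.
\<close>

lemma bounded_generation: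
  fixes H :: "nat \<Rightarrow> nat"
  shows "\<exists>D. \<forall>M :: ('n::finite \<Rightarrow>\<^sub>0 nat) set. upward_closed M \<longrightarrow>
           (\<forall>d. card {m \<in> M. monom_degree m = d} = H d) \<longrightarrow> generated_upto D M"
proof (rule ccontr)
  assume "\<not> ?thesis"
  then have "\<forall>D. \<exists>M :: ('n \<Rightarrow>\<^sub>0 nat) set. upward_closed M \<and>
      (\<forall>d. card {m \<in> M. monom_degree m = d} = H d) \<and> \<not> generated_upto D M" by blast
  from choice[OF this] obtain M :: "nat \<Rightarrow> ('n \<Rightarrow>\<^sub>0 nat) set" where
    M: "\<forall>D. upward_closed (M D) \<and> (\<forall>d. card {m \<in> M D. monom_degree m = d} = H d) \<and>
      \<not> generated_upto D (M D)" ..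
  then have up: "\<And>D. upward_closed (M D)"
    and H: "\<And>D d. card {m \<in> M D. monom_degree m = d} = H d"
    and bad: "\<And>D. \<not> generated_upto D (M D)" by auto
  obtain N where N: "\<And>d. infinite {D. {m \<in> M D. monom_degree m \<le> d} = {m \<in> N. monom_degree m \<le> d}}"
    using infinite_branch[of M] by blast
  have agree: "\<exists>D\<ge>e. \<forall>m. monom_degree m \<le> d \<longrightarrow> (m \<in> M D \<longleftrightarrow> m \<in> N)" for d e
  proof -
    obtain D where "D \<ge> e" "{m \<in> M D. monom_degree m \<le> d} = {m \<in> N. monom_degree m \<le> d}"
      using N[of d] unfolding infinite_nat_iff_unbounded_le by blast
    then show ?thesis by (auto simp: set_eq_iff)
  qed
  obtain d0 where d0: "generated_upto d0 N" using dickson by blast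
  obtain D where D: "d0 \<le> D" "\<And>m. monom_degree m \<le> d0 \<Longrightarrow> m \<in> M D \<longleftrightarrow> m \<in> N"
    using agree by metis
  have sub: "N \<subseteq> M D"
  proof
    fix m assume "m \<in> N"
    then obtain m' k where "m' \<in> N" "monom_degree m' \<le> d0" "m = m' + k"
      using d0 unfolding generated_upto_def by blast
    then show "m \<in> M D" using D(2) up unfolding upward_closed_def by blast
  qed
  have "{m \<in> N. monom_degree m = d} = {m \<in> M D. monom_degree m = d}" for d
  proof (rule card_subset_eq)
    show "finite {m \<in> M D. monom_degree m = d}"
      by (rule finite_subset[OF _ finite_monomials[of d]]) auto
    show "{m \<in> N. monom_degree m = d} \<subseteq> {m \<in> M D. monom_degree m = d}" using sub by blast
    obtain D' where "\<forall>m. monom_degree m \<le> d \<longrightarrow> (m \<in> M D' \<longleftrightarrow> m \<in> N)" using agree by blast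
    then have "{m \<in> N. monom_degree m = d} = {m \<in> M D'. monom_degree m = d}" by auto
    then show "card {m \<in> N. monom_degree m = d} = card {m \<in> M D. monom_degree m = d}"
      using H by simp
  qed
  then have "M D = N" by blast
  then show False using bad[of D] d0 D(1) unfolding generated_upto_def by (meson order_trans)
qed

section \<open>Graded ideals with a given Hilbert function\<close>

text \<open>
  Sending the variables to distinct primes gives an injective homomorphism from monomials to positive integers, by
  uniqueness of prime factorization. Comparing the values is a monomial order, and induction on them is induction on
  natural numbers.
\<close>

lemma monomial_order_exists:
  obtains \<kappa> :: "('n::finite \<Rightarrow>\<^sub>0 nat) \<Rightarrow> nat"
  where "inj \<kappa>" "\<And>m k. \<kappa> (m + k) = \<kappa> m * \<kappa> k" "\<And>m. \<kappa> m > 0"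
proof -
  obtain P where P: "finite P" "card P = CARD('n)" "P \<subseteq> {p :: nat. prime p}"
    using infinite_arbitrarily_large[OF primes_infinite] by blast
  then obtain p :: "'n \<Rightarrow> nat" where p: "bij_betw p UNIV P"
    using finite_same_card_bij[of "UNIV :: 'n set" P] by auto
  have prime: "prime (p i)" for i using p P(3) by (auto simp: bij_betw_def)
  have inj: "inj p" using p by (simp add: bij_betw_def)
  define \<kappa> where "\<kappa> m = (\<Prod>i\<in>UNIV. p i ^ Poly_Mapping.lookup m i)" for m :: "'n \<Rightarrow>\<^sub>0 nat"
  have "multiplicity (p j) (\<kappa> m) = Poly_Mapping.lookup m j" for m j
  proof -
    have "\<kappa> m = (\<Prod>q\<in>range p. q ^ Poly_Mapping.lookup m (inv p q))"
      unfolding \<kappa>_def using inj by (simp add: prod.reindex)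
    then show ?thesis
      using multiplicity_prod_prime_powers[of "range p" "p j" "\<lambda>q. Poly_Mapping.lookup m (inv p q)"] prime inj
      by auto
  qed
  then have "inj \<kappa>" by (intro injI poly_mapping_eqI) metis
  moreover have "\<kappa> (m + k) = \<kappa> m * \<kappa> k" for m k
    by (simp add: \<kappa>_def lookup_add power_add prod.distrib)
  moreover have "\<kappa> m > 0" for m
    unfolding \<kappa>_def by (intro prod_pos) (simp add: prime_gt_0_nat prime)
  ultimately show ?thesis using that by blast
qed

definition homogeneous :: "nat \<Rightarrow> ('n::finite, 'a::zero) mpoly \<Rightarrow> bool" where
  "homogeneous d f \<longleftrightarrow> Poly_Mapping.keys f \<subseteq> {m. monom_degree m = d}"

definition hpart :: "nat \<Rightarrow> ('n::finite, 'a::zero) mpoly set \<Rightarrow> ('n, 'a) mpoly set" where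
  "hpart d A = {f \<in> A. homogeneous d f}"

lemma homogeneousI: "(\<And>m. mcoeff f m \<noteq> 0 \<Longrightarrow> monom_degree m = d) \<Longrightarrow> homogeneous d f"
  by (auto simp: homogeneous_def in_keys_iff)

lemma homogeneousD: "homogeneous d f \<Longrightarrow> mcoeff f m \<noteq> 0 \<Longrightarrow> monom_degree m = d"
  by (auto simp: homogeneous_def in_keys_iff)

lemma mcoeff_homogeneous_component: "mcoeff (homogeneous_component d f) m = (if monom_degree m = d then mcoeff f m else 0)"
  by (simp add: homogeneous_component_def lookup_sum lookup_single when_def in_keys_iff)

lemma homogeneous_component_homogeneous: "homogeneous d (homogeneous_component d f)"
  by (rule homogeneousI) (simp add: mcoeff_homogeneous_component split: if_splits)

lemma sum_homogeneous_components:
  "f = (\<Sum>d\<in>monom_degree ` Poly_Mapping.keys f. homogeneous_component d f)"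
  by (rule poly_mapping_eqI) (auto simp: lookup_sum mcoeff_homogeneous_component in_keys_iff)

lemma ideal_closed:
  assumes "is_ideal A"
  shows "0 \<in> A" "f \<in> A \<Longrightarrow> g \<in> A \<Longrightarrow> f + g \<in> A" "f \<in> A \<Longrightarrow> g \<in> A \<Longrightarrow> f - g \<in> A" "f \<in> A \<Longrightarrow> r * f \<in> A"
  using assms ideal.subspace_0 ideal.subspace_add ideal.subspace_diff ideal.subspace_scale by blast+

lemma subspace_ideal: "is_ideal A \<Longrightarrow> mp.subspace A"
  unfolding mp.subspace_def by (auto intro: ideal_closed)

lemma subspace_hpart: "mp.subspace A \<Longrightarrow> mp.subspace (hpart d A)"
  unfolding mp.subspace_def hpart_def
  by (auto simp: lookup_add intro!: homogeneousI dest: homogeneousD) (metis add.right_neutral homogeneousD)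

lemma graded_idealD:
  "graded_ideal A \<Longrightarrow> is_ideal A" "graded_ideal A \<Longrightarrow> f \<in> A \<Longrightarrow> homogeneous_component d f \<in> hpart d A"
  by (simp_all add: graded_ideal_def hpart_def homogeneous_component_homogeneous)

lemma graded_ideal_subsetI:
  assumes "graded_ideal A" "is_ideal B" "\<And>d. hpart d A \<subseteq> B"
  shows "A \<subseteq> B"
proof
  fix f assume "f \<in> A"
  then have "(\<Sum>d\<in>monom_degree ` Poly_Mapping.keys f. homogeneous_component d f) \<in> B"
    using graded_idealD(2)[OF assms(1)] assms(3) by (intro ideal.subspace_sum assms(2)) blast
  then show "f \<in> B" using sum_homogeneous_components[of f] by simp
qed

lemma mcoeff_monomial_times:
  fixes f :: "('n, 'a::comm_ring_1) mpoly"
  shows "mcoeff (Poly_Mapping.single k 1 * f) (k + m) = mcoeff f m"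
    and "mcoeff (Poly_Mapping.single k 1 * f) e \<noteq> 0 \<Longrightarrow> \<exists>m. e = k + m \<and> mcoeff f m \<noteq> 0"
proof -
  show *: "mcoeff (Poly_Mapping.single k 1 * f) (k + m) = mcoeff f m" for m
    by (induction f rule: mpoly_induct)
      (simp_all add: distrib_left mult_single lookup_add lookup_single when_def)
  assume "mcoeff (Poly_Mapping.single k 1 * f) e \<noteq> 0"
  then have "e \<in> Poly_Mapping.keys (Poly_Mapping.single k 1 * f)" by (simp add: in_keys_iff)
  then obtain m where "e = k + m"
    using keys_mult[of "Poly_Mapping.single k 1" f] by (auto split: if_splits)
  then show "\<exists>m. e = k + m \<and> mcoeff f m \<noteq> 0"
    using * \<open>mcoeff (Poly_Mapping.single k 1 * f) e \<noteq> 0\<close> by metis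
qed

lemma homogeneous_monomial_times:
  "homogeneous d f \<Longrightarrow> homogeneous (monom_degree k + d) (Poly_Mapping.single k 1 * f)"
  for f :: "('n::finite, 'a::comm_ring_1) mpoly"
  by (rule homogeneousI) (metis mcoeff_monomial_times(2) homogeneousD monom_degree_add)

locale monomial_order =
  fixes \<kappa> :: "('n::finite \<Rightarrow>\<^sub>0 nat) \<Rightarrow> nat"
  assumes inj: "inj \<kappa>" and mult: "\<kappa> (m + k) = \<kappa> m * \<kappa> k" and pos: "\<kappa> m > 0"
begin

definition leading_set :: "('n, 'a::field) mpoly set \<Rightarrow> ('n \<Rightarrow>\<^sub>0 nat) set" where
  "leading_set A = (\<Union>d. leading_monomials \<kappa> (hpart d A))"

lemma leading_hpart_degree: "e \<in> leading_monomials \<kappa> (hpart d A) \<Longrightarrow> monom_degree e = d"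
  by (auto simp: leading_monomials_def hpart_def dest: homogeneousD)

lemma leading_set_degree: "{m \<in> leading_set A. monom_degree m = d} = leading_monomials \<kappa> (hpart d A)"
  by (auto simp: leading_set_def dest: leading_hpart_degree)

lemma leading_monomial_times:
  fixes f :: "('n, 'a::field) mpoly"
  assumes "mcoeff f e \<noteq> 0" "\<forall>e'. \<kappa> e < \<kappa> e' \<longrightarrow> mcoeff f e' = 0"
  shows "\<forall>e'. \<kappa> (k + e) < \<kappa> e' \<longrightarrow> mcoeff (Poly_Mapping.single k 1 * f) e' = 0"
proof (intro allI impI, rule ccontr)
  fix e' assume "\<kappa> (k + e) < \<kappa> e'" "mcoeff (Poly_Mapping.single k 1 * f) e' \<noteq> 0"
  then obtain m where "e' = k + m" "mcoeff f m \<noteq> 0" using mcoeff_monomial_times(2) by blast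
  then show False using \<open>\<kappa> (k + e) < \<kappa> e'\<close> assms(2) pos[of k] by (auto simp: mult)
qed

lemma upward_closed_leading_set:
  assumes "is_ideal A" shows "upward_closed (leading_set A)"
  unfolding upward_closed_def
proof (intro ballI allI)
  fix e k assume "e \<in> leading_set A"
  then obtain d f where f: "f \<in> A" "homogeneous d f" "mcoeff f e \<noteq> 0" "\<forall>e'. \<kappa> e < \<kappa> e' \<longrightarrow> mcoeff f e' = 0"
    by (auto simp: leading_set_def leading_monomials_def hpart_def)
  have "Poly_Mapping.single k 1 * f \<in> hpart (monom_degree k + d) A"
    using f(1,2) ideal_closed(4)[OF assms] homogeneous_monomial_times by (simp add: hpart_def)
  moreover have "mcoeff (Poly_Mapping.single k 1 * f) (k + e) \<noteq> 0" using f(3) mcoeff_monomial_times(1) by metis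
  ultimately show "e + k \<in> leading_set A"
    using leading_monomial_times[OF f(3,4), of k]
    unfolding leading_set_def leading_monomials_def add.commute[of e k] by blast
qed

text \<open>
  Division with remainder: a leading monomial of a homogeneous element of \<open>A\<close> is a multiple of the leading monomial of
  an element of \<open>A\<close> of degree at most \<open>D\<close>, which lies in \<open>B\<close>. Subtracting a multiple of that element lowers the leading
  monomial.
\<close>

lemma reduce_to_low_degrees:
  fixes A B :: "('n, 'a::field) mpoly set"
  assumes A: "graded_ideal A" and B: "is_ideal B"
    and gen: "generated_upto D (leading_set A)" and low: "\<And>d. d \<le> D \<Longrightarrow> hpart d A \<subseteq> B"
  shows "A \<subseteq> B"
proof (rule graded_ideal_subsetI[OF A B])
  fix d
  note A' = graded_idealD(1)[OF A]
  have "f \<in> B" if "f \<in> hpart d A" "\<And>m. mcoeff f m \<noteq> 0 \<Longrightarrow> \<kappa> m < N" for f N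
    using that
  proof (induction N arbitrary: f)
    case 0
    then have "f = 0" by (intro poly_mapping_eqI) auto
    then show ?case using ideal_closed(1)[OF B] by simp
  next
    case (Suc N)
    show ?case
    proof (cases "\<exists>e. mcoeff f e \<noteq> 0 \<and> \<kappa> e = N")
      case False
      then show ?thesis using Suc.prems by (intro Suc.IH) (auto simp: less_Suc_eq)
    next
      case True
      then obtain e where e: "mcoeff f e \<noteq> 0" "\<kappa> e = N" by blast
      have f: "f \<in> A" "homogeneous d f" using Suc.prems(1) by (simp_all add: hpart_def)
      have top: "\<forall>e'. \<kappa> e < \<kappa> e' \<longrightarrow> mcoeff f e' = 0" using Suc.prems(2) e(2) by force
      then have "e \<in> leading_set A"
        using Suc.prems(1) e(1) by (auto simp: leading_set_def leading_monomials_def)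
      then obtain m k where m: "m \<in> leading_set A" "monom_degree m \<le> D" "e = m + k"
        using gen by (auto simp: generated_upto_def)
      then have "m \<in> leading_monomials \<kappa> (hpart (monom_degree m) A)" using leading_set_degree by blast
      then obtain h where h: "h \<in> hpart (monom_degree m) A" "mcoeff h m \<noteq> 0"
        "\<forall>e'. \<kappa> m < \<kappa> e' \<longrightarrow> mcoeff h e' = 0"
        unfolding leading_monomials_def by blast
      have hB: "h \<in> B" using h(1) low[OF m(2)] by blast
      \<comment> \<open>The multiple of \<open>h\<close> with the same leading term as \<open>f\<close>.\<close>
      define c where "c = mcoeff f e / mcoeff h m"
      define g where "g = mconst c * (Poly_Mapping.single k 1 * h)"
      have g_coeff: "mcoeff g (k + x) = c * mcoeff h x" for x unfolding g_def mcoeff_scale mcoeff_monomial_times ..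
      have g0: "mcoeff g e' = 0" if "\<kappa> e < \<kappa> e'" for e'
        using leading_monomial_times[OF h(2,3), of k] that
        unfolding g_def mcoeff_scale by (simp add: m(3) add.commute)
      have gA: "g \<in> A" and gB: "g \<in> B"
        using h(1) hB unfolding g_def hpart_def by (blast intro: ideal_closed(4)[OF A'] ideal_closed(4)[OF B])+
      have "homogeneous (monom_degree k + monom_degree m) (Poly_Mapping.single k 1 * h)"
        using h(1) by (intro homogeneous_monomial_times) (simp add: hpart_def)
      moreover have "monom_degree k + monom_degree m = d"
        using homogeneousD[OF f(2) e(1)] by (simp add: m(3) monom_degree_add)
      ultimately have "homogeneous d g"
        unfolding g_def by (intro homogeneousI) (metis mcoeff_scale homogeneousD mult_zero_right)
      then have "f - g \<in> hpart d A"
        using f gA ideal_closed(3)[OF A'] unfolding hpart_def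
        by (auto simp: lookup_minus intro!: homogeneousI) (metis diff_0_right homogeneousD)
      moreover have "\<kappa> x < N" if x: "mcoeff (f - g) x \<noteq> 0" for x
      proof (rule ccontr)
        assume "\<not> \<kappa> x < N"
        moreover have "\<not> \<kappa> e < \<kappa> x" using x top g0 by (auto simp: lookup_minus)
        ultimately have "\<kappa> x = \<kappa> e" using e(2) by simp
        then have "x = e" using inj by (simp add: inj_eq)
        then show False
          using x g_coeff[of m] h(2) by (simp add: lookup_minus c_def m(3) add.commute)
      qed
      ultimately have "f - g \<in> B" by (rule Suc.IH)
      then have "(f - g) + g \<in> B" by (intro ideal_closed(2)[OF B] gB)
      then show ?thesis by simp
    qed
  qed note main = this
  show "hpart d A \<subseteq> B"
  proof
    fix f assume f: "f \<in> hpart d A"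
    have "\<kappa> m < Suc (\<Sum>m\<in>Poly_Mapping.keys f. \<kappa> m)" if "mcoeff f m \<noteq> 0" for m
      using member_le_sum[of m "Poly_Mapping.keys f" \<kappa>] that by (simp add: in_keys_iff less_Suc_eq_le)
    then show "f \<in> B" by (rule main[OF f])
  qed
qed

end

section \<open>Initial ideals as residues\<close>

lemma residue_monomial_times:
  assumes "integral_at \<omega> f"
    and h_def: "h = mconst (hmonom c (- wt \<omega> k)) * (Poly_Mapping.single k 1 * f)"
  shows "integral_at \<omega> h" "residue_at \<omega> h = mconst c * (Poly_Mapping.single k 1 * residue_at \<omega> f)"
proof -
  have h: "hcoeff (mcoeff h (k + m)) \<nu> = c * hcoeff (mcoeff f m) (\<nu> + wt \<omega> k)" for m \<nu>
    unfolding h_def mcoeff_scale mcoeff_monomial_times hcoeff_hmonom_times by simp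
  have zero: "mcoeff h e = 0" "mcoeff (Poly_Mapping.single k 1 * p) e = 0"
    if "\<nexists>m. e = k + m" for e and p :: "('a, 'b) mpoly"
    using that mcoeff_monomial_times(2) unfolding h_def mcoeff_scale by (metis mult_zero_right)+
  show "integral_at \<omega> h"
    unfolding integral_at_def
  proof
    fix e
    show "order_ge (mcoeff h e) (- wt \<omega> e)"
    proof (cases "\<exists>m. e = k + m")
      case True
      then obtain m where e: "e = k + m" ..
      have "order_ge (mcoeff f m) (- wt \<omega> m)" using assms(1) by (simp add: integral_at_def)
      then show ?thesis unfolding order_ge_def e h wt_add by simp
    qed (simp add: zero)
  qed
  show "residue_at \<omega> h = mconst c * (Poly_Mapping.single k 1 * residue_at \<omega> f)"
  proof (rule poly_mapping_eqI)
    fix e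
    show "mcoeff (residue_at \<omega> h) e = mcoeff (mconst c * (Poly_Mapping.single k 1 * residue_at \<omega> f)) e"
    proof (cases "\<exists>m. e = k + m")
      case True
      then obtain m where e: "e = k + m" ..
      show ?thesis unfolding e mcoeff_residue_at h mcoeff_scale mcoeff_monomial_times wt_add by simp
    next
      case False
      show ?thesis unfolding mcoeff_residue_at mcoeff_scale zero[OF False] by simp
    qed
  qed
qed

text \<open>
  Residues are closed under multiplication by \<open>x\<^sup>k\<close> because \<open>t\<^bsup>- wt \<omega> k\<^esup> x\<^sup>k\<close> has residue \<open>x\<^sup>k\<close>.
\<close>

lemma ideal_residues:
  assumes J: "is_ideal J" shows "is_ideal (residues \<omega> J)"
proof -
  have sub: "mp.subspace (residues \<omega> J)" by (rule subspace_residues[OF subspace_ideal[OF J]])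
  have "r * p \<in> residues \<omega> J" if p: "p \<in> residues \<omega> J" for r p
  proof (induction r rule: mpoly_induct)
    case zero
    then show ?case using mp.subspace_0[OF sub] by simp
  next
    case (add_single r k c)
    obtain f where f: "f \<in> J" "integral_at \<omega> f" "p = residue_at \<omega> f" using p by (auto simp: residues_def)
    have "mconst (hmonom c (- wt \<omega> k)) * (Poly_Mapping.single k 1 * f) \<in> J"
      by (intro ideal_closed(4)[OF J] f)
    then have "mconst c * (Poly_Mapping.single k 1 * p) \<in> residues \<omega> J"
      using residue_monomial_times[where c = c and k = k, OF f(2) refl] f(3) unfolding residues_def by (metis (mono_tags) imageI mem_Collect_eq)
    moreover have "Poly_Mapping.single k c = mconst c * Poly_Mapping.single k 1"
      by (simp add: mconst_def mult_single)
    ultimately have "Poly_Mapping.single k c * p \<in> residues \<omega> J" by simp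
    then show ?case using mp.subspace_add[OF sub _ add_single] by (simp add: distrib_right)
  qed
  then show ?thesis
    using mp.subspace_0[OF sub] mp.subspace_add[OF sub] by (simp add: ideal.subspace_def)
qed

text \<open>
  An initial form is the residue of \<open>t\<^bsup>- W\<^esup> f\<close>, where \<open>W\<close> is the weight of \<open>f\<close>. Conversely an integral polynomial of weight
  \<open>0\<close> has its initial form as residue, and one of positive weight has residue \<open>0\<close>. As the set of residues is already
  an ideal, it is the one generated by the initial forms.
\<close>

lemma initial_ideal_residues:
  assumes J: "is_ideal J" shows "initial_ideal \<omega> J = residues \<omega> J"
proof
  have "initial_form \<omega> f \<in> residues \<omega> J" if "f \<in> J" for f
  proof (cases "f = 0")
    case True
    then show ?thesis using ideal_closed(1)[OF ideal_residues[OF J]] by (simp add: initial_form_def)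
  next
    case False
    then show ?thesis
      using normalise_integral(1)[OF False] ideal_closed(4)[OF J that]
      unfolding initial_form_residue residues_def by blast
  qed
  then show "initial_ideal \<omega> J \<subseteq> residues \<omega> J"
    unfolding initial_ideal_def by (intro ideal.span_minimal ideal_residues[OF J]) blast
  show "residues \<omega> J \<subseteq> initial_ideal \<omega> J"
  proof
    fix p assume "p \<in> residues \<omega> J"
    then obtain f where f: "f \<in> J" "integral_at \<omega> f" "p = residue_at \<omega> f" by (auto simp: residues_def)
    show "p \<in> initial_ideal \<omega> J"
    proof (cases "p = 0")
      case True then show ?thesis by (simp add: initial_ideal_def ideal.span_zero)
    next
      case False
      then obtain m where m: "hcoeff (mcoeff f m) (- wt \<omega> m) \<noteq> 0"
        unfolding f(3) by (metis mcoeff_residue_at lookup_zero poly_mapping_eqI)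
      then have nz: "f \<noteq> 0" by auto
      \<comment> \<open>The non-zero residue shows that the weight is at most \<open>0\<close>, integrality that it is at least \<open>0\<close>.\<close>
      have "\<not> - wt \<omega> m < tropical_weight \<omega> f - wt \<omega> m"
        using tropical_weight_order(1)[OF nz, of m \<omega>] m unfolding order_ge_def by blast
      moreover obtain m' where "hcoeff (mcoeff f m') (tropical_weight \<omega> f - wt \<omega> m') \<noteq> 0"
        using tropical_weight_order(2)[OF nz] by blast
      then have "\<not> tropical_weight \<omega> f - wt \<omega> m' < - wt \<omega> m'"
        using f(2) unfolding integral_at_def order_ge_def by blast
      ultimately have "tropical_weight \<omega> f = 0" by simp
      then have "p = initial_form \<omega> f"
        unfolding initial_form_residue f(3)
        by (simp add: mconst_arith flip: one_hahn_def)
      then show ?thesis using f(1) unfolding initial_ideal_def by (simp add: ideal.span_base)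
    qed
  qed
qed

lemma residue_homogeneous_component:
  "homogeneous_component d (residue_at \<omega> f) = residue_at \<omega> (homogeneous_component d f)"
  by (rule poly_mapping_eqI) (simp add: mcoeff_homogeneous_component)

lemma integral_homogeneous_component:
  "integral_at \<omega> f \<Longrightarrow> integral_at \<omega> (homogeneous_component d f)"
  by (simp add: integral_at_def mcoeff_homogeneous_component)

lemma homogeneous_component_eq: "homogeneous d f \<Longrightarrow> homogeneous_component d f = f"
  by (rule poly_mapping_eqI) (auto simp: mcoeff_homogeneous_component dest: homogeneousD)

lemma graded_residues:
  assumes J: "graded_ideal J" shows "graded_ideal (residues \<omega> J)"
  unfolding graded_ideal_def
proof (intro conjI ballI allI)
  show "is_ideal (residues \<omega> J)" using J by (intro ideal_residues graded_idealD)
  fix p d assume "p \<in> residues \<omega> J"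
  then obtain f where f: "f \<in> J" "integral_at \<omega> f" "p = residue_at \<omega> f" by (auto simp: residues_def)
  moreover have "homogeneous_component d f \<in> J" using J f(1) by (simp add: graded_ideal_def)
  ultimately show "homogeneous_component d p \<in> residues \<omega> J"
    using integral_homogeneous_component[OF f(2), of d] unfolding residues_def
    by (auto simp: residue_homogeneous_component)
qed

lemma hpart_residues:
  assumes J: "graded_ideal J"
  shows "hpart d (residues \<omega> J) = residues \<omega> (hpart d J)"
proof
  show "hpart d (residues \<omega> J) \<subseteq> residues \<omega> (hpart d J)"
  proof
    fix p assume "p \<in> hpart d (residues \<omega> J)"
    then obtain f where f: "f \<in> J" "integral_at \<omega> f" "p = residue_at \<omega> f" "homogeneous d p"
      by (auto simp: residues_def hpart_def)
    have "p = residue_at \<omega> (homogeneous_component d f)"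
      using homogeneous_component_eq[OF f(4)] f(3) by (simp add: residue_homogeneous_component)
    then show "p \<in> residues \<omega> (hpart d J)"
      using graded_idealD(2)[OF J f(1)] integral_homogeneous_component[OF f(2)]
      unfolding residues_def by blast
  qed
  have "homogeneous d (residue_at \<omega> f)" if "homogeneous d f" for f
    using that by (intro homogeneousI) (metis mcoeff_residue_at homogeneousD zero_hahn.rep_eq)
  then show "residues \<omega> (hpart d J) \<subseteq> hpart d (residues \<omega> J)"
    by (auto simp: residues_def hpart_def)
qed

section \<open>The action of the general linear group\<close>

lemma msubst_zero: "msubst h 0 = 0"
  by (simp add: msubst_def meval_def)

lemma msubst_add: "msubst h (f + g) = msubst h f + msubst h g"
proof -
  let ?S = "Poly_Mapping.keys f \<union> Poly_Mapping.keys g"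
  have "msubst h u = (\<Sum>m\<in>?S. mconst (Poly_Mapping.lookup u m) *
      (\<Prod>i\<in>UNIV. h i ^ Poly_Mapping.lookup m i))" if "Poly_Mapping.keys u \<subseteq> ?S" for u
    unfolding msubst_def by (rule meval_superset) (use that in \<open>auto simp: mconst_arith\<close>)
  from this[of f] this[of g] this[of "f + g"] show ?thesis
    using keys_add[of f g] by (simp add: lookup_add mconst_arith distrib_right sum.distrib)
qed

lemma msubst_single:
  "msubst h (Poly_Mapping.single m d) = mconst d * (\<Prod>i\<in>UNIV. h i ^ Poly_Mapping.lookup m i)"
  by (simp add: msubst_def meval_def mconst_arith)

lemma msubst_single_times:
  "msubst h (Poly_Mapping.single k c * f) = mconst c * (\<Prod>i\<in>UNIV. h i ^ Poly_Mapping.lookup k i) * msubst h f"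
proof (induction f rule: mpoly_induct)
  case (add_single f m d)
  have "mconst (c * d) * (\<Prod>i\<in>UNIV. h i ^ (Poly_Mapping.lookup k i + Poly_Mapping.lookup m i)) =
      mconst c * (\<Prod>i\<in>UNIV. h i ^ Poly_Mapping.lookup k i) *
      (mconst d * (\<Prod>i\<in>UNIV. h i ^ Poly_Mapping.lookup m i))"
    unfolding mconst_arith power_add prod.distrib by (simp only: mult.assoc mult.left_commute)
  then show ?case
    using add_single by (simp add: distrib_left msubst_add mult_single msubst_single lookup_add)
qed (simp add: msubst_zero)

lemma msubst_mult: "msubst h (f * g) = msubst h f * msubst h g"
proof (induction f rule: mpoly_induct)
  case (add_single f m d)
  then show ?case by (simp add: distrib_right msubst_add msubst_single_times msubst_single)
qed (simp add: msubst_zero)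

lemma msubst_mconst: "msubst h (mconst c) = mconst c"
  by (simp add: mconst_def[of c] msubst_single)

lemma msubst_sum: "msubst h (\<Sum>x\<in>A. F x) = (\<Sum>x\<in>A. msubst h (F x))"
  by (induction A rule: infinite_finite_induct) (simp_all add: msubst_zero msubst_add)

lemma msubst_one: "msubst h 1 = 1"
  using msubst_mconst[of h 1] by (simp add: mconst_arith)

lemma msubst_prod: "msubst h (\<Prod>x\<in>A. F x) = (\<Prod>x\<in>A. msubst h (F x))"
  by (induction A rule: infinite_finite_induct) (simp_all add: msubst_one msubst_mult)

lemma msubst_power: "msubst h (f ^ n) = msubst h f ^ n"
  by (induction n) (simp_all add: msubst_one msubst_mult)

lemma msubst_mvar: "msubst h (mvar i) = h i"
proof -
  have "(\<Prod>j\<in>UNIV. h j ^ Poly_Mapping.lookup (Poly_Mapping.single i 1) j) =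
      (\<Prod>j\<in>UNIV. if j = i then h j else 1)"
    by (intro prod.cong) (auto simp: lookup_single when_def)
  also have "\<dots> = h i" by simp
  finally show ?thesis unfolding mvar_def msubst_single mconst_arith by simp
qed

lemma msubst_msubst: "msubst h (msubst k f) = msubst (\<lambda>i. msubst h (k i)) f"
  by (induction f rule: mpoly_induct)
    (simp_all add: msubst_zero msubst_add msubst_single msubst_mult msubst_mconst msubst_prod msubst_power)

lemma msubst_id: "msubst mvar f = f"
proof (induction f rule: mpoly_induct)
  case (add_single f m c)
  have "mconst c * Poly_Mapping.single m 1 = Poly_Mapping.single m c"
    by (simp add: mconst_def mult_single)
  then show ?case using add_single by (simp add: msubst_add msubst_single prod_mvar_power)
qed (simp add: msubst_zero)

lemma hmonom_zero_arith:
  "hmonom (0::'a::comm_ring_1) 0 = 0" "hmonom (a + b) 0 = hmonom a 0 + hmonom (b::'a) 0"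
  "hmonom (a * b) 0 = hmonom a 0 * hmonom (b::'a) 0"
  by (auto intro!: hahn_eqI simp: hcoeff_hmonom hcoeff_hmonom_times)

lemma hmonom_zero_sum: "hmonom (\<Sum>x\<in>A. F x) 0 = (\<Sum>x\<in>A. hmonom (F x :: 'a::comm_ring_1) 0)"
  by (induction A rule: infinite_finite_induct) (simp_all add: hmonom_zero_arith)

lemma mconst_sum: "mconst (\<Sum>x\<in>A. F x) = (\<Sum>x\<in>A. mconst (F x :: 'a::comm_ring_1))"
  by (induction A rule: infinite_finite_induct) (simp_all add: mconst_arith)

lemma GL_act_GL_act: "GL_act g (GL_act h f) = GL_act (g ** h) f"
proof -
  let ?x = "\<lambda>g i. \<Sum>j\<in>UNIV. mconst (hmonom (g $ j $ i) 0) * mvar j"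
  have "msubst (?x g) (?x h i) = ?x (g ** h) i" for i
  proof -
    have "msubst (?x g) (?x h i) =
        (\<Sum>j\<in>UNIV. \<Sum>k\<in>UNIV. mconst (hmonom (h $ j $ i) 0) * (mconst (hmonom (g $ k $ j) 0) * mvar k))"
      by (simp add: msubst_sum msubst_mult msubst_mconst msubst_mvar sum_distrib_left)
    also have "\<dots> = (\<Sum>k\<in>UNIV. \<Sum>j\<in>UNIV. mconst (hmonom (g $ k $ j * h $ j $ i) 0) * mvar k)"
      by (subst sum.swap, unfold mconst_arith hmonom_zero_arith)
        (simp only: mult.assoc mult.left_commute)
    also have "\<dots> = ?x (g ** h) i"
      by (simp add: matrix_matrix_mult_def hmonom_zero_sum mconst_sum sum_distrib_right)
    finally show ?thesis .
  qed
  then show ?thesis unfolding GL_act_def msubst_msubst by simp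
qed

lemma GL_act_one:
  fixes f :: "('n::finite, 'k::field hahn) mpoly"
  shows "GL_act (mat 1) f = f"
proof -
  have "(\<Sum>j\<in>UNIV. mconst (hmonom (mat 1 $ j $ i) 0) * mvar j) = (mvar i :: ('n, 'k hahn) mpoly)" for i
  proof -
    have "(\<Sum>j\<in>UNIV. mconst (hmonom (mat 1 $ j $ i) 0) * mvar j) =
        (\<Sum>j\<in>UNIV. if j = i then mvar j else (0 :: ('n, 'k hahn) mpoly))"
      by (intro sum.cong refl) (simp add: mat_def hmonom_zero_arith mconst_arith one_hahn_def[symmetric])
    then show ?thesis by simp
  qed
  then show ?thesis unfolding GL_act_def by (simp add: msubst_id)
qed

lemma GL_act_linear:
  "GL_act g (f + f') = GL_act g f + GL_act g f'" "GL_act g (mconst c * f) = mconst c * GL_act g f"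
  "GL_act g (f * f') = GL_act g f * GL_act g f'" "GL_act g 0 = 0"
  by (simp_all add: GL_act_def msubst_add msubst_mult msubst_mconst msubst_zero)

lemma invertible_GL_act:
  assumes "invertible g"
  shows "\<exists>h. (\<forall>f. GL_act g (GL_act h f) = f) \<and> (\<forall>f. GL_act h (GL_act g f) = f)"
proof -
  obtain h where h: "g ** h = mat 1" "h ** g = mat 1" using assms unfolding invertible_def by blast
  show ?thesis by (rule exI[of _ h]) (simp add: GL_act_GL_act h GL_act_one)
qed

lemma homogeneous_mult:
  "homogeneous d f \<Longrightarrow> homogeneous e g \<Longrightarrow> homogeneous (d + e) (f * g)"
  for f g :: "('n::finite, 'a::comm_ring_1) mpoly"
  using keys_mult[of f g] unfolding homogeneous_def by (fastforce simp: monom_degree_add)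

lemma homogeneous_sum:
  fixes F :: "'i \<Rightarrow> ('n::finite, 'a::comm_ring_1) mpoly"
  assumes "\<And>x. x \<in> A \<Longrightarrow> homogeneous d (F x)"
  shows "homogeneous d (\<Sum>x\<in>A. F x)"
proof (rule homogeneousI)
  fix m assume "mcoeff (\<Sum>x\<in>A. F x) m \<noteq> 0"
  then have "(\<Sum>x\<in>A. mcoeff (F x) m) \<noteq> 0" by (simp add: lookup_sum)
  then obtain x where "x \<in> A" "mcoeff (F x) m \<noteq> 0" by (rule sum.not_neutral_contains_not_neutral)
  then show "monom_degree m = d" using assms homogeneousD by blast
qed

lemma homogeneous_one: "homogeneous 0 (1 :: ('n::finite, 'a::comm_ring_1) mpoly)"
  by (rule homogeneousI) (simp add: lookup_one when_def monom_degree_def split: if_splits)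

lemma homogeneous_power: "homogeneous d f \<Longrightarrow> homogeneous (k * d) (f ^ k)"
  for f :: "('n::finite, 'a::comm_ring_1) mpoly"
  by (induction k) (auto simp: homogeneous_one intro: homogeneous_mult)

lemma homogeneous_prod:
  "finite A \<Longrightarrow> (\<And>x. x \<in> A \<Longrightarrow> homogeneous (D x) (F x)) \<Longrightarrow> homogeneous (\<Sum>x\<in>A. D x) (\<Prod>x\<in>A. F x)"
  for F :: "'i \<Rightarrow> ('n::finite, 'a::comm_ring_1) mpoly"
  by (induction A rule: finite_induct) (auto simp: homogeneous_one intro: homogeneous_mult)

lemma homogeneous_scl: "homogeneous d f \<Longrightarrow> homogeneous d (mconst c * f)"
  for f :: "('n::finite, 'a::comm_ring_1) mpoly"
  by (rule homogeneousI) (metis mcoeff_scale homogeneousD mult_zero_right)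

lemma homogeneous_mvar: "homogeneous 1 (mvar i :: ('n::finite, 'a::comm_ring_1) mpoly)"
  by (rule homogeneousI) (simp add: mvar_def lookup_single when_def monom_degree_def split: if_splits)

lemma homogeneous_GL_act:
  assumes "homogeneous d f" shows "homogeneous d (GL_act g f)"
proof -
  let ?x = "\<lambda>i. \<Sum>j\<in>UNIV. mconst (hmonom (g $ j $ i) 0) * mvar j"
  have x: "homogeneous 1 (?x i)" for i
    by (intro homogeneous_sum homogeneous_scl homogeneous_mvar)
  have "homogeneous (monom_degree m) (\<Prod>i\<in>UNIV. ?x i ^ Poly_Mapping.lookup m i)" for m
    using homogeneous_prod[of UNIV "\<lambda>i. Poly_Mapping.lookup m i" "\<lambda>i. ?x i ^ Poly_Mapping.lookup m i"]
      homogeneous_power[OF x] by (simp add: monom_degree_def)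
  then show ?thesis
    using assms unfolding GL_act_def msubst_def meval_def
    by (intro homogeneous_sum homogeneous_scl) (auto simp: homogeneous_def)
qed

lemma homogeneous_component_add:
  "homogeneous_component d (f + g) = homogeneous_component d f + homogeneous_component d g"
  by (rule poly_mapping_eqI) (simp add: mcoeff_homogeneous_component lookup_add)

lemma homogeneous_component_other: "homogeneous e f \<Longrightarrow> d \<noteq> e \<Longrightarrow> homogeneous_component d f = 0"
  by (rule poly_mapping_eqI) (auto simp: mcoeff_homogeneous_component dest: homogeneousD)

lemma homogeneous_component_GL_act:
  fixes f :: "('n::finite, 'k::field hahn) mpoly"
  shows "homogeneous_component d (GL_act g f) = GL_act g (homogeneous_component d f)"
proof (induction f rule: mpoly_induct)
  case zero
  have "homogeneous_component d 0 = (0 :: ('n, 'k hahn) mpoly)"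
    by (rule poly_mapping_eqI) (simp add: mcoeff_homogeneous_component)
  then show ?case by (simp add: GL_act_linear)
next
  case (add_single f m c)
  have m: "homogeneous (monom_degree m) (Poly_Mapping.single m c)"
    by (rule homogeneousI) (simp add: lookup_single when_def split: if_splits)
  note gm = homogeneous_GL_act[OF m, of g]
  have "homogeneous_component d (GL_act g (Poly_Mapping.single m c)) =
      GL_act g (homogeneous_component d (Poly_Mapping.single m c))"
    by (cases "d = monom_degree m")
      (simp_all add: homogeneous_component_eq m gm homogeneous_component_other[OF m]
        homogeneous_component_other[OF gm] GL_act_linear)
  then show ?case using add_single by (simp add: GL_act_linear homogeneous_component_add)
qed

lemma graded_ideal_GL_act:
  assumes I: "graded_ideal I" and g: "invertible g"
  shows "graded_ideal (GL_act g ` I)"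
proof -
  note I' = graded_idealD(1)[OF I]
  obtain h where "(\<forall>f. GL_act g (GL_act h f) = f) \<and> (\<forall>f. GL_act h (GL_act g f) = f)"
    using invertible_GL_act[OF g] ..
  then have h: "GL_act g (GL_act h f) = f" for f by simp
  have "r * GL_act g f \<in> GL_act g ` I" if "f \<in> I" for r f
    by (rule image_eqI[of _ "GL_act g" "GL_act h r * f" I])
      (simp_all only: GL_act_linear(3) h ideal_closed(4)[OF I' that])
  moreover have "0 \<in> GL_act g ` I"
    by (rule image_eqI[of 0 "GL_act g" 0 I]) (simp_all add: GL_act_linear(4) ideal_closed(1)[OF I'])
  moreover have "GL_act g f + GL_act g f' \<in> GL_act g ` I" if "f \<in> I" "f' \<in> I" for f f'
    by (rule image_eqI[of _ "GL_act g" "f + f'" I]) (simp_all add: GL_act_linear(1) ideal_closed(2)[OF I' that])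
  ultimately have "is_ideal (GL_act g ` I)" unfolding ideal.subspace_def by blast
  moreover have "homogeneous_component d (GL_act g f) \<in> GL_act g ` I" if "f \<in> I" for f d
    using that I by (simp add: homogeneous_component_GL_act graded_ideal_def)
  ultimately show ?thesis by (auto simp: graded_ideal_def)
qed

lemma hpart_GL_act:
  assumes I: "graded_ideal I"
  shows "hpart d (GL_act g ` I) = GL_act g ` hpart d I"
proof
  show "GL_act g ` hpart d I \<subseteq> hpart d (GL_act g ` I)"
    by (auto simp: hpart_def homogeneous_GL_act)
  show "hpart d (GL_act g ` I) \<subseteq> GL_act g ` hpart d I"
  proof
    fix p assume "p \<in> hpart d (GL_act g ` I)"
    then obtain f where f: "f \<in> I" "p = GL_act g f" "homogeneous d p" by (auto simp: hpart_def)
    then have "p = GL_act g (homogeneous_component d f)"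
      using homogeneous_component_eq[OF f(3)] by (simp add: homogeneous_component_GL_act)
    then show "p \<in> GL_act g ` hpart d I" using graded_idealD(2)[OF I f(1)] by blast
  qed
qed

definition monomials :: "nat \<Rightarrow> ('n::finite \<Rightarrow>\<^sub>0 nat) set" where
  "monomials d = {m. monom_degree m = d}"

lemma finite_monomials_degree: "finite (monomials d)"
  by (rule finite_subset[OF _ finite_monomials[of d]]) (auto simp: monomials_def)

lemma keys_hpart: "f \<in> hpart d A \<Longrightarrow> Poly_Mapping.keys f \<subseteq> monomials d"
  by (simp add: hpart_def homogeneous_def monomials_def)

lemma hpart_GL_act_span:
  fixes I :: "('n::finite, 'k::field hahn) mpoly set"
  assumes I: "graded_ideal I" and g: "invertible g" and B: "hpart d I = mp.span B"
  shows "hpart d (GL_act g ` I) = mp.span (GL_act g ` B)"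
proof
  have sub: "mp.subspace (hpart d (GL_act g ` I))"
    by (rule subspace_hpart[OF subspace_ideal[OF graded_idealD(1)[OF graded_ideal_GL_act[OF I g]]]])
  have "GL_act g ` B \<subseteq> hpart d (GL_act g ` I)"
    using mp.span_superset[of B] by (auto simp: hpart_GL_act[OF I] B)
  then show "mp.span (GL_act g ` B) \<subseteq> hpart d (GL_act g ` I)" by (rule mp.span_minimal[OF _ sub])
  have "mp.subspace {f. GL_act g f \<in> mp.span (GL_act g ` B)}"
    unfolding mp.subspace_def
    by (simp add: GL_act_linear(1,2,4) mp.span_zero mp.span_add mp.span_scale)
  then have "mp.span B \<subseteq> {f. GL_act g f \<in> mp.span (GL_act g ` B)}"
    by (rule mp.span_minimal[rotated]) (auto intro: mp.span_base)
  then show "hpart d (GL_act g ` I) \<subseteq> mp.span (GL_act g ` B)"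
    by (auto simp: hpart_GL_act[OF I] B)
qed

text \<open>
  The leading monomials of the degeneration are the pivots of a reduced basis of \<open>g(I)\<^sub>d\<close> itself; their number is the
  dimension of \<open>g(I)\<^sub>d\<close>, which is that of \<open>I\<^sub>d\<close>.
\<close>

lemma (in monomial_order) hilbert_function_initial:
  fixes I :: "('n, 'k::field hahn) mpoly set"
  assumes I: "graded_ideal I" and g: "invertible g"
  shows "card {m \<in> leading_set (residues \<omega> (GL_act g ` I)). monom_degree m = d} =
    card (leading_monomials \<kappa> (hpart d I))"
proof -
  let ?E = "monomials d :: ('n \<Rightarrow>\<^sub>0 nat) set"
  have E: "finite ?E" "inj_on \<kappa> ?E" using finite_monomials_degree inj by (auto intro: inj_on_subset)
  let ?J = "GL_act g ` I"
  have J: "graded_ideal ?J" by (rule graded_ideal_GL_act[OF I g])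
  have W: "mp.subspace (hpart d I)" "mp.subspace (hpart d ?J)"
    using subspace_hpart[OF subspace_ideal[OF graded_idealD(1)[OF I]]]
      subspace_hpart[OF subspace_ideal[OF graded_idealD(1)[OF J]]] by auto
  obtain b where b: "graph_basis (hpart d I) (leading_monomials \<kappa> (hpart d I)) b"
    using echelon_graph_basis[OF E W(1)] keys_hpart by metis
  obtain b' where b': "graph_basis (hpart d ?J) (leading_monomials \<kappa> (residues \<omega> (hpart d ?J))) b'"
    "leading_monomials \<kappa> (residues \<omega> (hpart d ?J)) \<subseteq> ?E"
    using residues_graph_basis_exists[OF E W(2) keys_hpart[of _ d ?J] refl] by metis
  have fin: "finite (leading_monomials \<kappa> (hpart d I))" "finite (leading_monomials \<kappa> (residues \<omega> (hpart d ?J)))"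
    using finite_subset[OF b'(2) E(1)] finite_subset[OF _ E(1), of "leading_monomials \<kappa> (hpart d I)"]
      leading_hpart_degree[of _ d I] by (auto simp: monomials_def)
  obtain h where "(\<forall>f. GL_act g (GL_act h f) = f) \<and> (\<forall>f. GL_act h (GL_act g f) = f)"
    using invertible_GL_act[OF g] ..
  then have h: "GL_act g (GL_act h f) = f" "GL_act h (GL_act g f) = f" for f by simp_all
  have h0: "GL_act g f = 0 \<Longrightarrow> f = 0" "GL_act h f = 0 \<Longrightarrow> f = 0" for f
    using h[of f] by (auto simp: GL_act_linear)
  have img: "GL_act g ` hpart d I \<subseteq> hpart d ?J" "GL_act h ` hpart d ?J \<subseteq> hpart d I"
    using h by (auto simp: hpart_GL_act[OF I])
  have "card (leading_monomials \<kappa> (hpart d I)) \<le> card (leading_monomials \<kappa> (residues \<omega> (hpart d ?J)))"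
    by (rule graph_basis_card_le[of "GL_act g", OF GL_act_linear(1,2) h0(1) W(1) b fin(1) W(2) b'(1) fin(2) img(1)])
  moreover have "card (leading_monomials \<kappa> (residues \<omega> (hpart d ?J))) \<le> card (leading_monomials \<kappa> (hpart d I))"
    by (rule graph_basis_card_le[of "GL_act h", OF GL_act_linear(1,2) h0(2) W(2) b'(1) fin(2) W(1) b fin(1) img(2)])
  ultimately show ?thesis by (simp add: leading_set_degree hpart_residues[OF J])
qed

section \<open>Generic elements of a subvariety\<close>

text \<open>
  The filter of generic elements of \<open>V\<close>: a property holds eventually if it holds on a non-empty open set.
  Irreducibility of \<open>V\<close> is what makes these properties closed under conjunction.
\<close>

definition generic :: "('k::field ^ 'n::finite ^ 'n) set \<Rightarrow> ('k ^ 'n ^ 'n) filter" where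
  "generic V = (INF U\<in>{U. openin (subtopology zariski_GL V) U \<and> U \<noteq> {}}. principal U)"

lemma subvariety_subset_GL: "GL_subvariety V \<Longrightarrow> V \<subseteq> {g. invertible g}"
  unfolding GL_subvariety_def zariski_GL_def by (auto dest!: closedin_subset)

lemma topspace_subvariety:
  assumes "GL_subvariety V"
  shows "topspace (subtopology zariski_GL V) = V" "V \<noteq> {}"
proof -
  show *: "topspace (subtopology zariski_GL V) = V"
    using subvariety_subset_GL[OF assms] by (auto simp: zariski_GL_def)
  show "V \<noteq> {}"
    using assms unfolding GL_subvariety_def irreducible_space_def * by blast
qed

lemma eventually_generic:
  assumes V: "GL_subvariety V"
  shows "eventually P (generic V) \<longleftrightarrow>
    (\<exists>U. openin (subtopology zariski_GL V) U \<and> U \<noteq> {} \<and> (\<forall>g\<in>U. P g))"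
proof -
  let ?X = "subtopology zariski_GL V"
  let ?B = "{U. openin ?X U \<and> U \<noteq> {}}"
  have inter: "U \<inter> U' \<noteq> {}" if U: "openin ?X U" "U \<noteq> {}" "openin ?X U'" "U' \<noteq> {}" for U U'
  proof
    assume disj: "U \<inter> U' = {}"
    have "(topspace ?X - U) \<union> (topspace ?X - U') = topspace ?X" using disj by blast
    moreover have "closedin ?X (topspace ?X - U)" "closedin ?X (topspace ?X - U')"
      using U by (intro closedin_diff closedin_topspace; simp)+
    ultimately have "topspace ?X - U = topspace ?X \<or> topspace ?X - U' = topspace ?X"
      using V unfolding GL_subvariety_def irreducible_space_def by blast
    then show False using U openin_subset[of ?X U] openin_subset[of ?X U'] by blast
  qed
  have "openin ?X (topspace ?X)" by (rule openin_topspace)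
  moreover have "topspace ?X \<noteq> {}" unfolding topspace_subvariety(1)[OF V] by (rule topspace_subvariety(2)[OF V])
  ultimately have "?B \<noteq> {}" by blast
  moreover have "\<exists>W\<in>?B. principal W \<le> inf (principal U) (principal U')" if "U \<in> ?B" "U' \<in> ?B" for U U'
    using that inter by (intro bexI[of _ "U \<inter> U'"]) auto
  ultimately have "eventually P (generic V) \<longleftrightarrow> (\<exists>U\<in>?B. eventually P (principal U))"
    unfolding generic_def by (rule eventually_INF_base)
  then show ?thesis by (auto simp: eventually_principal)
qed

lemma generic_nontrivial: "GL_subvariety V \<Longrightarrow> generic V \<noteq> bot"
  unfolding trivial_limit_def by (subst eventually_generic) auto

definition matrix_poly :: "('k::field ^ 'n::finite ^ 'n \<Rightarrow> 'k) \<Rightarrow> bool" where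
  "matrix_poly p \<longleftrightarrow> (\<exists>P. \<forall>A. p A = meval (\<lambda>c. c) (\<lambda>(i, j). A $ i $ j) P)"

lemma matrix_poly_const: "matrix_poly (\<lambda>_. c)"
  unfolding matrix_poly_def
  by (rule exI[of _ "Poly_Mapping.single 0 c"]) (simp add: meval_single)

lemma matrix_poly_entry: "matrix_poly (\<lambda>A. A $ i $ j)"
  unfolding matrix_poly_def
proof (intro exI allI)
  fix A :: "'a ^ 'b ^ 'b"
  let ?h = "\<lambda>(i, j). A $ i $ j"
  have "(\<Prod>x\<in>UNIV. ?h x ^ Poly_Mapping.lookup (Poly_Mapping.single (i, j) 1) x) =
      (\<Prod>x\<in>UNIV. if x = (i, j) then ?h x else 1)"
    by (intro prod.cong) (auto simp: lookup_single when_def)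
  also have "\<dots> = A $ i $ j" by simp
  finally show "A $ i $ j = meval (\<lambda>c. c) ?h (mvar (i, j))"
    unfolding mvar_def meval_single by simp
qed

lemma matrix_poly_add: "matrix_poly p \<Longrightarrow> matrix_poly q \<Longrightarrow> matrix_poly (\<lambda>A. p A + q A)"
  unfolding matrix_poly_def by (metis meval_add)

lemma matrix_poly_mult: "matrix_poly p \<Longrightarrow> matrix_poly q \<Longrightarrow> matrix_poly (\<lambda>A. p A * q A)"
  unfolding matrix_poly_def by (metis meval_mult)

lemma openin_nonvanishing:
  assumes V: "GL_subvariety V" and p: "matrix_poly p"
  shows "openin (subtopology zariski_GL V) {g \<in> V. p g \<noteq> 0}"
proof -
  obtain P where P: "\<And>A. p A = meval (\<lambda>c. c) (\<lambda>(i, j). A $ i $ j) P"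
    using p unfolding matrix_poly_def by blast
  have "{g. p g \<noteq> 0} = - matrix_zero_set {P}" by (auto simp: matrix_zero_set_def P)
  then have "openin zariski_matrix {g. p g \<noteq> 0}" unfolding openin_zariski_matrix by blast
  moreover have "{g \<in> V. p g \<noteq> 0} = {g. p g \<noteq> 0} \<inter> ({g. invertible g} \<inter> V)"
    using subvariety_subset_GL[OF V] by blast
  ultimately show ?thesis
    unfolding zariski_GL_def subtopology_subtopology openin_subtopology by blast
qed

section \<open>Polynomial and rational families\<close>

text \<open>
  The functions on matrices with values in the \<open>K\<close>-algebra given by \<open>\<iota>\<close> that are finite sums of polynomial
  functions times constants from the algebra. The algebras of interest are \<open>L\<close> and \<open>S\<^sub>L\<close>.
\<close>

inductive poly_family :: "('k::field \<Rightarrow> 'b::comm_ring_1) \<Rightarrow> ('k ^ 'n::finite ^ 'n \<Rightarrow> 'b) \<Rightarrow> bool"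
  for \<iota> where
  monomial: "matrix_poly p \<Longrightarrow> poly_family \<iota> (\<lambda>g. \<iota> (p g) * c)"
| add: "poly_family \<iota> u \<Longrightarrow> poly_family \<iota> v \<Longrightarrow> poly_family \<iota> (\<lambda>g. u g + v g)"

lemma poly_family_mult:
  assumes \<iota>: "\<And>a b. \<iota> (a * b) = \<iota> a * \<iota> b" and u: "poly_family \<iota> u" and v: "poly_family \<iota> v"
  shows "poly_family \<iota> (\<lambda>g. u g * v g)"
  using u
proof induction
  case (monomial p c)
  show ?case
    using v
  proof induction
    case (monomial q d)
    have "\<iota> (p g) * c * (\<iota> (q g) * d) = \<iota> (p g * q g) * (c * d)" for g
      unfolding \<iota> by (simp only: mult.assoc mult.left_commute)
    then show ?case
      using poly_family.monomial[where \<iota> = \<iota> and c = "c * d", OF matrix_poly_mult[OF \<open>matrix_poly p\<close> monomial]]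
      by (simp only:)
  next
    case (add v w)
    then show ?case unfolding distrib_left by (intro poly_family.add)
  qed
next
  case (add u w)
  then show ?case unfolding distrib_right by (intro poly_family.add)
qed

lemma poly_family_const:
  assumes "\<iota> 1 = 1" shows "poly_family \<iota> (\<lambda>_. c)"
  using poly_family.monomial[OF matrix_poly_const[of 1], of \<iota> c] assms by simp

lemma poly_family_sum:
  assumes "\<iota> 1 = 1" "finite A" "\<And>x. x \<in> A \<Longrightarrow> poly_family \<iota> (\<lambda>g. F x g)"
  shows "poly_family \<iota> (\<lambda>g. \<Sum>x\<in>A. F x g)"
  using assms(2,3)
  by (induction A rule: finite_induct) (auto intro: poly_family_const[of \<iota>, OF assms(1)] poly_family.add)

lemma poly_family_prod:
  assumes "\<And>a b. \<iota> (a * b) = \<iota> a * \<iota> b" "\<iota> 1 = 1" "finite A" "\<And>x. x \<in> A \<Longrightarrow> poly_family \<iota> (\<lambda>g. F x g)"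
  shows "poly_family \<iota> (\<lambda>g. \<Prod>x\<in>A. F x g)"
  using assms(3,4)
  by (induction A rule: finite_induct) (auto intro: poly_family_const[of \<iota>, OF assms(2)] poly_family_mult[of \<iota>, OF assms(1)])

lemma poly_family_power:
  assumes "\<And>a b. \<iota> (a * b) = \<iota> a * \<iota> b" "\<iota> 1 = 1" "poly_family \<iota> u"
  shows "poly_family \<iota> (\<lambda>g. u g ^ n)"
  by (induction n) (auto intro: poly_family_const[of \<iota>, OF assms(2)] poly_family_mult[of \<iota>, OF assms(1)] assms(3))

abbreviation scalar_family :: "('k::field ^ 'n::finite ^ 'n \<Rightarrow> 'k hahn) \<Rightarrow> bool" where
  "scalar_family \<equiv> poly_family (\<lambda>c. hmonom c 0)"

lemma scalar_embedding: "hmonom (1::'k::field) 0 = 1" "mconst (hmonom (1::'k) 0) = 1"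
  by (simp_all add: one_hahn_def[symmetric] mconst_arith)

lemma poly_family_GL_act:
  fixes f :: "('n::finite, 'k::field hahn) mpoly"
  shows "poly_family (\<lambda>c. mconst (hmonom c 0)) (\<lambda>g. GL_act g f)"
proof -
  let ?\<iota> = "\<lambda>c::'k. mconst (hmonom c 0) :: ('n, 'k hahn) mpoly"
  have hom: "?\<iota> (a * b) = ?\<iota> a * ?\<iota> b" for a b
    by (simp add: hmonom_zero_arith mconst_arith)
  note mult = poly_family_mult[of ?\<iota>, OF hom]
    and const = poly_family_const[of ?\<iota>, OF scalar_embedding(2)]
    and sum = poly_family_sum[of ?\<iota>, OF scalar_embedding(2)]
    and prod = poly_family_prod[of ?\<iota>, OF hom scalar_embedding(2)]
    and power = poly_family_power[of ?\<iota>, OF hom scalar_embedding(2)]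
  have lin: "poly_family ?\<iota> (\<lambda>g. \<Sum>j\<in>UNIV. mconst (hmonom (g $ j $ i) 0) * mvar j)" for i :: 'n
    by (intro sum finite poly_family.monomial matrix_poly_entry)
  have "poly_family ?\<iota> (\<lambda>g. mconst c *
      (\<Prod>i\<in>UNIV. (\<Sum>j\<in>UNIV. mconst (hmonom (g $ j $ i) 0) * mvar j) ^ Poly_Mapping.lookup m i))" for c m
    by (rule mult[OF const prod[OF finite power[OF lin]]])
  then show ?thesis unfolding GL_act_def msubst_def meval_def by (intro sum finite_keys)
qed

lemma poly_family_mcoeff:
  "poly_family (\<lambda>c. mconst (hmonom c 0)) u \<Longrightarrow> scalar_family (\<lambda>g. mcoeff (u g) m)"
proof (induction rule: poly_family.induct)
  case (monomial p c)
  then show ?case unfolding mcoeff_scale by (rule poly_family.monomial)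
next
  case (add u v)
  then show ?case unfolding lookup_add by (intro poly_family.add)
qed

text \<open>
  The finitely many constants of \<open>L\<close> that occur in a family bound its exponents uniformly by a well-ordered set.
\<close>

lemma scalar_family_coefficients:
  assumes "scalar_family \<phi>"
  shows "\<exists>A. well_ordered A \<and> (\<forall>g. hsupp (\<phi> g) \<subseteq> A) \<and> (\<forall>\<nu>. matrix_poly (\<lambda>g. hcoeff (\<phi> g) \<nu>))"
  using assms
proof induction
  case (monomial p c)
  show ?case
    by (rule exI[of _ "hsupp c"])
      (auto simp: hcoeff_hmonom_times well_ordered_hsupp intro: matrix_poly_mult monomial matrix_poly_const)
next
  case (add u v)
  obtain A where A: "well_ordered A \<and> (\<forall>g. hsupp (u g) \<subseteq> A) \<and> (\<forall>\<nu>. matrix_poly (\<lambda>g. hcoeff (u g) \<nu>))"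
    using add.IH(1) ..
  obtain B where B: "well_ordered B \<and> (\<forall>g. hsupp (v g) \<subseteq> B) \<and> (\<forall>\<nu>. matrix_poly (\<lambda>g. hcoeff (v g) \<nu>))"
    using add.IH(2) ..
  have "hsupp (u g + v g) \<subseteq> A \<union> B" for g
  proof
    fix \<nu> assume "\<nu> \<in> hsupp (u g + v g)"
    then have "\<nu> \<in> hsupp (u g) \<or> \<nu> \<in> hsupp (v g)" by auto
    then show "\<nu> \<in> A \<union> B" using A B by blast
  qed
  moreover have "matrix_poly (\<lambda>g. hcoeff (u g + v g) \<nu>)" for \<nu>
    using A B by (simp add: matrix_poly_add)
  moreover have "well_ordered (A \<union> B)" using A B by (simp add: well_ordered_Un)
  ultimately show ?case by (intro exI[of _ "A \<union> B"]) simp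
qed

text \<open>
  The generic valuation is the least exponent whose coefficient, a polynomial function, does not vanish identically
  on \<open>V\<close>; without such an exponent the family vanishes on \<open>V\<close>.
\<close>

lemma scalar_family_order:
  assumes V: "GL_subvariety V" and \<phi>: "scalar_family \<phi>"
  shows "eventually (\<lambda>g. \<phi> g = 0) (generic V) \<or> (\<exists>a. eventually (\<lambda>g. has_order (\<phi> g) a) (generic V))"
proof -
  obtain A where A: "well_ordered A" "\<And>g. hsupp (\<phi> g) \<subseteq> A" "\<And>\<nu>. matrix_poly (\<lambda>g. hcoeff (\<phi> g) \<nu>)"
    using scalar_family_coefficients[OF \<phi>] by blast
  define B where "B = {\<nu>. \<exists>g\<in>V. hcoeff (\<phi> g) \<nu> \<noteq> 0}"
  show ?thesis
  proof (cases "B = {}")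
    case True
    then have "\<phi> g = 0" if "g \<in> V" for g using that by (intro hahn_eqI) (auto simp: B_def)
    then show ?thesis
      using openin_topspace[of "subtopology zariski_GL V"] topspace_subvariety[OF V]
      unfolding eventually_generic[OF V] by metis
  next
    case False
    have "B \<subseteq> A" using A(2) by (auto simp: B_def)
    then obtain a where a: "a \<in> B" "\<And>\<nu>. \<nu> \<in> B \<Longrightarrow> a \<le> \<nu>"
      using False well_ordered_min[OF A(1), of B] by blast
    have "order_ge (\<phi> g) a" if "g \<in> V" for g
      unfolding order_ge_def using a(2) that by (force simp: B_def)
    then have "\<forall>g\<in>{g \<in> V. hcoeff (\<phi> g) a \<noteq> 0}. has_order (\<phi> g) a"
      by (simp add: has_order_def)
    moreover have "{g \<in> V. hcoeff (\<phi> g) a \<noteq> 0} \<noteq> {}" using a(1) by (auto simp: B_def)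
    ultimately show ?thesis
      using openin_nonvanishing[OF V A(3)] unfolding eventually_generic[OF V] by blast
  qed
qed

locale generic_family =
  fixes V :: "('k::field ^ 'n::finite ^ 'n) set"
  assumes V: "GL_subvariety V"
begin

text \<open>
  The families that agree with a quotient of polynomial ones near the generic point of \<open>V\<close>. Modulo generic equality they
  form a field, which plays the role of a function field of \<open>V\<close> with coefficients in \<open>L\<close>.
\<close>

definition rational :: "('k ^ 'n ^ 'n \<Rightarrow> 'k hahn) \<Rightarrow> bool" where
  "rational \<phi> \<longleftrightarrow> (\<exists>p q. scalar_family p \<and> scalar_family q \<and>
     eventually (\<lambda>g. q g \<noteq> 0 \<and> \<phi> g * q g = p g) (generic V))"

lemma rationalI:
  assumes "scalar_family p" "scalar_family q" "eventually (\<lambda>g. q g \<noteq> 0 \<and> \<phi> g * q g = p g) (generic V)"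
  shows "rational \<phi>"
  unfolding rational_def using assms by (intro exI conjI)

lemmas sf_mult = poly_family_mult[of "\<lambda>c. hmonom c 0", OF hmonom_zero_arith(3)]

lemmas sf_const = poly_family_const[of "\<lambda>c. hmonom c 0", OF scalar_embedding(1)]

lemma rational_scalar_family: "scalar_family \<phi> \<Longrightarrow> rational \<phi>"
  unfolding rational_def by (rule exI[of _ \<phi>], rule exI[of _ "\<lambda>_. 1"]) (simp add: sf_const)

lemma rational_add:
  assumes "rational \<phi>" "rational \<psi>" shows "rational (\<lambda>g. \<phi> g + \<psi> g)"
proof -
  obtain p q r s where *: "scalar_family p" "scalar_family q" "scalar_family r" "scalar_family s"
    and ev: "eventually (\<lambda>g. q g \<noteq> 0 \<and> \<phi> g * q g = p g) (generic V)"
      "eventually (\<lambda>g. s g \<noteq> 0 \<and> \<psi> g * s g = r g) (generic V)"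
    using assms unfolding rational_def by blast
  have "eventually (\<lambda>g. q g * s g \<noteq> 0 \<and> (\<phi> g + \<psi> g) * (q g * s g) = p g * s g + r g * q g) (generic V)"
    using ev
  proof eventually_elim
    case (elim g)
    have "\<phi> g * (q g * s g) = (\<phi> g * q g) * s g" "\<psi> g * (q g * s g) = (\<psi> g * s g) * q g"
      by (simp_all only: mult.assoc mult.left_commute mult.commute)
    then have "(\<phi> g + \<psi> g) * (q g * s g) = (\<phi> g * q g) * s g + (\<psi> g * s g) * q g"
      by (simp only: distrib_right)
    then show ?case using elim by (simp only: mult_eq_0_iff) blast
  qed
  then show ?thesis by (rule rationalI[rotated 2]) (intro poly_family.add sf_mult *)+
qed

lemma rational_mult:
  assumes "rational \<phi>" "rational \<psi>" shows "rational (\<lambda>g. \<phi> g * \<psi> g)"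
proof -
  obtain p q r s where *: "scalar_family p" "scalar_family q" "scalar_family r" "scalar_family s"
    and ev: "eventually (\<lambda>g. q g \<noteq> 0 \<and> \<phi> g * q g = p g) (generic V)"
      "eventually (\<lambda>g. s g \<noteq> 0 \<and> \<psi> g * s g = r g) (generic V)"
    using assms unfolding rational_def by blast
  have "eventually (\<lambda>g. q g * s g \<noteq> 0 \<and> (\<phi> g * \<psi> g) * (q g * s g) = p g * r g) (generic V)"
    using ev
  proof eventually_elim
    case (elim g)
    have "(\<phi> g * \<psi> g) * (q g * s g) = (\<phi> g * q g) * (\<psi> g * s g)"
      by (simp only: mult.assoc mult.left_commute)
    then show ?case using elim by (simp only: mult_eq_0_iff) blast
  qed
  then show ?thesis by (rule rationalI[rotated 2]) (intro sf_mult *)+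
qed

lemma rational_diff:
  assumes "rational \<phi>" "rational \<psi>" shows "rational (\<lambda>g. \<phi> g - \<psi> g)"
proof -
  have "rational (\<lambda>g. \<phi> g + (-1) * \<psi> g)"
    by (intro rational_add rational_mult assms rational_scalar_family sf_const)
  then show ?thesis by simp
qed

lemma rational_sum:
  assumes "finite A" "\<And>x. x \<in> A \<Longrightarrow> rational (\<lambda>g. F x g)"
  shows "rational (\<lambda>g. \<Sum>x\<in>A. F x g)"
  using assms
  by (induction A rule: finite_induct) (auto intro: rational_add rational_scalar_family sf_const)

lemma rational_order:
  assumes "rational \<phi>"
  shows "eventually (\<lambda>g. \<phi> g = 0) (generic V) \<or> (\<exists>a. eventually (\<lambda>g. has_order (\<phi> g) a) (generic V))"
proof -
  obtain p q where pq: "scalar_family p" "scalar_family q"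
    and ev: "eventually (\<lambda>g. q g \<noteq> 0 \<and> \<phi> g * q g = p g) (generic V)"
    using assms unfolding rational_def by blast
  have "\<not> eventually (\<lambda>g. q g = 0) (generic V)"
  proof
    assume "eventually (\<lambda>g. q g = 0) (generic V)"
    with ev have "eventually (\<lambda>g. False) (generic V)" by eventually_elim simp
    then show False using generic_nontrivial[OF V] by (simp add: trivial_limit_def)
  qed
  then obtain b where b: "eventually (\<lambda>g. has_order (q g) b) (generic V)"
    using scalar_family_order[OF V pq(2)] by blast
  from scalar_family_order[OF V pq(1)] show ?thesis
  proof
    assume "eventually (\<lambda>g. p g = 0) (generic V)"
    with ev have "eventually (\<lambda>g. \<phi> g = 0) (generic V)" by eventually_elim auto
    then show ?thesis ..
  next
    assume "\<exists>a. eventually (\<lambda>g. has_order (p g) a) (generic V)"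
    then obtain a where "eventually (\<lambda>g. has_order (p g) a) (generic V)" ..
    with ev b have "eventually (\<lambda>g. has_order (\<phi> g) (a - b)) (generic V)"
    proof eventually_elim
      case (elim g)
      have "\<phi> g \<noteq> 0" using elim by (auto simp: has_order_def)
      then obtain c where c: "has_order (\<phi> g) c" by (rule has_order_exists)
      have "has_order (p g) (c + b)" using has_order_mult[OF c elim(2)] elim(1) by simp
      then have "a = c + b" using elim(3) has_order_unique by blast
      then show ?case using c by simp
    qed
    then show ?thesis by blast
  qed
qed

lemma rational_inverse:
  assumes "rational \<phi>" shows "rational (\<lambda>g. inverse (\<phi> g))"
proof -
  obtain p q where pq: "scalar_family p" "scalar_family q"
    and ev: "eventually (\<lambda>g. q g \<noteq> 0 \<and> \<phi> g * q g = p g) (generic V)"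
    using assms unfolding rational_def by blast
  from rational_order[OF assms] show ?thesis
  proof
    assume "eventually (\<lambda>g. \<phi> g = 0) (generic V)"
    then have "eventually (\<lambda>g. (1::'k hahn) \<noteq> 0 \<and> inverse (\<phi> g) * 1 = 0) (generic V)" by eventually_elim simp
    then show ?thesis by (rule rationalI[rotated 2]) (rule sf_const)+
  next
    assume "\<exists>a. eventually (\<lambda>g. has_order (\<phi> g) a) (generic V)"
    then obtain a where "eventually (\<lambda>g. has_order (\<phi> g) a) (generic V)" ..
    with ev have "eventually (\<lambda>g. p g \<noteq> 0 \<and> inverse (\<phi> g) * p g = q g) (generic V)"
    proof eventually_elim
      case (elim g)
      have nz: "\<phi> g \<noteq> 0" using elim(2) by (auto simp: has_order_def)
      have "inverse (\<phi> g) * (\<phi> g * q g) = (inverse (\<phi> g) * \<phi> g) * q g" by (rule mult.assoc[symmetric])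
      then show ?case using elim(1) nz by auto
    qed
    then show ?thesis by (rule rationalI[OF pq(2,1)])
  qed
qed

lemma rational_orders_constant:
  assumes "rational \<phi>"
  shows "\<exists>Q. eventually (\<lambda>g. {\<nu>. has_order (\<phi> g) \<nu>} = Q) (generic V)"
  using rational_order[OF assms]
proof
  assume "eventually (\<lambda>g. \<phi> g = 0) (generic V)"
  then have "eventually (\<lambda>g. {\<nu>. has_order (\<phi> g) \<nu>} = {}) (generic V)"
    by eventually_elim (simp add: has_order_def)
  then show ?thesis ..
next
  assume "\<exists>a. eventually (\<lambda>g. has_order (\<phi> g) a) (generic V)"
  then obtain a where "eventually (\<lambda>g. has_order (\<phi> g) a) (generic V)" ..
  then have "eventually (\<lambda>g. {\<nu>. has_order (\<phi> g) \<nu>} = {a}) (generic V)"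
    by eventually_elim (auto dest: has_order_unique)
  then show ?thesis ..
qed

end

section \<open>Gaussian elimination over the generic point\<close>

text \<open>
  Subtracting multiples of \<open>v\<close> clears the \<open>x\<close>-coordinate of all generators.
\<close>

lemma span_eliminate:
  fixes u :: "'i \<Rightarrow> ('n, 'a::field) mpoly"
  assumes v: "v \<in> mp.span (u ` S)" "mcoeff v x = 1"
  shows "mp.span ((\<lambda>j. u j - mconst (mcoeff (u j) x) * v) ` S) = {f \<in> mp.span (u ` S). mcoeff f x = 0}"
proof
  let ?u = "\<lambda>j. u j - mconst (mcoeff (u j) x) * v"
  have "?u j \<in> {f \<in> mp.span (u ` S). mcoeff f x = 0}" if "j \<in> S" for j
    using that v mp.span_diff[OF mp.span_base[OF imageI[OF that, of u]] mp.span_scale[OF v(1)]]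
    by (simp add: lookup_minus)
  then show "mp.span (?u ` S) \<subseteq> {f \<in> mp.span (u ` S). mcoeff f x = 0}"
    by (intro mp.span_minimal subspace_zero_coeff) auto
  let ?Z = "{f. f - mconst (mcoeff f x) * v \<in> mp.span (?u ` S)}"
  have "mp.subspace ?Z"
    unfolding mp.subspace_def
  proof (intro conjI ballI allI)
    show "0 \<in> ?Z" by (simp add: mconst_arith mp.span_zero)
    fix f g assume fg: "f \<in> ?Z" "g \<in> ?Z"
    have "(f + g) - mconst (mcoeff (f + g) x) * v = (f - mconst (mcoeff f x) * v) + (g - mconst (mcoeff g x) * v)"
      unfolding lookup_add mconst_arith distrib_right by simp
    moreover have "\<dots> \<in> mp.span (?u ` S)" using fg by (intro mp.span_add) simp_all
    ultimately show "f + g \<in> ?Z" by (simp only: mem_Collect_eq)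
  next
    fix c f assume f: "f \<in> ?Z"
    have "mconst c * f - mconst (mcoeff (mconst c * f) x) * v = mconst c * (f - mconst (mcoeff f x) * v)"
      unfolding mcoeff_scale mp.scale_right_diff_distrib mp.scale_scale ..
    then show "mconst c * f \<in> ?Z" using f mp.span_scale by auto
  qed
  moreover have "u ` S \<subseteq> ?Z" by (auto intro: mp.span_base)
  ultimately have "mp.span (u ` S) \<subseteq> ?Z" by (intro mp.span_minimal)
  then show "{f \<in> mp.span (u ` S). mcoeff f x = 0} \<subseteq> mp.span (?u ` S)"
    by (auto simp: mconst_arith)
qed

lemma span_zero_coeff:
  assumes "\<And>i. i \<in> S \<Longrightarrow> mcoeff (u i) x = 0" "f \<in> mp.span (u ` S)"
  shows "mcoeff f x = 0"
proof -
  have "mp.span (u ` S) \<subseteq> {f \<in> UNIV. mcoeff f x = 0}"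
    using assms(1) by (intro mp.span_minimal subspace_zero_coeff) auto
  then show ?thesis using assms(2) by blast
qed

context generic_family begin

text \<open>
  Gaussian elimination over the field of rational families. Each test for a zero entry has a generic answer, so the
  elimination takes the same course for generic \<open>g\<close>; a step replaces every generator, including the one that provides
  the pivot, which becomes \<open>0\<close>, so that the index set \<open>S\<close> stays the same.
\<close>

lemma generic_graph_basis:
  fixes u :: "'i \<Rightarrow> 'k ^ 'n ^ 'n \<Rightarrow> ('n, 'k hahn) mpoly"
  assumes "finite T" "finite S" "finite E"
    and "\<And>i m. i \<in> S \<Longrightarrow> rational (\<lambda>g. mcoeff (u i g) m)"
    and "\<And>i g. i \<in> S \<Longrightarrow> Poly_Mapping.keys (u i g) \<subseteq> E"
  shows "eventually (\<lambda>g. \<nexists>b. graph_basis (mp.span ((\<lambda>i. u i g) ` S)) T b) (generic V) \<or>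
    (\<exists>b. eventually (\<lambda>g. graph_basis (mp.span ((\<lambda>i. u i g) ` S)) T (\<lambda>e. b e g)) (generic V) \<and>
      (\<forall>e\<in>T. \<forall>m. rational (\<lambda>g. mcoeff (b e g) m)))"
  using assms(1,4,5)
proof (induction T arbitrary: u rule: finite_induct)
  case empty
  show ?case
  proof (cases "\<forall>i\<in>S. \<forall>m\<in>E. eventually (\<lambda>g. mcoeff (u i g) m = 0) (generic V)")
    case True
    then have "eventually (\<lambda>g. \<forall>i\<in>S. \<forall>m\<in>E. mcoeff (u i g) m = 0) (generic V)"
      using assms(2,3) by (auto intro!: eventually_ball_finite)
    then have "eventually (\<lambda>g. graph_basis (mp.span ((\<lambda>i. u i g) ` S)) {} (\<lambda>e. 0)) (generic V)"
    proof eventually_elim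
      case (elim g)
      have "u i g = 0" if "i \<in> S" for i
        using elim that empty.prems(2)[OF that, of g] by (intro poly_mapping_eqI) (auto simp: in_keys_iff)
      then have "mp.span ((\<lambda>i. u i g) ` S) \<subseteq> {0}"
        by (intro mp.span_minimal) (auto simp: mp.subspace_def)
      then show ?case by (auto simp: graph_basis_def)
    qed
    then show ?thesis by auto
  next
    case False
    then obtain i m where im: "i \<in> S" "\<not> eventually (\<lambda>g. mcoeff (u i g) m = 0) (generic V)" by blast
    then obtain a where "eventually (\<lambda>g. has_order (mcoeff (u i g) m) a) (generic V)"
      using rational_order[OF empty.prems(1)] by blast
    then have "eventually (\<lambda>g. \<nexists>b. graph_basis (mp.span ((\<lambda>i. u i g) ` S)) {} b) (generic V)"
    proof eventually_elim
      case (elim g)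
      have "u i g \<noteq> 0" using elim by (auto simp: has_order_def)
      moreover have "u i g \<in> mp.span ((\<lambda>i. u i g) ` S)" using im(1) by (intro mp.span_base) auto
      ultimately show ?case by (auto simp: graph_basis_def)
    qed
    then show ?thesis ..
  qed
next
  case (insert x T)
  note rat = insert.prems(1) and keys = insert.prems(2)
  let ?W = "\<lambda>g. mp.span ((\<lambda>i. u i g) ` S)"
  show ?case
  proof (cases "\<forall>i\<in>S. eventually (\<lambda>g. mcoeff (u i g) x = 0) (generic V)")
    case True
    then have "eventually (\<lambda>g. \<forall>i\<in>S. mcoeff (u i g) x = 0) (generic V)"
      using assms(2) by (auto intro!: eventually_ball_finite)
    then have "eventually (\<lambda>g. \<nexists>b. graph_basis (?W g) (insert x T) b) (generic V)"
    proof eventually_elim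
      case (elim g)
      show ?case
      proof
        assume "\<exists>b. graph_basis (?W g) (insert x T) b"
        then obtain b where b: "graph_basis (?W g) (insert x T) b" ..
        have "mcoeff (b x) x = 0"
          using span_zero_coeff[of S "\<lambda>i. u i g" x "b x"] elim graph_basisD(1)[OF b, of x] by blast
        then show False using graph_basisD(2)[OF b, of x] by simp
      qed
    qed
    then show ?thesis ..
  next
    case False
    then obtain i where i: "i \<in> S" "\<not> eventually (\<lambda>g. mcoeff (u i g) x = 0) (generic V)" by blast
    then obtain a where a: "eventually (\<lambda>g. has_order (mcoeff (u i g) x) a) (generic V)"
      using rational_order[OF rat] by blast
    define v where "v g = mconst (inverse (mcoeff (u i g) x)) * u i g" for g
    \<comment> \<open>This family is \<open>0\<close> for the pivot index \<open>i\<close> and has vanishing \<open>x\<close>-coordinate for the others.\<close>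
    define u' where "u' j g = u j g - mconst (mcoeff (u j g) x) * v g" for j g
    have rat_v: "rational (\<lambda>g. mcoeff (v g) m)" for m
      unfolding v_def mcoeff_scale by (intro rational_mult rational_inverse rat i(1))
    have rat_u': "rational (\<lambda>g. mcoeff (u' j g) m)" if "j \<in> S" for j m
      unfolding u'_def lookup_minus mcoeff_scale by (intro rational_diff rational_mult rat rat_v that)
    have keys_u': "Poly_Mapping.keys (u' j g) \<subseteq> E" if "j \<in> S" for j g
    proof
      fix m assume "m \<in> Poly_Mapping.keys (u' j g)"
      moreover have "mcoeff (u' j g) m =
          mcoeff (u j g) m - mcoeff (u j g) x * (inverse (mcoeff (u i g) x) * mcoeff (u i g) m)"
        unfolding u'_def v_def lookup_minus mcoeff_scale ..
      ultimately have "mcoeff (u j g) m \<noteq> 0 \<or> mcoeff (u i g) m \<noteq> 0"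
        by (auto simp: in_keys_iff)
      then show "m \<in> E" using keys[OF that, of g] keys[OF i(1), of g] by (auto simp: in_keys_iff)
    qed
    have elim1: "eventually (\<lambda>g. v g \<in> ?W g \<and> mcoeff (v g) x = 1 \<and>
        mp.span ((\<lambda>j. u' j g) ` S) = {f \<in> ?W g. mcoeff f x = 0}) (generic V)"
      using a
    proof eventually_elim
      case (elim g)
      have nz: "mcoeff (u i g) x \<noteq> 0" using elim by (auto simp: has_order_def)
      have v: "v g \<in> ?W g" "mcoeff (v g) x = 1"
        using nz mp.span_scale[OF mp.span_base[OF imageI[OF i(1)]]] by (simp_all add: v_def)
      then show ?case using span_eliminate[OF v] by (simp add: u'_def)
    qed
    from insert.IH[of u', OF rat_u' keys_u'] show ?thesis
    proof
      assume "eventually (\<lambda>g. \<nexists>b. graph_basis (mp.span ((\<lambda>j. u' j g) ` S)) T b) (generic V)"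
      with elim1 have "eventually (\<lambda>g. \<nexists>b. graph_basis (?W g) (insert x T) b) (generic V)"
      proof eventually_elim
        case (elim g)
        show ?case
        proof
          assume "\<exists>b. graph_basis (?W g) (insert x T) b"
          then obtain b where b: "graph_basis (?W g) (insert x T) b" ..
          have "graph_basis (mp.span ((\<lambda>j. u' j g) ` S)) T b"
            using graph_basis_remove[OF b insert.hyps(2)] elim(1) by simp
          then show False using elim(2) by blast
        qed
      qed
      then show ?thesis ..
    next
      assume "\<exists>b. eventually (\<lambda>g. graph_basis (mp.span ((\<lambda>j. u' j g) ` S)) T (\<lambda>e. b e g)) (generic V) \<and>
        (\<forall>e\<in>T. \<forall>m. rational (\<lambda>g. mcoeff (b e g) m))"
      then obtain b where b: "eventually (\<lambda>g. graph_basis (mp.span ((\<lambda>j. u' j g) ` S)) T (\<lambda>e. b e g)) (generic V)"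
        and rat_b: "\<And>e m. e \<in> T \<Longrightarrow> rational (\<lambda>g. mcoeff (b e g) m)" by blast
      define w where "w g = v g - (\<Sum>e\<in>T. mconst (mcoeff (v g) e) * b e g)" for g
      have "rational (\<lambda>g. mcoeff (w g) m)" for m
        unfolding w_def lookup_minus lookup_sum mcoeff_scale
        by (intro rational_diff rational_sum rational_mult rat_v rat_b insert.hyps(1))
      then have rat_bw: "rational (\<lambda>g. mcoeff ((b(x := w)) e g) m)" if "e \<in> insert x T" for e m
        using that rat_b by auto
      from elim1 b have "eventually (\<lambda>g. graph_basis (?W g) (insert x T) (\<lambda>e. (b(x := w)) e g)) (generic V)"
      proof eventually_elim
        case (elim g)
        have "(\<lambda>e. (b(x := w)) e g) = (\<lambda>e. b e g)(x := v g - (\<Sum>e\<in>T. mconst (mcoeff (v g) e) * b e g))"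
          by (auto simp: w_def)
        then show ?case
          using graph_basis_insert[OF mp.subspace_span, of "v g" "(\<lambda>i. u i g) ` S" x T "\<lambda>e. b e g"]
            elim insert.hyps by simp
      qed
      then show ?thesis using rat_bw by blast
    qed
  qed
qed

lemma eventually_GL: "eventually (\<lambda>g. invertible g) (generic V)"
  using openin_topspace[of "subtopology zariski_GL V"] topspace_subvariety[OF V] subvariety_subset_GL[OF V]
  unfolding eventually_generic[OF V] by (metis mem_Collect_eq subsetD)

text \<open>
  The space \<open>g(I)\<^sub>d\<close> is spanned by the images of a basis of \<open>I\<^sub>d\<close>, which are polynomial families, so its reduced basis
  consists of rational families, and these have generically constant valuations.
\<close>

lemma generic_basis_orders:
  fixes I :: "('n, 'k hahn) mpoly set"
  assumes I: "graded_ideal I" and T: "finite T"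
  shows "\<exists>Q. eventually (\<lambda>g. basis_orders (hpart d (GL_act g ` I)) T = Q) (generic V)"
proof -
  let ?E = "monomials d :: ('n \<Rightarrow>\<^sub>0 nat) set"
  have E: "finite ?E" by (rule finite_monomials_degree)
  obtain \<kappa> :: "('n \<Rightarrow>\<^sub>0 nat) \<Rightarrow> nat" where \<kappa>: "inj_on \<kappa> ?E"
    using finite_imp_inj_to_nat_seg[OF E] by blast
  have subI: "mp.subspace (hpart d I)"
    by (rule subspace_hpart[OF subspace_ideal[OF graded_idealD(1)[OF I]]])
  obtain c where c: "graph_basis (hpart d I) (leading_monomials \<kappa> (hpart d I)) c"
    using echelon_graph_basis[OF E \<kappa> subI] keys_hpart by metis
  define S where "S = leading_monomials \<kappa> (hpart d I)"
  have "S \<subseteq> ?E"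
  proof
    fix e assume "e \<in> S"
    then obtain f where "f \<in> hpart d I" "e \<in> Poly_Mapping.keys f"
      unfolding S_def leading_monomials_def in_keys_iff by blast
    then show "e \<in> ?E" using keys_hpart by blast
  qed
  then have S: "finite S" using E finite_subset by blast
  define u where "u e g = GL_act g (c e)" for e and g :: "'k ^ 'n ^ 'n"
  have span: "hpart d (GL_act g ` I) = mp.span ((\<lambda>e. u e g) ` S)" if "invertible g" for g
    using hpart_GL_act_span[OF I that graph_basis_span[OF subI c]] S
    by (simp add: u_def S_def image_image)
  have "rational (\<lambda>g. mcoeff (u e g) m)" for e m
    unfolding u_def by (intro rational_scalar_family poly_family_mcoeff poly_family_GL_act)
  moreover have "Poly_Mapping.keys (u e g) \<subseteq> ?E" if "e \<in> S" for e g
    using graph_basisD(1)[OF c] that homogeneous_GL_act[of d "c e" g]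
    by (simp add: u_def S_def hpart_def homogeneous_def monomials_def)
  ultimately have "eventually (\<lambda>g. \<nexists>b. graph_basis (mp.span ((\<lambda>i. u i g) ` S)) T b) (generic V) \<or>
    (\<exists>b. eventually (\<lambda>g. graph_basis (mp.span ((\<lambda>i. u i g) ` S)) T (\<lambda>e. b e g)) (generic V) \<and>
      (\<forall>e\<in>T. \<forall>m. rational (\<lambda>g. mcoeff (b e g) m)))"
    by (intro generic_graph_basis[OF T S E]) auto
  then show ?thesis
  proof
    assume "eventually (\<lambda>g. \<nexists>b. graph_basis (mp.span ((\<lambda>i. u i g) ` S)) T b) (generic V)"
    with eventually_GL have "eventually (\<lambda>g. basis_orders (hpart d (GL_act g ` I)) T = {}) (generic V)"
      by eventually_elim (simp add: basis_orders_def span)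
    then show ?thesis ..
  next
    assume "\<exists>b. eventually (\<lambda>g. graph_basis (mp.span ((\<lambda>i. u i g) ` S)) T (\<lambda>e. b e g)) (generic V) \<and>
      (\<forall>e\<in>T. \<forall>m. rational (\<lambda>g. mcoeff (b e g) m))"
    then obtain b where b: "eventually (\<lambda>g. graph_basis (mp.span ((\<lambda>i. u i g) ` S)) T (\<lambda>e. b e g)) (generic V)"
      and rat: "\<And>e m. e \<in> T \<Longrightarrow> rational (\<lambda>g. mcoeff (b e g) m)" by blast
    have "\<forall>e\<in>T. \<forall>m. \<exists>Q. eventually (\<lambda>g. {\<nu>. has_order (mcoeff (b e g) m) \<nu>} = Q) (generic V)"
      using rational_orders_constant rat by blast
    then obtain Q where Q: "\<And>e m. e \<in> T \<Longrightarrow>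
        eventually (\<lambda>g. {\<nu>. has_order (mcoeff (b e g) m) \<nu>} = Q e m) (generic V)" by metis
    have "eventually (\<lambda>g. \<forall>e\<in>T. \<forall>m\<in>?E. {\<nu>. has_order (mcoeff (b e g) m) \<nu>} = Q e m) (generic V)"
      using T E Q by (auto intro!: eventually_ball_finite)
    with eventually_GL b have "eventually (\<lambda>g. basis_orders (hpart d (GL_act g ` I)) T =
        {{(e, m, \<nu>). e \<in> T \<and> m \<in> ?E \<and> \<nu> \<in> Q e m}}) (generic V)"
    proof eventually_elim
      case (elim g)
      let ?W = "hpart d (GL_act g ` I)"
      have bg: "graph_basis ?W T (\<lambda>e. b e g)" using elim(1,2) by (simp add: span)
      have sub: "mp.subspace ?W" using elim(1) by (simp add: span mp.subspace_span)
      have same: "{(e, m, \<nu>). e \<in> T \<and> has_order (mcoeff (b' e) m) \<nu>} =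
          {(e, m, \<nu>). e \<in> T \<and> m \<in> ?E \<and> \<nu> \<in> Q e m}" if b': "graph_basis ?W T b'" for b'
      proof -
        have "has_order (mcoeff (b' e) m) \<nu> \<longleftrightarrow> m \<in> ?E \<and> \<nu> \<in> Q e m" if e: "e \<in> T" for e m \<nu>
        proof (cases "m \<in> ?E")
          case True
          then show ?thesis using graph_basis_unique[OF sub b' bg e] elim(3) e by auto
        next
          case False
          then have "mcoeff (b' e) m = 0"
            using keys_hpart[OF graph_basisD(1)[OF b' e]] by (auto simp: in_keys_iff)
          then show ?thesis using False by (simp add: has_order_def)
        qed
        then show ?thesis by auto
      qed
      show ?case
      proof (intro equalityI subsetI)
        fix Y assume "Y \<in> basis_orders ?W T"
        then obtain b' where b': "graph_basis ?W T b'"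
          and Y: "Y = {(e, m, \<nu>). e \<in> T \<and> has_order (mcoeff (b' e) m) \<nu>}"
          by (auto simp: basis_orders_def)
        show "Y \<in> {{(e, m, \<nu>). e \<in> T \<and> m \<in> ?E \<and> \<nu> \<in> Q e m}}"
          unfolding Y same[OF b'] by simp
      next
        fix Y assume "Y \<in> {{(e, m, \<nu>). e \<in> T \<and> m \<in> ?E \<and> \<nu> \<in> Q e m}}"
        then have "Y = {(e, m, \<nu>). e \<in> T \<and> has_order (mcoeff (b e g) m) \<nu>}"
          unfolding same[OF bg] by simp
        then show "Y \<in> basis_orders ?W T"
          unfolding basis_orders_def by (intro CollectI exI[of _ "\<lambda>e. b e g"] conjI bg)
      qed
    qed
    then show ?thesis ..
  qed
qed

end

section \<open>The Groebner complex after a generic coordinate change\<close>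

theorem theorem5p1:
  fixes I :: "('n::finite, 'k::alg_closed_field hahn) mpoly set"
    and V :: "('k ^ 'n ^ 'n) set"
  assumes "graded_ideal I"
    and "GL_subvariety V"
  shows "\<exists>U. openin (subtopology zariski_GL V) U \<and> U \<noteq> {} \<and>
           (\<exists>C. \<forall>g\<in>U. groebner_complex (GL_act g ` I) = C)"
proof -
  interpret generic_family V by standard (rule assms(2))
  obtain \<kappa> :: "('n \<Rightarrow>\<^sub>0 nat) \<Rightarrow> nat" where "inj \<kappa>" "\<And>m k. \<kappa> (m + k) = \<kappa> m * \<kappa> k" "\<And>m. \<kappa> m > 0"
    using monomial_order_exists by blast
  then interpret monomial_order \<kappa> by unfold_locales
  obtain D where D: "\<And>M :: ('n \<Rightarrow>\<^sub>0 nat) set. upward_closed M \<Longrightarrow>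
      (\<And>d. card {m \<in> M. monom_degree m = d} = card (leading_monomials \<kappa> (hpart d I))) \<Longrightarrow> generated_upto D M"
    using bounded_generation[of "\<lambda>d. card (leading_monomials \<kappa> (hpart d I))"] by blast
  let ?J = "\<lambda>g. GL_act g ` I"
  let ?\<Sigma> = "SIGMA d:{..D}. Pow (monomials d :: ('n \<Rightarrow>\<^sub>0 nat) set)"
  define Q where "Q d T = (SOME Q. eventually (\<lambda>g. basis_orders (hpart d (?J g)) T = Q) (generic V))" for d T
  have Q: "eventually (\<lambda>g. basis_orders (hpart d (?J g)) T = Q d T) (generic V)" if "T \<subseteq> monomials d" for d T
    unfolding Q_def
    by (rule someI_ex[OF generic_basis_orders[OF assms(1) finite_subset[OF that finite_monomials_degree]]])
  have "finite ?\<Sigma>" by (intro finite_SigmaI) (auto simp: finite_monomials_degree)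
  then have "eventually (\<lambda>g. \<forall>(d, T)\<in>?\<Sigma>. basis_orders (hpart d (?J g)) T = Q d T) (generic V)"
    using Q by (intro eventually_ball_finite) auto
  with eventually_GL have "eventually (\<lambda>g. invertible g \<and>
      (\<forall>(d, T)\<in>?\<Sigma>. basis_orders (hpart d (?J g)) T = Q d T)) (generic V)"
    by eventually_elim blast
  then obtain U where U: "openin (subtopology zariski_GL V) U" "U \<noteq> {}"
    and UQ: "\<forall>g\<in>U. invertible g \<and> (\<forall>(d, T)\<in>?\<Sigma>. basis_orders (hpart d (?J g)) T = Q d T)"
    unfolding eventually_generic[OF assms(2)] by blast
  have inv: "invertible g" if "g \<in> U" for g using UQ that by blast
  have orders: "basis_orders (hpart d (?J g)) T = Q d T" if "g \<in> U" "d \<le> D" "T \<subseteq> monomials d" for g d T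
    using UQ that by auto
  have J: "graded_ideal (?J g)" "mp.subspace (hpart d (?J g))"
    "\<And>\<omega>. initial_ideal \<omega> (?J g) = residues \<omega> (?J g)"
    "\<And>\<omega>. graded_ideal (residues \<omega> (?J g))"
    "\<And>\<omega>. generated_upto D (leading_set (residues \<omega> (?J g)))" if "g \<in> U" for g d
  proof -
    show *: "graded_ideal (?J g)" using graded_ideal_GL_act[OF assms(1) inv[OF that]] .
    show "mp.subspace (hpart d (?J g))" using * by (intro subspace_hpart subspace_ideal graded_idealD)
    fix \<omega>
    show "initial_ideal \<omega> (?J g) = residues \<omega> (?J g)" using * by (intro initial_ideal_residues graded_idealD)
    show **: "graded_ideal (residues \<omega> (?J g))" using * by (rule graded_residues)
    show "generated_upto D (leading_set (residues \<omega> (?J g)))"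
      using hilbert_function_initial[OF assms(1) inv[OF that]] ** 
      by (intro D upward_closed_leading_set graded_idealD) auto
  qed
  have transfer: "residues \<omega> (?J h) \<subseteq> residues \<omega>' (?J h)"
    if g: "g \<in> U" and h: "h \<in> U" and eq: "residues \<omega> (?J g) = residues \<omega>' (?J g)" for g h \<omega> \<omega>'
  proof (rule reduce_to_low_degrees[OF J(4)[OF h] graded_idealD(1)[OF J(4)[OF h]] J(5)[OF h]])
    fix d assume d: "d \<le> D"
    have low: "residues \<omega> (hpart d (?J g)) = residues \<omega>' (hpart d (?J g))"
      using eq by (simp add: hpart_residues[OF J(1)[OF g], symmetric])
    have "basis_orders (hpart d (?J g)) T = basis_orders (hpart d (?J h)) T" if "T \<subseteq> monomials d" for T
      by (simp add: orders g h d that)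
    from residues_eq_transfer[OF finite_monomials_degree J(2)[OF g] keys_hpart[of _ d "?J g"] J(2)[OF h] this low]
    have "residues \<omega> (hpart d (?J h)) = residues \<omega>' (hpart d (?J h))" by blast
    then have "hpart d (residues \<omega> (?J h)) = hpart d (residues \<omega>' (?J h))"
      by (simp add: hpart_residues[OF J(1)[OF h]])
    then show "hpart d (residues \<omega> (?J h)) \<subseteq> residues \<omega>' (?J h)" by (auto simp: hpart_def)
  qed
  have "residues \<omega> (?J h) = residues \<omega>' (?J h)"
    if "g \<in> U" "h \<in> U" "residues \<omega> (?J g) = residues \<omega>' (?J g)" for g h \<omega> \<omega>'
    by (rule equalityI[OF transfer[OF that] transfer[OF that(1,2) that(3)[symmetric]]])
  note eq_transfer = this
  have same: "(residues \<omega>' (?J g) = residues \<omega> (?J g)) = (residues \<omega>' (?J h) = residues \<omega> (?J h))"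
    if "g \<in> U" "h \<in> U" for g h \<omega> \<omega>'
    by (rule iffI[OF eq_transfer[OF that] eq_transfer[OF that(2,1)]])
  have "groebner_complex (?J g) = groebner_complex (?J h)" if "g \<in> U" "h \<in> U" for g h
    unfolding groebner_complex_def J(3)[OF that(1)] J(3)[OF that(2)] same[OF that] ..
  moreover obtain h where "h \<in> U" using U(2) by blast
  ultimately have "\<forall>g\<in>U. groebner_complex (?J g) = groebner_complex (?J h)" by blast
  then show ?thesis using U by (intro exI conjI)
qed

end
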